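(* Let $\tau:\mathcal{D}\to\mathcal{D}$ be a bijection and let $X$ be a complex UMD-space. If there exists a $p\in(1,\infty)$ with $p\neq 2$ such that $$\|\mathrm{Id}_X\otimes T_{p,\tau}: L^p_{X,0}\to L^p_X\|\cdot\|\mathrm{Id}_X\otimes T_{p,\tau^{-1}}: L^p_{X,0}\to L^p_X\|<\infty,$$ then for each $q\in(1,\infty)$ one has $$\|\mathrm{Id}_X\otimes T_{q,\tau}: L^q_{X,0}\to L^q_X\|\cdot\|\mathrm{Id}_X\otimes T_{q,\tau^{-1}}: L^q_{X,0}\to L^q_X\|<\infty.$$
   Context: $\mathcal{D}$ is the set of all dyadic intervals contained in $[0,1)$ (intervals $[j2^{-k},(j+1)2^{-k})$, $k\ge 0$, $0\le j<2^k$), and $\mathcal{D}_k$ the set of those of length $2^{-k}$; $|I|$ denotes Lebesgue measure. $h_I$ is the $L_\infty$-normalized Haar function supported on $I$ ($+1$ on the left half of $I$, $-1$ on the right half, $0$ elsewhere). All Banach spaces have dimension at least one. $L^p_X=L^p_X([0,1))$ is the Bochner space with Lebesgue measure and $L^p_{X,0}$ its subspace of mean zero functions. For an injective map $\tau:\mathcal{D}\to\mathcal{D}$, a Banach space $X$ and $p\in[1,\infty)$, the rearrangement operator $\mathrm{Id}_X\otimes T_{p,\tau}$ maps $\sum_I a_I h_I/|I|^{1/p}$ to $\sum_I a_I h_{\tau(I)}/|\tau(I)|^{1/p}$ for finitely supported $(a_I)_{I\in\mathcal{D}}\subseteq X$, and $$\|\mathrm{Id}_X\otimes T_{p,\tau}:L^p_{X,0}\to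 L^p_X\|:=\sup\Big\{\Big\|\sum_{I} a_I\frac{h_{\tau(I)}}{|\tau(I)|^{1/p}}\Big\|_{L^p_X}:\Big\|\sum_I a_I\frac{h_I}{|I|^{1/p}}\Big\|_{L^p_X}\le 1\Big\}\in[0,\infty],$$ the supremum being over finitely supported families $(a_I)\subseteq X$. $X$ is a UMD-space if for some (equivalently, all) $p\in(1,\infty)$ there is a constant $c_p>0$ with $\sup_{\theta_k\in[-1,1]}\|\sum_{k=1}^n\theta_k d_k\|_{L^p_X}\le c_p\|\sum_{k=1}^n d_k\|_{L^p_X}$ for all $n\ge1$ and all $X$-valued martingale difference sequences $(d_k)_{k=1}^n$ with respect to the dyadic filtration $\mathcal{F}_k=\sigma(\mathcal{D}_k)$, $k=0,\dots,n$ (i.e. $d_k$ is $\mathcal{F}_k$-measurable and $\mathbb{E}(d_k|\mathcal{F}_{k-1})=0$). *)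

theory Defs
  imports "HOL-Analysis.Analysis"
begin

class complex_banach = banach +
  fixes scaleC :: "complex \<Rightarrow> 'a \<Rightarrow> 'a"  (infixr "*\<^sub>C" 75)
  assumes scaleC_add_right: "c *\<^sub>C (x + y) = c *\<^sub>C x + c *\<^sub>C y"
    and scaleC_add_left: "(b + c) *\<^sub>C x = b *\<^sub>C x + c *\<^sub>C x"
    and scaleC_scaleC: "b *\<^sub>C c *\<^sub>C x = (b * c) *\<^sub>C x"
    and scaleC_of_real: "complex_of_real r *\<^sub>C x = r *\<^sub>R x"
    and norm_scaleC: "norm (c *\<^sub>C x) = cmod c * norm x"

instantiation complex :: complex_banach
begin

definition scaleC_complex :: "complex \<Rightarrow> complex \<Rightarrow> complex" where
  "scaleC_complex c x = c * x"

instance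
  by standard (simp_all add: scaleC_complex_def algebra_simps norm_mult scaleR_conv_of_real)

end

definition dyadic_level :: "nat \<Rightarrow> real set set" where
  "dyadic_level k = {{real j / 2 ^ k ..< (real j + 1) / 2 ^ k} | j. j < 2 ^ k}"

definition dyadic :: "real set set" where
  "dyadic = (\<Union>k. dyadic_level k)"

definition dyadic_filtration :: "nat \<Rightarrow> real measure" where
  "dyadic_filtration k = sigma {0..<1} (dyadic_level k)"

definition haar :: "real set \<Rightarrow> real \<Rightarrow> real" where
  "haar I t = (if t \<in> I then if t < (Inf I + Sup I) / 2 then 1 else -1 else 0)"

text \<open>
  The \<open>L\<^sup>p\<close> norm on \<open>[0,1)\<close>. It is only ever applied to functions that are constant on
  the intervals of some level of the dyadic filtration, so the integrand is integrable and
  the junk value 0 of the Lebesgue integral does not occur.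
\<close>

definition Lp_norm :: "real \<Rightarrow> (real \<Rightarrow> 'a::real_normed_vector) \<Rightarrow> real" where
  "Lp_norm p f = (LINT t:{0..<1}|lborel. norm (f t) powr p) powr (1 / p)"

definition fin_supp :: "(real set \<Rightarrow> 'a::zero) \<Rightarrow> bool" where
  "fin_supp a \<longleftrightarrow> finite {I \<in> dyadic. a I \<noteq> 0}"

text \<open>
  \<open>haar_sum p \<tau> a\<close> is the sum of \<open>a\<^sub>I h\<^bsub>\<tau>(I)\<^esub> / |\<tau>(I)|\<^bsup>1/p\<^esup>\<close>. The operator
  \<open>Id \<otimes> T\<^bsub>p,\<tau>\<^esub>\<close> maps \<open>haar_sum p id a\<close> to \<open>haar_sum p \<tau> a\<close>.
\<close>

definition haar_sum ::
  "real \<Rightarrow> (real set \<Rightarrow> real set) \<Rightarrow> (real set \<Rightarrow> 'a::real_normed_vector) \<Rightarrow> real \<Rightarrow> 'a" where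
  "haar_sum p \<tau> a t =
     (\<Sum>I\<in>{I \<in> dyadic. a I \<noteq> 0}. (haar (\<tau> I) t / measure lborel (\<tau> I) powr (1 / p)) *\<^sub>R a I)"

definition rearrangement_norm ::
  "'a::real_normed_vector itself \<Rightarrow> real \<Rightarrow> (real set \<Rightarrow> real set) \<Rightarrow> ennreal" where
  "rearrangement_norm _ p \<tau> =
     (SUP a \<in> {a :: real set \<Rightarrow> 'a. fin_supp a \<and> Lp_norm p (haar_sum p id a) \<le> 1}.
        ennreal (Lp_norm p (haar_sum p \<tau> a)))"

text \<open>
  \<open>g\<close> is the conditional expectation of \<open>f\<close> given the \<open>k\<close>-th \<open>\<sigma>\<close>-algebra of the dyadic
  filtration. The library's Bochner integral requires a second countable range, which would
  exclude non-separable spaces, so the Henstock-Kurzweil integral is used instead; the two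
  agree for functions that are constant on the intervals of some dyadic level.
\<close>

definition is_dyadic_cond_exp ::
  "nat \<Rightarrow> (real \<Rightarrow> 'a::real_normed_vector) \<Rightarrow> (real \<Rightarrow> 'a) \<Rightarrow> bool" where
  "is_dyadic_cond_exp k f g \<longleftrightarrow>
     g \<in> borel_measurable (dyadic_filtration k) \<and>
     (\<forall>A\<in>sets (dyadic_filtration k). g integrable_on A \<and> (f has_integral integral A g) A)"

definition martingale_difference :: "nat \<Rightarrow> (nat \<Rightarrow> real \<Rightarrow> 'a::real_normed_vector) \<Rightarrow> bool" where
  "martingale_difference n d \<longleftrightarrow>
     (\<forall>k\<in>{1..n}. d k \<in> borel_measurable (dyadic_filtration k) \<and>
                 is_dyadic_cond_exp (k - 1) (d k) (\<lambda>_. 0))"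

definition UMD_space :: "'a::banach itself \<Rightarrow> bool" where
  "UMD_space _ \<longleftrightarrow>
     (\<exists>p>1. \<exists>c>0. \<forall>n\<ge>1. \<forall>d :: nat \<Rightarrow> real \<Rightarrow> 'a. martingale_difference n d \<longrightarrow>
        (\<forall>\<theta> :: nat \<Rightarrow> real. (\<forall>k\<in>{1..n}. \<theta> k \<in> {-1..1}) \<longrightarrow>
           Lp_norm p (\<lambda>t. \<Sum>k=1..n. \<theta> k *\<^sub>R d k t) \<le> c * Lp_norm p (\<lambda>t. \<Sum>k=1..n. d k t)))"

end

theory Submission
  imports Defs
begin

text \<open>
  If \<open>T\<^bsub>p,\<tau>\<^esub>\<close> is an isomorphism for some \<open>p \<noteq> 2\<close>, then \<open>\<tau>\<close> and its inverse map Carleson families of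
  dyadic intervals to Carleson families, because these are the families whose Haar functions span
  \<open>\<ell>\<^sup>p\<close> in \<open>L\<^sup>p\<close>. For such \<open>\<tau>\<close> the ratio \<open>|\<tau>(I)| / |I|\<close> takes only few values below a given interval, in
  the sense of a Carleson packing condition. On a class of intervals with constant ratio, \<open>T\<^bsub>p,\<tau>\<^esub>\<close> and
  \<open>T\<^bsub>q,\<tau>\<^esub>\<close> agree up to a scalar factor. Splitting a function along the principal intervals of its norm and
  along these classes turns an \<open>L\<^sup>p\<close> bound into an \<open>L\<^sup>q\<close> bound for \<open>q < p\<close>, and duality gives the case
  \<open>q > p\<close>. The argument needs the Haar system to be unconditional in \<open>L\<^sup>p\<^sub>X\<close>; the UMD property gives this
  for one exponent, and the same extrapolation with \<open>\<tau> = id\<close> for all others.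
\<close>

section \<open>Inequalities for finite sums\<close>

text \<open>The exponent 2 carries no information: on scalar Haar sums every bijection acts
  isometrically for p = 2. For p other than 2 the geometry of \<tau> can be read off from scalar
  Haar sums alone. The obstacle to extrapolation is that the normalisations for p and for q differ
  by (|\<tau>(I)| / |I|)^(1/p - 1/q), a factor with no a priori bound over I. On a class of constant
  shift k it is one power of 2^k. Hoelder's inequality on the image of the class, whose total length
  is at most a constant times 2^k that of the tops of the class, produces the inverse power, and the
  two cancel exactly. Nothing then decays in k; the packing condition alone makes the sum over the
  shifts finite. Going down is the natural direction: on a block with a fixed principal interval the
  function is bounded by the mean over that interval, hence controlled in every exponent, and
  Hoelder's inequality on the support of the output lowers the exponent but never raises it.\<close>

lemma holder_sum:
  fixes f g :: "'i \<Rightarrow> real"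
  assumes "finite A" "p > 1" "q > 1" "1/p + 1/q = 1"
    and f: "\<And>i. i \<in> A \<Longrightarrow> f i \<ge> 0" and g: "\<And>i. i \<in> A \<Longrightarrow> g i \<ge> 0"
  shows "(\<Sum>i\<in>A. f i * g i) \<le> (\<Sum>i\<in>A. f i powr p) powr (1/p) * (\<Sum>i\<in>A. g i powr q) powr (1/q)"
proof -
  define a b where "a = (\<Sum>i\<in>A. f i powr p)" and "b = (\<Sum>i\<in>A. g i powr q)"
  have nn: "a \<ge> 0" "b \<ge> 0" unfolding a_def b_def by (auto intro: sum_nonneg)
  show ?thesis
  proof (cases "a = 0 \<or> b = 0")
    case True
    then have "\<forall>i\<in>A. f i * g i = 0"
    proof
      assume "a = 0"
      then have "\<forall>i\<in>A. f i powr p = 0" using assms(1) unfolding a_def by (subst (asm) sum_nonneg_eq_0_iff) auto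
      then show ?thesis by simp
    next
      assume "b = 0"
      then have "\<forall>i\<in>A. g i powr q = 0" using assms(1) unfolding b_def by (subst (asm) sum_nonneg_eq_0_iff) auto
      then show ?thesis by simp
    qed
    then have "(\<Sum>i\<in>A. f i * g i) = 0" by (simp add: sum.neutral)
    then show ?thesis by simp
  next
    case False
    then have ab: "a > 0" "b > 0" using nn by auto
    define u v where "u = a powr (1/p)" and "v = b powr (1/q)"
    have uv: "u > 0" "v > 0" "u powr p = a" "v powr q = b"
      using ab assms by (auto simp: u_def v_def powr_powr)
    have "(\<Sum>i\<in>A. (f i / u) * (g i / v)) \<le> (\<Sum>i\<in>A. (f i / u) powr p / p + (g i / v) powr q / q)"
      using assms uv by (intro sum_mono Youngs_inequality) auto
    also have "\<dots> = (\<Sum>i\<in>A. f i powr p / (a * p) + g i powr q / (b * q))"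
      using f g uv by (intro sum.cong) (auto simp: powr_divide)
    also have "\<dots> = a / (a * p) + b / (b * q)"
      unfolding sum.distrib by (simp add: a_def b_def sum_divide_distrib)
    also have "\<dots> = 1" using ab assms by simp
    finally have "(\<Sum>i\<in>A. f i * g i) / (u * v) \<le> 1" by (simp add: sum_divide_distrib)
    then show ?thesis using uv by (simp add: u_def v_def a_def b_def field_simps)
  qed
qed

lemma conj_exp_gt_1:
  fixes p :: real
  assumes "p > 1" "1/p + 1/p' = 1"
  shows "p' > 1" "p' = p / (p - 1)"
proof -
  have "1/p' = (p - 1)/p" using assms by (simp add: field_simps)
  then show e: "p' = p / (p - 1)" by (metis divide_divide_eq_right div_by_1 mult.left_neutral)
  show "p' > 1" unfolding e using assms by (simp add: field_simps)
qed

text \<open>Hoelder's inequality for w x = (w^(1/r) x) w^(1/r'). The weights are not normalised,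
  hence the extra power of their sum; in the extrapolation this power carries the length of the
  image.\<close>

lemma jensen_sum:
  fixes w x :: "'i \<Rightarrow> real"
  assumes "finite A" "r > 1"
    and w: "\<And>i. i \<in> A \<Longrightarrow> w i \<ge> 0" and x: "\<And>i. i \<in> A \<Longrightarrow> x i \<ge> 0"
  shows "(\<Sum>i\<in>A. w i * x i) powr r \<le> (\<Sum>i\<in>A. w i) powr (r - 1) * (\<Sum>i\<in>A. w i * x i powr r)"
proof -
  define r' where "r' = r / (r - 1)"
  have r': "r' > 1" "1/r + 1/r' = 1" using assms(2) by (auto simp: r'_def field_simps)
  have "(\<Sum>i\<in>A. w i * x i) = (\<Sum>i\<in>A. (w i powr (1/r) * x i) * w i powr (1/r'))"
  proof (rule sum.cong)
    fix i assume "i \<in> A"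
    have "w i powr (1/r) * w i powr (1/r') = w i"
      using w[OF \<open>i \<in> A\<close>] r' by (cases "w i = 0") (auto simp flip: powr_add)
    then show "w i * x i = (w i powr (1/r) * x i) * w i powr (1/r')" by (metis mult.commute mult.left_commute)
  qed simp
  also have "\<dots> \<le> (\<Sum>i\<in>A. (w i powr (1/r) * x i) powr r) powr (1/r) * (\<Sum>i\<in>A. (w i powr (1/r')) powr r') powr (1/r')"
    using assms r' by (intro holder_sum) auto
  also have "(\<Sum>i\<in>A. (w i powr (1/r) * x i) powr r) = (\<Sum>i\<in>A. w i * x i powr r)"
    using assms r' w x by (intro sum.cong) (auto simp: powr_mult powr_powr)
  also have "(\<Sum>i\<in>A. (w i powr (1/r')) powr r') = (\<Sum>i\<in>A. w i)"
    using assms r' w x by (intro sum.cong) (auto simp: powr_powr)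
  finally have le: "(\<Sum>i\<in>A. w i * x i) \<le> (\<Sum>i\<in>A. w i * x i powr r) powr (1/r) * (\<Sum>i\<in>A. w i) powr (1/r')" .
  have nn: "0 \<le> (\<Sum>i\<in>A. w i * x i)" "0 \<le> (\<Sum>i\<in>A. w i)" "0 \<le> (\<Sum>i\<in>A. w i * x i powr r)"
    using w x by (auto intro!: sum_nonneg)
  have "(\<Sum>i\<in>A. w i * x i) powr r \<le> ((\<Sum>i\<in>A. w i * x i powr r) powr (1/r) * (\<Sum>i\<in>A. w i) powr (1/r')) powr r"
    using le nn assms by (intro powr_mono2) auto
  also have "\<dots> = (\<Sum>i\<in>A. w i * x i powr r) * (\<Sum>i\<in>A. w i) powr (r - 1)"
    using nn assms by (simp add: powr_mult powr_powr r'_def)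
  finally show ?thesis by (simp add: mult.commute)
qed

lemma powr_add_le:
  fixes a b :: real
  assumes "a \<ge> 0" "b \<ge> 0" "r \<ge> 0"
  shows "(a + b) powr r \<le> 2 powr r * (a powr r + b powr r)"
proof -
  have "(a + b) powr r \<le> (2 * max a b) powr r" using assms by (intro powr_mono2) auto
  also have "\<dots> = 2 powr r * max a b powr r" using assms by (simp add: powr_mult)
  also have "max a b powr r \<le> a powr r + b powr r" by (auto simp: max_def)
  finally show ?thesis by simp
qed

text \<open>Weighted Jensen at the points x/u and y/v with weights u and v: the perspective x^r /
  u^(r-1) is midpoint convex. This lets the Bellman function pass between an interval and its
  halves.\<close>

lemma perspective_convex:
  fixes x y u v :: real
  assumes "x \<ge> 0" "y \<ge> 0" "u > 0" "v > 0" "r > 1"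
  shows "2 * (((x + y) / 2) powr r / ((u + v) / 2) powr (r - 1)) \<le> x powr r / u powr (r - 1) + y powr r / v powr (r - 1)"
proof -
  define W X where "W = (\<lambda>b. if b then u else v)" and "X = (\<lambda>b. if b then x / u else y / v)"
  have "(\<Sum>b\<in>UNIV. W b * X b) powr r \<le> (\<Sum>b\<in>UNIV. W b) powr (r - 1) * (\<Sum>b\<in>UNIV. W b * X b powr r)"
    using assms by (intro jensen_sum) (auto simp: W_def X_def)
  then have *: "(x + y) powr r \<le> (u + v) powr (r - 1) * (u * (x / u) powr r + v * (y / v) powr r)"
    using assms by (simp add: W_def X_def UNIV_bool add.commute)
  have e: "a * (b / a) powr r = b powr r / a powr (r - 1)" if "a > 0" "b \<ge> 0" for a b :: real
    using that by (simp add: powr_divide powr_diff)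
  have h: "2 * (((x + y) / 2) powr r / ((u + v) / 2) powr (r - 1)) = (x + y) powr r / (u + v) powr (r - 1)"
    using assms by (simp add: powr_divide powr_diff)
  show ?thesis unfolding h using * assms by (simp add: e divide_le_eq mult.commute)
qed

text \<open>The function s^(1-r) has derivative (1-r) s^(-r), and s stays in [1,2] because a + b is
  at most 1. Additional mass a therefore lowers it by at least a (r-1) / 2^r; this is the origin of
  the constant in \<open>carleson_embedding\<close>.\<close>

lemma bellman_gain:
  fixes a b r :: real
  assumes "r > 1" "a \<ge> 0" "b \<ge> 0" "a + b \<le> 1"
  shows "1 / (1 + a + b) powr (r - 1) + a * ((r - 1) / 2 powr r) \<le> 1 / (1 + b) powr (r - 1)"
proof (cases "a = 0")
  case False
  then have a: "a > 0" using assms by simp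
  define \<psi> where "\<psi> = (\<lambda>s::real. s powr (1 - r))"
  have "\<exists>z. 1 + b < z \<and> z < 1 + a + b \<and> \<psi> (1 + a + b) - \<psi> (1 + b) = (1 + a + b - (1 + b)) * ((1 - r) * z powr (1 - r - 1))"
    using a assms unfolding \<psi>_def
    by (intro MVT2) (auto intro!: derivative_eq_intros simp: field_simps)
  then obtain z where z: "1 + b < z" "z < 1 + a + b" "\<psi> (1 + a + b) - \<psi> (1 + b) = a * ((1 - r) * z powr (- r))"
    by auto
  have "2 powr (-r) \<le> z powr (-r)" using z assms by (intro powr_mono2') auto
  then have "a * ((r - 1) * 2 powr (-r)) \<le> a * ((r - 1) * z powr (-r))" using a assms by (intro mult_left_mono) auto
  then have "\<psi> (1 + a + b) + a * ((r - 1) * 2 powr (-r)) \<le> \<psi> (1 + b)" using z(3) by (simp add: algebra_simps)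
  moreover have "\<psi> s = 1 / s powr (r - 1)" if "s > 0" for s
    using that by (simp add: \<psi>_def powr_minus_divide[symmetric])
  ultimately show ?thesis using assms by (simp add: powr_minus_divide)
qed simp

section \<open>Dyadic intervals and Haar functions\<close>

abbreviation len :: "real set \<Rightarrow> real" where
  "len I \<equiv> measure lborel I"

text \<open>The dyadic interval of level k around t, written with integer parts: nestedness becomes
  division of integers, and the choice of a half becomes a parity.\<close>

definition cell :: "nat \<Rightarrow> real \<Rightarrow> real set" where
  "cell k t = {s. \<lfloor>2 ^ k * s\<rfloor> = \<lfloor>2 ^ k * t\<rfloor>}"

definition lev :: "real set \<Rightarrow> nat" where
  "lev I = (THE k. I \<in> dyadic_level k)"

definition grid :: "nat \<Rightarrow> real set" where
  "grid N = (\<lambda>j. real j / 2 ^ N) ` {..<2 ^ N}"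

lemma cell_refl [simp]: "t \<in> cell k t"
  by (simp add: cell_def)

lemma cell_eq: "s \<in> cell k t \<Longrightarrow> cell k s = cell k t"
  by (simp add: cell_def)

lemma cell_interval: "cell k t = {real_of_int \<lfloor>2 ^ k * t\<rfloor> / 2 ^ k ..< (real_of_int \<lfloor>2 ^ k * t\<rfloor> + 1) / 2 ^ k}"
proof -
  have "(\<lfloor>2 ^ k * s\<rfloor> = \<lfloor>2 ^ k * t\<rfloor>) \<longleftrightarrow> real_of_int \<lfloor>2 ^ k * t\<rfloor> / 2 ^ k \<le> s \<and> s < (real_of_int \<lfloor>2 ^ k * t\<rfloor> + 1) / 2 ^ k" for s :: real
    by (simp add: floor_eq_iff field_simps)
  then show ?thesis unfolding cell_def set_eq_iff mem_Collect_eq atLeastLessThan_iff by blast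
qed

lemma floor_unit_bounds:
  assumes "t \<in> {0..<1::real}"
  shows "0 \<le> \<lfloor>2 ^ k * t\<rfloor>" "\<lfloor>2 ^ k * t\<rfloor> < 2 ^ k"
proof -
  show "0 \<le> \<lfloor>2 ^ k * t\<rfloor>" using assms by simp
  have "2 ^ k * t < 2 ^ k * (1::real)" using assms by (intro mult_strict_left_mono) auto
  then show "\<lfloor>2 ^ k * t\<rfloor> < 2 ^ k" by (simp add: floor_less_iff)
qed

lemma dyadic_level_cell: "dyadic_level k = cell k ` {0..<1}"
proof (intro equalityI subsetI)
  fix I assume "I \<in> dyadic_level k"
  then obtain j :: nat where j: "j < 2 ^ k" and I: "I = {real j / 2 ^ k ..< (real j + 1) / 2 ^ k}"
    by (auto simp: dyadic_level_def)
  have "real j < 2 ^ k" using j by (metis of_nat_less_iff of_nat_numeral of_nat_power)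
  then have "real j / 2 ^ k \<in> {0..<1}" by simp
  moreover have "I = cell k (real j / 2 ^ k)" by (simp add: I cell_interval)
  ultimately show "I \<in> cell k ` {0..<1}" by blast
next
  fix I assume "I \<in> cell k ` {0..<1}"
  then obtain t where t: "t \<in> {0..<1}" "I = cell k t" by blast
  have "real_of_int \<lfloor>2 ^ k * t\<rfloor> = real (nat \<lfloor>2 ^ k * t\<rfloor>)" using floor_unit_bounds[OF t(1), of k] by simp
  then have "I = {real (nat \<lfloor>2 ^ k * t\<rfloor>) / 2 ^ k ..< (real (nat \<lfloor>2 ^ k * t\<rfloor>) + 1) / 2 ^ k}"
    by (simp only: t(2) cell_interval)
  moreover have "nat \<lfloor>2 ^ k * t\<rfloor> < 2 ^ k" using floor_unit_bounds[OF t(1), of k]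
    by (simp add: nat_less_iff)
  ultimately show "I \<in> dyadic_level k" unfolding dyadic_level_def by blast
qed

lemma cell_in_level: "t \<in> {0..<1} \<Longrightarrow> cell k t \<in> dyadic_level k"
  by (auto simp: dyadic_level_cell)

lemma cell_mono:
  assumes "k \<le> l"
  shows "cell l t \<subseteq> cell k t"
proof -
  have "\<lfloor>2 ^ k * s\<rfloor> = \<lfloor>2 ^ l * s\<rfloor> div 2 ^ (l - k)" for s :: real
  proof -
    have "2 ^ k * s = (2 ^ l * s) / real_of_int (2 ^ (l - k))"
      using assms by (simp add: power_add[symmetric] field_simps)
    then show ?thesis by (simp only: floor_divide_real_eq_div[of "2 ^ (l - k)"] zero_le_power zero_le_numeral)
  qed
  then show ?thesis by (auto simp: cell_def)
qed

lemma cell_subset_unit: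
  assumes "t \<in> {0..<1}"
  shows "cell k t \<subseteq> {0..<1}"
proof -
  have "\<lfloor>t\<rfloor> = 0" using assms by (simp add: floor_eq_iff)
  then have "cell 0 t = {s. \<lfloor>s\<rfloor> = 0}" by (simp add: cell_def)
  also have "\<dots> = {0..<1}" by (auto simp: floor_eq_iff)
  finally have "cell 0 t = {0..<1}" .
  then show ?thesis using cell_mono[of 0 k t] by simp
qed

lemma level_subset_unit: "I \<in> dyadic_level k \<Longrightarrow> I \<subseteq> {0..<1}"
  using cell_subset_unit unfolding dyadic_level_cell by blast

lemma level_eq_cell: "I \<in> dyadic_level k \<Longrightarrow> t \<in> I \<Longrightarrow> I = cell k t"
  by (auto simp: dyadic_level_cell cell_eq)

lemma len_cell: "len (cell k t) = 1 / 2 ^ k"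
  by (simp add: cell_interval diff_divide_distrib[symmetric] divide_right_mono)

lemma level_unique: "I \<in> dyadic_level k \<Longrightarrow> I \<in> dyadic_level l \<Longrightarrow> k = l"
proof -
  assume "I \<in> dyadic_level k" "I \<in> dyadic_level l"
  then have "len I = 1 / 2 ^ k" "len I = 1 / 2 ^ l" by (auto simp: dyadic_level_cell len_cell)
  then have "(2::real) ^ k = 2 ^ l" by simp
  then show "k = l" by simp
qed

lemma lev_eq: "I \<in> dyadic_level k \<Longrightarrow> lev I = k"
  unfolding lev_def by (rule the_equality) (simp_all add: level_unique[of I _ k])

lemma dyadic_lev: "I \<in> dyadic \<Longrightarrow> I \<in> dyadic_level (lev I)"
  unfolding dyadic_def using lev_eq by auto

lemma dyadic_iff_lev: "I \<in> dyadic_level k \<longleftrightarrow> I \<in> dyadic \<and> lev I = k"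
proof
  assume "I \<in> dyadic_level k"
  then show "I \<in> dyadic \<and> lev I = k" unfolding dyadic_def by (simp add: lev_eq) blast
next
  assume "I \<in> dyadic \<and> lev I = k"
  then show "I \<in> dyadic_level k" using dyadic_lev by auto
qed

lemma dyadic_cell: "I \<in> dyadic \<Longrightarrow> t \<in> I \<Longrightarrow> I = cell (lev I) t"
  by (rule level_eq_cell[OF dyadic_lev])

lemma dyadic_subset_unit: "I \<in> dyadic \<Longrightarrow> I \<subseteq> {0..<1}"
  using dyadic_lev level_subset_unit by blast

lemma cell_dyadic [simp]: "t \<in> {0..<1} \<Longrightarrow> cell k t \<in> dyadic"
  using cell_in_level by (auto simp: dyadic_def)

lemma lev_cell [simp]: "t \<in> {0..<1} \<Longrightarrow> lev (cell k t) = k"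
  using cell_in_level lev_eq by blast

lemma dyadic_nonempty: "I \<in> dyadic \<Longrightarrow> \<exists>t. t \<in> I"
  using cell_refl unfolding dyadic_def dyadic_level_cell by blast

lemma len_dyadic: "I \<in> dyadic \<Longrightarrow> len I = 1 / 2 ^ lev I"
  using dyadic_cell dyadic_nonempty len_cell by metis

lemma len_pos: "I \<in> dyadic \<Longrightarrow> len I > 0"
  by (simp add: len_dyadic)

lemma unit_dyadic: "{0..<1} \<in> dyadic" "lev {0..<1} = 0"
proof -
  have "{0..<1::real} \<in> dyadic_level 0" by (auto simp: dyadic_level_def)
  then show "{0..<1} \<in> dyadic" "lev {0..<1} = 0" by (auto simp: dyadic_iff_lev)
qed

lemma dyadic_nested:
  assumes "I \<in> dyadic" "J \<in> dyadic" "t \<in> I" "t \<in> J" "lev I \<le> lev J"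
  shows "J \<subseteq> I"
  using cell_mono[OF assms(5), of t] dyadic_cell assms by metis

lemma dyadic_nested_cases:
  assumes "I \<in> dyadic" "J \<in> dyadic"
  shows "J \<subseteq> I \<or> I \<subseteq> J \<or> I \<inter> J = {}"
proof (cases "I \<inter> J = {}")
  case False
  then obtain t where "t \<in> I" "t \<in> J" by blast
  then show ?thesis using dyadic_nested[of I J t] dyadic_nested[of J I t] assms by linarith
qed simp

lemma subset_lev_mono:
  assumes "I \<in> dyadic" "J \<in> dyadic" "J \<subseteq> I"
  shows "lev I \<le> lev J"
proof (rule ccontr)
  assume "\<not> ?thesis"
  then have l: "lev J < lev I" by simp
  obtain t where t: "t \<in> J" using dyadic_nonempty assms by blast
  then have "I \<subseteq> J" using dyadic_nested[of J I t] assms l by auto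
  then have "I = J" using assms by blast
  then show False using l by simp
qed

lemma subset_lev_eq:
  assumes "I \<in> dyadic" "J \<in> dyadic" "J \<subseteq> I" "lev I = lev J"
  shows "J = I"
proof -
  obtain t where t: "t \<in> J" using dyadic_nonempty assms by blast
  then show ?thesis using dyadic_nested[of J I t] assms by auto
qed

lemma psubset_lev: "I \<in> dyadic \<Longrightarrow> J \<in> dyadic \<Longrightarrow> J \<subset> I \<Longrightarrow> lev I < lev J"
  using subset_lev_mono subset_lev_eq by (metis le_neq_implies_less psubset_eq)

lemma finite_level [simp]: "finite (dyadic_level k)"
  unfolding dyadic_level_def by auto

definition dyadic_upto :: "nat \<Rightarrow> real set set" where
  "dyadic_upto N = {I \<in> dyadic. lev I \<le> N}"

lemma finite_dyadic_upto [simp]: "finite (dyadic_upto N)"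
proof -
  have "dyadic_upto N \<subseteq> (\<Union>k\<le>N. dyadic_level k)" by (auto simp: dyadic_upto_def dyadic_iff_lev)
  then show ?thesis by (rule finite_subset) auto
qed

lemma finite_subset_upto:
  assumes "finite F" "F \<subseteq> dyadic"
  shows "\<exists>N. \<forall>n\<ge>N. F \<subseteq> dyadic_upto n"
proof (intro exI[of _ "Max (lev ` F)"] allI impI subsetI)
  fix n I assume n: "Max (lev ` F) \<le> n" and I: "I \<in> F"
  have "lev I \<le> Max (lev ` F)" using assms I by (intro Max_ge) auto
  then have "lev I \<le> n" using n by linarith
  then show "I \<in> dyadic_upto n" using I assms(2) unfolding dyadic_upto_def by blast
qed

lemma finite_ancestors: "J \<in> dyadic \<Longrightarrow> finite {I \<in> dyadic. J \<subseteq> I}"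
proof (rule finite_subset[OF _ finite_dyadic_upto[of "lev J"]])
  assume "J \<in> dyadic"
  then show "{I \<in> dyadic. J \<subseteq> I} \<subseteq> dyadic_upto (lev J)" using subset_lev_mono unfolding dyadic_upto_def by blast
qed

lemma dyadic_upto_memD: "I \<in> dyadic_upto N \<Longrightarrow> I \<in> dyadic" "I \<in> dyadic_upto N \<Longrightarrow> lev I \<le> N"
  by (auto simp: dyadic_upto_def)

section \<open>Halves of a dyadic interval and the Haar function on them\<close>

definition lft :: "real set \<Rightarrow> real set" where
  "lft I = {t \<in> I. even \<lfloor>2 ^ Suc (lev I) * t\<rfloor>}"

definition rgt :: "real set \<Rightarrow> real set" where
  "rgt I = {t \<in> I. odd \<lfloor>2 ^ Suc (lev I) * t\<rfloor>}"

lemma cell_floor: "t \<in> cell k (of_int j / 2 ^ k) \<longleftrightarrow> \<lfloor>2 ^ k * t\<rfloor> = j"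
  by (simp add: cell_def)

lemma floor_Suc_level: "\<lfloor>2 ^ k * t\<rfloor> = \<lfloor>2 ^ Suc k * (t::real)\<rfloor> div 2"
proof -
  have "2 ^ k * t = (2 ^ Suc k * t) / real_of_int 2" by simp
  then show ?thesis by (simp only: floor_divide_real_eq_div[of 2] zero_le_numeral)
qed

lemma children:
  assumes "I \<in> dyadic"
  shows "lft I \<in> dyadic" "rgt I \<in> dyadic" "lev (lft I) = Suc (lev I)" "lev (rgt I) = Suc (lev I)"
    "lft I \<union> rgt I = I" "lft I \<inter> rgt I = {}"
proof -
  obtain t where t: "t \<in> {0..<1}" "I = cell (lev I) t"
    using assms dyadic_lev dyadic_level_cell by blast
  define j where "j = \<lfloor>2 ^ lev I * t\<rfloor>"
  have j: "0 \<le> j" "j < 2 ^ lev I" using floor_unit_bounds[OF t(1)] by (auto simp: j_def)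
  have mem: "s \<in> I \<longleftrightarrow> \<lfloor>2 ^ Suc (lev I) * s\<rfloor> div 2 = j" for s
  proof -
    have "s \<in> I \<longleftrightarrow> s \<in> cell (lev I) t" using t(2) by (rule arg_cong)
    then show ?thesis unfolding cell_def j_def floor_Suc_level[of "lev I" s, symmetric] by simp
  qed
  have d: "real_of_int j + 1 \<le> 2 ^ lev I" using j(2) by (metis int_less_real_le of_int_numeral of_int_power)
  define l r where "l = real_of_int (2 * j) / 2 ^ Suc (lev I)" and "r = real_of_int (2 * j + 1) / 2 ^ Suc (lev I)"
  have lr: "l \<in> {0..<1}" "r \<in> {0..<1}" using j d by (auto simp: l_def r_def)
  have L: "lft I = cell (Suc (lev I)) l"
    unfolding lft_def mem l_def set_eq_iff cell_floor mem_Collect_eq by (intro allI) presburger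
  have R: "rgt I = cell (Suc (lev I)) r"
    unfolding rgt_def mem r_def set_eq_iff cell_floor mem_Collect_eq by (intro allI) presburger
  show "lft I \<in> dyadic" "rgt I \<in> dyadic" "lev (lft I) = Suc (lev I)" "lev (rgt I) = Suc (lev I)"
    unfolding L R using lr by auto
  show "lft I \<union> rgt I = I" "lft I \<inter> rgt I = {}" by (auto simp: lft_def rgt_def)
qed

lemma len_children: "I \<in> dyadic \<Longrightarrow> len (lft I) = len I / 2" "I \<in> dyadic \<Longrightarrow> len (rgt I) = len I / 2"
  by (simp_all add: len_dyadic children)

lemma subset_children:
  assumes "I \<in> dyadic" "J \<in> dyadic" "J \<subseteq> I" "J \<noteq> I"
  shows "J \<subseteq> lft I \<or> J \<subseteq> rgt I"
proof -
  obtain t where t: "t \<in> J" using dyadic_nonempty assms by blast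
  have l: "lev I < lev J" using psubset_lev assms by blast
  have "t \<in> lft I \<or> t \<in> rgt I" using children(5)[OF assms(1)] t assms by blast
  then show ?thesis using dyadic_nested[of _ J t] children[OF assms(1)] assms t l by (metis Suc_leI)
qed

text \<open>A point of I lies to the left of the midpoint exactly when its index at the next level
  is even. This replaces the midpoint of \<open>Inf\<close> and \<open>Sup\<close> by the two
  halves.\<close>

lemma haar_eq:
  assumes "I \<in> dyadic"
  shows "haar I t = (if t \<in> lft I then 1 else if t \<in> rgt I then -1 else 0)"
proof (cases "t \<in> I")
  case True
  define k j where "k = lev I" and "j = \<lfloor>2 ^ k * t\<rfloor>"
  have I: "I = {real_of_int j / 2 ^ k ..< (real_of_int j + 1) / 2 ^ k}"
    using dyadic_cell[OF assms True] cell_interval by (simp add: k_def j_def)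
  have lt: "real_of_int j / 2 ^ k < (real_of_int j + 1) / 2 ^ k" by (simp add: divide_strict_right_mono)
  have mid: "(Inf I + Sup I) / 2 = (2 * real_of_int j + 1) / 2 ^ Suc k"
    unfolding I using lt by (simp add: add_divide_distrib)
  have "\<lfloor>2 ^ Suc k * t\<rfloor> div 2 = j" using floor_Suc_level[of k t] j_def by simp
  then have "even \<lfloor>2 ^ Suc k * t\<rfloor> \<longleftrightarrow> \<lfloor>2 ^ Suc k * t\<rfloor> < 2 * j + 1" by presburger
  also have "\<dots> \<longleftrightarrow> t < (2 * real_of_int j + 1) / 2 ^ Suc k"
    by (simp add: floor_less_iff field_simps)
  finally show ?thesis using True by (auto simp: haar_def lft_def rgt_def mid k_def)
qed (auto simp: haar_def lft_def rgt_def)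

lemma haar_outside: "t \<notin> I \<Longrightarrow> haar I t = 0"
  by (simp add: haar_def)

lemma abs_haar: "\<bar>haar I t\<bar> = indicator I t"
  by (simp add: haar_def indicator_def)

lemma haar_const_on:
  assumes "I \<in> dyadic" "J \<in> dyadic" "J \<subseteq> I" "J \<noteq> I" "s \<in> J" "t \<in> J"
  shows "haar I s = haar I t"
  using subset_children[OF assms(1-4)] children(6)[OF assms(1)] assms(5,6) by (auto simp: haar_eq[OF assms(1)])

lemma haar_const_lev:
  assumes "I \<in> dyadic" "J \<in> dyadic" "lev I < lev J" "s \<in> J" "t \<in> J"
  shows "haar I s = haar I t"
proof (cases "I \<inter> J = {}")
  case True
  then show ?thesis using assms haar_outside by (metis disjoint_iff)
next
  case False
  then have "J \<subseteq> I" using dyadic_nested assms by (metis disjoint_iff less_imp_le)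
  then show ?thesis using haar_const_on[of I J s t] assms by auto
qed

section \<open>Sampling on the dyadic grid\<close>

lemma finite_grid [simp]: "finite (grid N)"
  by (simp add: grid_def)

lemma grid_unit: "grid N \<subseteq> {0..<1}"
proof
  fix t assume "t \<in> grid N"
  then obtain j :: nat where j: "j < 2 ^ N" "t = real j / 2 ^ N" by (auto simp: grid_def)
  have "real j < 2 ^ N" using j(1) by (metis of_nat_less_iff of_nat_numeral of_nat_power)
  then show "t \<in> {0..<1}" using j by simp
qed

lemma grid_cell_inj: "s \<in> grid N \<Longrightarrow> t \<in> grid N \<Longrightarrow> s \<in> cell N t \<Longrightarrow> s = t"
  by (auto simp: grid_def cell_def)

lemma grid_cell_ex:
  assumes "t \<in> {0..<1}"
  shows "\<exists>s\<in>grid N. t \<in> cell N s"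
proof
  define j where "j = nat \<lfloor>2 ^ N * t\<rfloor>"
  have j: "j < 2 ^ N" "real j = of_int \<lfloor>2 ^ N * t\<rfloor>" using floor_unit_bounds[OF assms, of N] by (auto simp: j_def nat_less_iff)
  show "real j / 2 ^ N \<in> grid N" unfolding grid_def using j(1) by blast
  show "t \<in> cell N (real j / 2 ^ N)" using j by (simp add: cell_def)
qed

text \<open>
  Functions that are constant on the intervals of level \<open>N\<close> are integrated by sampling at the left
  endpoints of these intervals.
\<close>

definition isum :: "nat \<Rightarrow> real set \<Rightarrow> (real \<Rightarrow> real) \<Rightarrow> real" where
  "isum N I f = (\<Sum>t\<in>grid N \<inter> I. f t) / 2 ^ N"

definition stepfun :: "nat \<Rightarrow> (real \<Rightarrow> 'b) \<Rightarrow> bool" where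
  "stepfun N f \<longleftrightarrow> (\<forall>s t. s \<in> {0..<1} \<longrightarrow> t \<in> cell N s \<longrightarrow> f t = f s)"

lemma grid_Int_cell:
  assumes "t \<in> {0..<1}"
  shows "\<exists>s. grid N \<inter> cell N t = {s}"
proof -
  obtain s where s: "s \<in> grid N" "t \<in> cell N s" using grid_cell_ex[OF assms] by blast
  then have "cell N t = cell N s" using cell_eq by blast
  then have "grid N \<inter> cell N t = {s}" using s grid_cell_inj by auto
  then show ?thesis by blast
qed

lemma isum_split:
  assumes "I \<in> dyadic"
  shows "isum N I f = isum N (lft I) f + isum N (rgt I) f"
proof -
  have "(\<Sum>t\<in>grid N \<inter> I. f t) = (\<Sum>t\<in>(grid N \<inter> lft I) \<union> (grid N \<inter> rgt I). f t)"
    using children(5)[OF assms] by (metis Int_Un_distrib)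
  also have "\<dots> = (\<Sum>t\<in>grid N \<inter> lft I. f t) + (\<Sum>t\<in>grid N \<inter> rgt I. f t)"
    using children(6)[OF assms] by (intro sum.union_disjoint) auto
  finally show ?thesis by (simp add: isum_def add_divide_distrib)
qed

lemma isum_nonneg: "(\<And>t. f t \<ge> 0) \<Longrightarrow> isum N I f \<ge> 0"
  by (simp add: isum_def sum_nonneg)

lemma isum_mono: "(\<And>t. t \<in> grid N \<Longrightarrow> t \<in> I \<Longrightarrow> f t \<le> g t) \<Longrightarrow> isum N I f \<le> isum N I g"
  unfolding isum_def by (intro divide_right_mono sum_mono) auto

lemma isum_cmult: "isum N I (\<lambda>t. c * f t) = c * isum N I f"
  by (simp add: isum_def sum_distrib_left[symmetric])

lemma isum_sum: "isum N I (\<lambda>t. \<Sum>i\<in>A. f i t) = (\<Sum>i\<in>A. isum N I (f i))"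
  unfolding isum_def by (simp add: sum.swap[of _ A] sum_divide_distrib)

lemma isum_set_mono: "(\<And>t. f t \<ge> 0) \<Longrightarrow> I \<subseteq> J \<Longrightarrow> isum N I f \<le> isum N J f"
  unfolding isum_def by (intro divide_right_mono sum_mono2) auto

text \<open>Induction from the intervals of level N towards the root, the order in which the Bellman
  estimate collects its gains.\<close>

lemma dyadic_induct_up [consumes 2, case_names leaf split]:
  assumes "I \<in> dyadic" "lev I \<le> N"
    and leaf: "\<And>I. I \<in> dyadic \<Longrightarrow> lev I = N \<Longrightarrow> P I"
    and split: "\<And>I. I \<in> dyadic \<Longrightarrow> lev I < N \<Longrightarrow> P (lft I) \<Longrightarrow> P (rgt I) \<Longrightarrow> P I"
  shows "P I"
  using assms(1,2)
proof (induction "N - lev I" arbitrary: I)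
  case 0
  then show ?case using leaf by simp
next
  case (Suc n)
  then show ?case using split[of I] children[of I] by simp
qed

lemma isum_1: 
  assumes "I \<in> dyadic" "lev I \<le> N"
  shows "isum N I (\<lambda>_. 1) = len I"
  using assms
proof (induction rule: dyadic_induct_up)
  case (leaf I)
  obtain t where t: "t \<in> {0..<1}" "I = cell N t" using leaf dyadic_lev dyadic_level_cell by blast
  obtain s where "grid N \<inter> I = {s}" using grid_Int_cell[OF t(1)] t(2) by blast
  then show ?case using leaf by (simp add: isum_def len_dyadic)
next
  case (split I)
  then show ?case by (simp add: isum_split len_children)
qed

lemma isum_const: "I \<in> dyadic \<Longrightarrow> lev I \<le> N \<Longrightarrow> (\<And>t. t \<in> I \<Longrightarrow> f t = c) \<Longrightarrow> isum N I f = c * len I"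
  using isum_1[of I N] isum_cmult[of N I c "\<lambda>_. 1"] by (simp add: isum_def)

lemma isum_haar:
  assumes "I \<in> dyadic" "lev I < N"
  shows "isum N I (haar I) = 0"
proof -
  have "isum N (lft I) (haar I) = 1 * len (lft I)" "isum N (rgt I) (haar I) = (-1) * len (rgt I)"
    using assms children[OF assms(1)] by (intro isum_const; auto simp: haar_eq)+
  then show ?thesis using assms by (simp add: isum_split len_children)
qed

lemma isum_restrict: "(\<And>t. t \<in> J - I \<Longrightarrow> f t = 0) \<Longrightarrow> I \<subseteq> J \<Longrightarrow> isum N J f = isum N I f"
  unfolding isum_def by (intro arg_cong2[of _ _ _ _ "(/)"] sum.mono_neutral_right) auto

lemma sum_haar_vec:
  fixes c :: "'a::real_vector"
  assumes "I \<in> dyadic" "lev I < N" "I \<subseteq> J"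
  shows "(\<Sum>t\<in>grid N \<inter> J. haar I t *\<^sub>R c) = 0"
proof -
  have "isum N J (haar I) = 0" using isum_haar[OF assms(1,2)] isum_restrict[of J I "haar I" N] assms haar_outside by auto
  then have "(\<Sum>t\<in>grid N \<inter> J. haar I t) = 0" by (simp add: isum_def)
  then show ?thesis by (simp flip: scaleR_left.sum)
qed

text \<open>For distinct nested intervals the larger Haar function is constant on the smaller
  interval, where the other one has mean zero. The bounds on the levels are strict because a Haar
  function of level k is constant only on intervals of level k + 1.\<close>

lemma haar_orth:
  assumes "I \<in> dyadic" "J \<in> dyadic" "lev I < N" "lev J < N"
  shows "isum N UNIV (\<lambda>t. haar I t * haar J t) = (if I = J then len I else 0)"
proof -
  have *: "isum N UNIV (\<lambda>t. haar I t * haar J t) = 0" 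
    if H: "I \<in> dyadic" "J \<in> dyadic" "lev I < N" "lev J < N" "J \<subseteq> I" "I \<noteq> J" for I J
  proof -
    obtain s where s: "s \<in> J" using dyadic_nonempty H(2) by blast
    have "isum N UNIV (\<lambda>t. haar I t * haar J t) = isum N J (\<lambda>t. haar I t * haar J t)"
      by (rule isum_restrict) (auto simp: haar_outside)
    also have "\<dots> = isum N J (\<lambda>t. haar I s * haar J t)"
    proof -
      have "haar I t = haar I s" if "t \<in> J" for t
        using haar_const_on[OF H(1,2,5) H(6)[symmetric] that s] .
      then show ?thesis unfolding isum_def by simp
    qed
    also have "\<dots> = 0" unfolding isum_cmult using isum_haar H by simp
    finally show ?thesis .
  qed
  show ?thesis
  proof (cases "I = J")
    case True
    have "isum N UNIV (\<lambda>t. haar I t * haar J t) = isum N I (\<lambda>t. haar I t * haar J t)"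
      by (rule isum_restrict) (auto simp: haar_outside)
    also have "\<dots> = 1 * len I" using assms True by (intro isum_const) (auto simp: haar_def)
    finally show ?thesis using True by simp
  next
    case False
    consider "J \<subseteq> I" | "I \<subseteq> J" | "I \<inter> J = {}" using dyadic_nested_cases assms by metis
    then show ?thesis
    proof cases
      case 1
      then show ?thesis using * assms False by simp
    next
      case 2
      then show ?thesis using *[of J I] assms False by (simp add: mult.commute)
    next
      case 3
      then have z: "haar I t * haar J t = 0" for t using haar_outside by (metis disjoint_iff mult_eq_0_iff)
      show ?thesis unfolding z using False by (simp add: isum_def)
    qed
  qed
qed

lemma disjoint_sum_isum:
  assumes "finite C" "C \<subseteq> dyadic_upto N"
    and "\<And>I J. I \<in> C \<Longrightarrow> J \<in> C \<Longrightarrow> I \<noteq> J \<Longrightarrow> I \<inter> J = {}"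
  shows "(\<Sum>I\<in>C. isum N I f) = isum N (\<Union>C) f"
proof -
  have "(\<Sum>I\<in>C. \<Sum>t\<in>grid N \<inter> I. f t) = (\<Sum>t\<in>(\<Union>I\<in>C. grid N \<inter> I). f t)"
    using assms by (subst sum.UNION_disjoint) auto
  also have "(\<Union>I\<in>C. grid N \<inter> I) = grid N \<inter> \<Union>C" by auto
  finally show ?thesis by (simp add: isum_def flip: sum_divide_distrib)
qed

text \<open>On [0,1) the function is a finite combination of indicators of the cells around the grid
  points, each of length 2^(-N). This links the sampled sums to the integral in the definition of
  the norm.\<close>

lemma lebesgue_stepfun:
  fixes f :: "real \<Rightarrow> real"
  assumes "stepfun N f"
  shows "(LINT t:{0..<1}|lborel. f t) = isum N UNIV f"
proof -
  have "indicator {0..<1} t *\<^sub>R f t = (\<Sum>s\<in>grid N. indicator (cell N s) t *\<^sub>R f s)" for t :: real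
  proof (cases "t \<in> {0..<1}")
    case True
    obtain s where s: "s \<in> grid N" "t \<in> cell N s" using grid_cell_ex[OF True] by blast
    have "(\<Sum>s\<in>grid N. indicator (cell N s) t *\<^sub>R f s) = (\<Sum>s\<in>{s}. indicator (cell N s) t *\<^sub>R f s)"
    proof (rule sum.mono_neutral_right)
      show "\<forall>i\<in>grid N - {s}. indicator (cell N i) t *\<^sub>R f i = 0"
      proof
        fix i assume i: "i \<in> grid N - {s}"
        have "t \<notin> cell N i"
        proof
          assume "t \<in> cell N i"
          then have "s \<in> cell N i" using cell_eq s(2) cell_refl by metis
          then show False using grid_cell_inj[of s N i] s i by auto
        qed
        then show "indicator (cell N i) t *\<^sub>R f i = 0" by simp
      qed
    qed (use s in auto)
    also have "\<dots> = f t" proof -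
      have "s \<in> {0..<1}" using s(1) grid_unit by blast
      then have "f t = f s" using s(2) assms unfolding stepfun_def by blast
      then show ?thesis using s by simp
    qed
    finally show ?thesis using True by simp
  next
    case False
    then have "t \<notin> cell N s" if "s \<in> grid N" for s using cell_subset_unit grid_unit that by blast
    then show ?thesis using False by simp
  qed
  then have "(LINT t:{0..<1}|lborel. f t) = (LINT t|lborel. (\<Sum>s\<in>grid N. indicator (cell N s) t *\<^sub>R f s))"
    unfolding set_lebesgue_integral_def by simp
  also have "\<dots> = (\<Sum>s\<in>grid N. LINT t|lborel. indicator (cell N s) t *\<^sub>R f s)"
    by (intro Bochner_Integration.integral_sum integrable_scaleR_left integrable_real_indicator)
       (auto simp: cell_interval divide_right_mono)
  also have "\<dots> = (\<Sum>s\<in>grid N. f s / 2 ^ N)"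
  proof (intro sum.cong refl)
    fix s
    have "cell N s \<in> sets lborel" "emeasure lborel (cell N s) < \<infinity>" by (auto simp: cell_interval divide_right_mono)
    then show "(LINT t|lborel. indicator (cell N s) t *\<^sub>R f s) = f s / 2 ^ N"
      using integral_scaleR_left[of "f s" lborel "indicator (cell N s)"] by (simp add: len_cell)
  qed
  finally show ?thesis by (simp add: isum_def sum_divide_distrib)
qed

lemma Lp_norm_stepfun:
  assumes "stepfun N f"
  shows "Lp_norm p f = (isum N UNIV (\<lambda>t. norm (f t) powr p)) powr (1 / p)"
proof -
  have "stepfun N (\<lambda>t. norm (f t) powr p)" using assms unfolding stepfun_def by metis
  then show ?thesis by (simp add: Lp_norm_def lebesgue_stepfun)
qed

section \<open>Carleson families\<close>

text \<open>Finiteness is built in, in keeping with norms that are tested on finitely supported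
  families; what matters throughout is that the constant M is uniform.\<close>

definition carleson :: "real \<Rightarrow> real set set \<Rightarrow> bool" where
  "carleson M C \<longleftrightarrow> finite C \<and> C \<subseteq> dyadic \<and> (\<forall>R\<in>dyadic. (\<Sum>I\<in>{I\<in>C. I \<subseteq> R}. len I) \<le> M * len R)"

definition maximal :: "real set set \<Rightarrow> real set set" where
  "maximal C = {I \<in> C. \<forall>J\<in>C. I \<subseteq> J \<longrightarrow> J = I}"

lemma carlesonD: "carleson M C \<Longrightarrow> R \<in> dyadic \<Longrightarrow> (\<Sum>I\<in>{I\<in>C. I \<subseteq> R}. len I) \<le> M * len R"
  by (simp add: carleson_def)

lemma carleson_subset: "carleson M C \<Longrightarrow> C' \<subseteq> C \<Longrightarrow> carleson M C'"
  unfolding carleson_def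
proof (intro conjI ballI)
  assume a: "finite C \<and> C \<subseteq> dyadic \<and> (\<forall>R\<in>dyadic. (\<Sum>I\<in>{I\<in>C. I \<subseteq> R}. len I) \<le> M * len R)" "C' \<subseteq> C"
  then show "finite C'" "C' \<subseteq> dyadic" using finite_subset by blast+
  fix R assume "R \<in> dyadic"
  moreover have "(\<Sum>I\<in>{I\<in>C'. I \<subseteq> R}. len I) \<le> (\<Sum>I\<in>{I\<in>C. I \<subseteq> R}. len I)"
    using a by (intro sum_mono2) auto
  ultimately show "(\<Sum>I\<in>{I\<in>C'. I \<subseteq> R}. len I) \<le> M * len R" using a(1) by force
qed

lemma carleson_mono: "carleson M C \<Longrightarrow> M \<le> M' \<Longrightarrow> carleson M' C"
  unfolding carleson_def by (meson len_pos less_imp_le mult_right_mono order_trans)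

lemma sum_UN_le:
  fixes f :: "'b \<Rightarrow> real"
  assumes "finite A" "\<And>a. a \<in> A \<Longrightarrow> finite (B a)" "\<And>x. f x \<ge> 0"
  shows "(\<Sum>x\<in>(\<Union>a\<in>A. B a). f x) \<le> (\<Sum>a\<in>A. \<Sum>x\<in>B a. f x)"
  using assms(1,2)
proof (induction rule: finite_induct)
  case (insert a A)
  have "(\<Sum>x\<in>B a \<union> (\<Union>a\<in>A. B a). f x) \<le> (\<Sum>x\<in>B a. f x) + (\<Sum>x\<in>(\<Union>a\<in>A. B a). f x)"
    using insert assms(3) by (subst sum.union_inter[symmetric]) (auto intro: sum_nonneg)
  then show ?case using insert by simp
qed simp

lemma sum_cover_le:
  fixes f :: "'b \<Rightarrow> real"
  assumes "finite D" "finite T" "\<And>x. f x \<ge> 0" "\<And>x. x \<in> D \<Longrightarrow> \<exists>K\<in>T. P x K"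
  shows "(\<Sum>x\<in>D. f x) \<le> (\<Sum>K\<in>T. \<Sum>x\<in>{x\<in>D. P x K}. f x)"
proof -
  have "D = (\<Union>K\<in>T. {x\<in>D. P x K})" using assms(4) by blast
  then have "(\<Sum>x\<in>D. f x) = (\<Sum>x\<in>(\<Union>K\<in>T. {x\<in>D. P x K}). f x)" by (rule arg_cong)
  also have "\<dots> \<le> (\<Sum>K\<in>T. \<Sum>x\<in>{x\<in>D. P x K}. f x)" using assms by (intro sum_UN_le) auto
  finally show ?thesis .
qed

section \<open>Maximal intervals and packing under a cover\<close>

lemma maximal_subset: "maximal C \<subseteq> C"
  by (auto simp: maximal_def)

lemma maximal_disjoint:
  assumes "C \<subseteq> dyadic" "I \<in> maximal C" "J \<in> maximal C" "I \<noteq> J"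
  shows "I \<inter> J = {}"
  using dyadic_nested_cases[of I J] assms by (auto simp: maximal_def)

lemma maximal_above:
  assumes "C \<subseteq> dyadic" "I \<in> C"
  shows "\<exists>J\<in>maximal C. I \<subseteq> J"
proof -
  have "\<exists>J. (J \<in> C \<and> I \<subseteq> J) \<and> (\<forall>K. K \<in> C \<and> I \<subseteq> K \<longrightarrow> lev J \<le> lev K)"
    using assms by (intro ex_has_least_nat[of _ I]) auto
  then obtain J where J: "J \<in> C" "I \<subseteq> J" "\<And>K. K \<in> C \<Longrightarrow> I \<subseteq> K \<Longrightarrow> lev J \<le> lev K" by blast
  have "K = J" if "K \<in> C" "J \<subseteq> K" for K
  proof -
    have "lev K \<le> lev J" using subset_lev_mono[of K J] that J assms by blast
    moreover have "lev J \<le> lev K" using J that by blast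
    ultimately show ?thesis using subset_lev_eq[of K J] that J assms by (metis le_antisym subsetD)
  qed
  then show ?thesis using J by (auto simp: maximal_def)
qed

lemma sum_disjoint_le:
  assumes "finite C" "C \<subseteq> dyadic" "R \<in> dyadic" "\<And>I. I \<in> C \<Longrightarrow> I \<subseteq> R"
    and "\<And>I J. I \<in> C \<Longrightarrow> J \<in> C \<Longrightarrow> I \<noteq> J \<Longrightarrow> I \<inter> J = {}"
  shows "(\<Sum>I\<in>C. len I) \<le> len R"
proof -
  obtain N where N: "insert R C \<subseteq> dyadic_upto N" using finite_subset_upto[of "insert R C"] assms by auto
  have "(\<Sum>I\<in>C. len I) = (\<Sum>I\<in>C. isum N I (\<lambda>_. 1))" 
    using N by (intro sum.cong refl isum_1[symmetric]) (auto dest: dyadic_upto_memD)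
  also have "\<dots> = isum N (\<Union>C) (\<lambda>_. 1)" using assms N by (intro disjoint_sum_isum) auto
  also have "\<dots> \<le> isum N R (\<lambda>_. 1)" using assms by (intro isum_set_mono) auto
  also have "\<dots> = len R" using N by (intro isum_1) (auto dest: dyadic_upto_memD)
  finally show ?thesis .
qed

lemma carleson_disjoint:
  assumes "finite C" "C \<subseteq> dyadic" "\<And>I J. I \<in> C \<Longrightarrow> J \<in> C \<Longrightarrow> I \<noteq> J \<Longrightarrow> I \<inter> J = {}"
  shows "carleson 1 C"
  unfolding carleson_def using assms by (auto intro!: sum_disjoint_le)

text \<open>The packing bound is applied below each covering interval separately. The cover may
  overlap, since double counting only enlarges the right side.\<close>

lemma carleson_tops:
  assumes "carleson M C" "finite T" "T \<subseteq> dyadic" "\<And>I. I \<in> C \<Longrightarrow> \<exists>K\<in>T. I \<subseteq> K"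
  shows "(\<Sum>I\<in>C. len I) \<le> M * (\<Sum>K\<in>T. len K)"
proof -
  have "(\<Sum>I\<in>C. len I) \<le> (\<Sum>K\<in>T. \<Sum>I\<in>{I\<in>C. I \<subseteq> K}. len I)"
    using assms by (intro sum_cover_le) (auto simp: carleson_def)
  also have "\<dots> \<le> (\<Sum>K\<in>T. M * len K)" using assms carlesonD by (intro sum_mono) blast
  finally show ?thesis by (simp add: sum_distrib_left)
qed

text \<open>Below an arbitrary R the family splits under its maximal members, which are disjoint and
  fit into R. It is therefore enough to test intervals of the family itself.\<close>

lemma carleson_check:
  assumes "finite C" "C \<subseteq> dyadic" "M \<ge> 0" "\<And>R. R \<in> C \<Longrightarrow> (\<Sum>I\<in>{I\<in>C. I \<subseteq> R}. len I) \<le> M * len R"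
  shows "carleson M C"
  unfolding carleson_def
proof (intro conjI ballI)
  fix R assume R: "R \<in> dyadic"
  define D where "D = {I\<in>C. I \<subseteq> R}"
  have D: "finite D" "D \<subseteq> dyadic" using assms by (auto simp: D_def)
  have fm: "finite (maximal D)" using D(1) maximal_subset finite_subset by blast
  have "(\<Sum>I\<in>D. len I) \<le> (\<Sum>K\<in>maximal D. \<Sum>I\<in>{I\<in>D. I \<subseteq> K}. len I)"
    using D fm maximal_above[OF D(2)] by (intro sum_cover_le) auto
  also have "\<dots> \<le> (\<Sum>K\<in>maximal D. M * len K)"
  proof (rule sum_mono)
    fix K assume "K \<in> maximal D"
    then have "K \<in> C" "K \<subseteq> R" using maximal_subset D_def by auto
    then have "(\<Sum>I\<in>{I\<in>D. I \<subseteq> K}. len I) \<le> (\<Sum>I\<in>{I\<in>C. I \<subseteq> K}. len I)"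
      using assms(1) by (intro sum_mono2) (auto simp: D_def)
    then show "(\<Sum>I\<in>{I\<in>D. I \<subseteq> K}. len I) \<le> M * len K" using assms(4)[OF \<open>K \<in> C\<close>] by simp
  qed
  also have "\<dots> = M * (\<Sum>K\<in>maximal D. len K)" by (simp add: sum_distrib_left)
  also have "\<dots> \<le> M * len R"
  proof (intro mult_left_mono sum_disjoint_le fm R)
    show "maximal D \<subseteq> dyadic" using maximal_subset D(2) by blast
    show "\<And>I. I \<in> maximal D \<Longrightarrow> I \<subseteq> R" using maximal_subset unfolding D_def by blast
    show "\<And>I J. I \<in> maximal D \<Longrightarrow> J \<in> maximal D \<Longrightarrow> I \<noteq> J \<Longrightarrow> I \<inter> J = {}" using maximal_disjoint[OF D(2)] by blast
  qed (use assms in simp)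
  finally show "(\<Sum>I\<in>{I\<in>C. I \<subseteq> R}. len I) \<le> M * len R" by (simp add: D_def)
qed (use assms in auto)

text \<open>The recursion behind the Bellman induction: an interval below I is I itself or lies in
  exactly one half.\<close>

lemma sum_subtree_split:
  fixes f :: "real set \<Rightarrow> real"
  assumes "finite C" "C \<subseteq> dyadic" "I \<in> dyadic"
  shows "(\<Sum>J\<in>{J\<in>C. J \<subseteq> I}. f J) = (if I \<in> C then f I else 0) + (\<Sum>J\<in>{J\<in>C. J \<subseteq> lft I}. f J) + (\<Sum>J\<in>{J\<in>C. J \<subseteq> rgt I}. f J)"
proof -
  have nI: "\<not> I \<subseteq> lft I" "\<not> I \<subseteq> rgt I"
    using psubset_lev[of "lft I" I] psubset_lev[of "rgt I" I] subset_lev_mono children[OF assms(3)] assms(3)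
    by (metis Suc_n_not_le_n)+
  have sub: "lft I \<subseteq> I" "rgt I \<subseteq> I" using children(5)[OF assms(3)] by auto
  have dis: "\<not> (J \<subseteq> lft I \<and> J \<subseteq> rgt I)" if "J \<in> C" for J
    using dyadic_nonempty[of J] assms(2) that children(6)[OF assms(3)] by blast
  have "{J\<in>C. J \<subseteq> I} = (C \<inter> {I}) \<union> ({J\<in>C. J \<subseteq> lft I} \<union> {J\<in>C. J \<subseteq> rgt I})"
    using subset_children[OF assms(3)] assms(2) sub by blast
  also have "sum f \<dots> = sum f (C \<inter> {I}) + sum f ({J\<in>C. J \<subseteq> lft I} \<union> {J\<in>C. J \<subseteq> rgt I})"
    using assms(1) nI by (intro sum.union_disjoint) auto
  also have "sum f ({J\<in>C. J \<subseteq> lft I} \<union> {J\<in>C. J \<subseteq> rgt I}) = (\<Sum>J\<in>{J\<in>C. J \<subseteq> lft I}. f J) + (\<Sum>J\<in>{J\<in>C. J \<subseteq> rgt I}. f J)"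
    using assms(1) dis by (intro sum.union_disjoint) auto
  also have "sum f (C \<inter> {I}) = (if I \<in> C then f I else 0)" by simp
  finally show ?thesis by simp
qed

text \<open>The Bellman function is \<open>x\<^sup>r / (1 + A)\<^bsup>r - 1\<^esup>\<close>, with \<open>x\<close> the mean of \<open>g\<close> over an interval and
  \<open>A\<close> the normalised mass of the family below that interval.\<close>

theorem carleson_embedding:
  assumes C: "carleson M C" "C \<subseteq> dyadic_upto N" and M: "M > 0" and r: "r > 1" and g: "\<And>t. g t \<ge> 0"
  shows "(\<Sum>I\<in>C. len I * (isum N I g / len I) powr r) \<le> M * (2 powr r / (r - 1)) * isum N UNIV (\<lambda>t. g t powr r)"
proof -
  define c where "c = (r - 1) / 2 powr r"
  have c: "c > 0" using r by (simp add: c_def)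
  define x where "x = (\<lambda>I. isum N I g / len I)"
  \<comment> \<open>Division by M normalises the Carleson constant to 1, so that
    \<open>S I / len I\<close> stays in [0,1] as \<open>bellman_gain\<close> requires.\<close>
  define S where "S = (\<lambda>I. (\<Sum>J\<in>{J\<in>C. J \<subseteq> I}. len J / M))"
  define T where "T = (\<lambda>I. (\<Sum>J\<in>{J\<in>C. J \<subseteq> I}. len J / M * x J powr r))"
  have fin: "finite C" "C \<subseteq> dyadic" using C by (auto simp: carleson_def)
  have x0: "x I \<ge> 0" if "I \<in> dyadic" for I using g isum_nonneg len_pos[OF that] by (simp add: x_def)
  have S: "0 \<le> S I" "S I / len I \<le> 1" if "I \<in> dyadic" for I
  proof -
    show "0 \<le> S I" unfolding S_def using M by (intro sum_nonneg) auto
    show "S I / len I \<le> 1" using carlesonD[OF C(1) that] M len_pos[OF that]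
      by (simp add: S_def flip: sum_divide_distrib)
  qed
  \<comment> \<open>The second summand is the Bellman value left over at I; one level higher it pays
    for the mass of the parent. The gains accumulate in \<open>T\<close>.\<close>
  have main: "c * T I + len I * (x I powr r / (1 + S I / len I) powr (r - 1)) \<le> isum N I (\<lambda>t. g t powr r)"
    if "I \<in> dyadic" "lev I \<le> N" for I
    using that
  proof (induction rule: dyadic_induct_up)
    case (leaf I)
    define a where "a = (if I \<in> C then 1 / M else 0)"
    have e: "{J\<in>C. J \<subseteq> I} = C \<inter> {I}"
    proof -
      have "J = I" if J: "J \<in> C" "J \<subseteq> I" for J
      proof -
        have JD: "J \<in> dyadic" "lev J \<le> N" using J(1) C(2) dyadic_upto_memD by blast+
        then have "lev I = lev J" using subset_lev_mono[OF leaf(1) JD(1) J(2)] leaf(2) by simp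
        then show ?thesis using subset_lev_eq[OF leaf(1) JD(1) J(2)] by simp
      qed
      then show ?thesis by blast
    qed
    have TI: "T I = a * len I * x I powr r" "S I = a * len I" by (auto simp: T_def S_def e a_def)
    have a: "0 \<le> a" "a \<le> 1" using S[OF leaf(1)] len_pos[OF leaf(1)] M TI by (auto simp: a_def)
    obtain s where s: "isum N I g = g s * len I" "isum N I (\<lambda>t. g t powr r) = g s powr r * len I"
    proof -
      obtain t where t: "t \<in> {0..<1}" "I = cell N t" using leaf dyadic_lev dyadic_level_cell by blast
      obtain s where "grid N \<inter> I = {s}" using grid_Int_cell[OF t(1)] t(2) by blast
      then show ?thesis using leaf by (intro that[of s]) (simp_all add: isum_def len_dyadic)
    qed
    have x: "x I = g s" using s len_pos[OF leaf(1)] by (simp add: x_def)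
    have "1 / (1 + a + 0) powr (r - 1) + a * c \<le> 1 / (1 + 0) powr (r - 1)"
      unfolding c_def using a r by (intro bellman_gain) auto
    then have "(1 / (1 + a) powr (r - 1) + a * c) * (x I powr r * len I) \<le> 1 * (x I powr r * len I)"
      using len_pos[OF leaf(1)] by (intro mult_right_mono) auto
    then show ?case unfolding TI s x using len_pos[OF leaf(1)] by (simp add: algebra_simps)
  next
    case (split I)
    define L R where "L = lft I" and "R = rgt I"
    have LR: "L \<in> dyadic" "R \<in> dyadic" "len L = len I / 2" "len R = len I / 2"
      using children[OF split(1)] len_children[OF split(1)] by (auto simp: L_def R_def)
    define a where "a = (if I \<in> C then 1 / M else 0)"
    define b where "b = (S L / len L + S R / len R) / 2"
    have lp: "len I > 0" using len_pos split by blast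
    have TI: "T I = a * len I * x I powr r + T L + T R" 
      unfolding T_def sum_subtree_split[OF fin split(1)] by (simp add: a_def L_def R_def)
    have "S I = a * len I + S L + S R"
      unfolding S_def sum_subtree_split[OF fin split(1)] by (simp add: a_def L_def R_def)
    then have SI: "S I / len I = a + b" using lp by (simp add: b_def LR field_simps)
    have xI: "x I = (x L + x R) / 2"
      using lp unfolding x_def isum_split[OF split(1)] LR by (simp add: L_def R_def field_simps LR)
    have a: "0 \<le> a" using M by (simp add: a_def)
    have b: "0 \<le> b" using S LR len_pos by (simp add: b_def)
    have ab: "a + b \<le> 1" using S(2)[OF split(1)] SI by simp
    \<comment> \<open>With a the mass of I itself and b the mean mass of its halves,
      \<open>p1\<close> trades a for the gain c a x^r, and \<open>p2\<close> distributes the rest to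
      the halves by convexity.\<close>
    have p1: "(1 / (1 + a + b) powr (r - 1) + a * c) * x I powr r \<le> 1 / (1 + b) powr (r - 1) * x I powr r"
      unfolding c_def using a b ab r by (intro mult_right_mono bellman_gain) auto
    have "2 * (((x L + x R) / 2) powr r / (((1 + S L / len L) + (1 + S R / len R)) / 2) powr (r - 1))
        \<le> x L powr r / (1 + S L / len L) powr (r - 1) + x R powr r / (1 + S R / len R) powr (r - 1)"
      using x0 S LR len_pos r by (intro perspective_convex) (auto intro!: add_pos_nonneg)
    also have "((1 + S L / len L) + (1 + S R / len R)) / 2 = 1 + b" by (simp add: b_def field_simps)
    finally have p2: "2 * (x I powr r / (1 + b) powr (r - 1))
        \<le> x L powr r / (1 + S L / len L) powr (r - 1) + x R powr r / (1 + S R / len R) powr (r - 1)" unfolding xI .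
    have "c * T I + len I * (x I powr r / (1 + S I / len I) powr (r - 1))
      = c * T L + c * T R + len I * ((1 / (1 + a + b) powr (r - 1) + a * c) * x I powr r)"
      unfolding TI SI by (simp add: algebra_simps)
    also have "\<dots> \<le> c * T L + c * T R + len I * (1 / (1 + b) powr (r - 1) * x I powr r)"
      using p1 lp by (intro add_left_mono mult_left_mono) auto
    also have "\<dots> \<le> c * T L + c * T R + len I / 2 * (x L powr r / (1 + S L / len L) powr (r - 1) + x R powr r / (1 + S R / len R) powr (r - 1))"
      using mult_left_mono[OF p2, of "len I / 2"] lp by simp
    also have "\<dots> = (c * T L + len L * (x L powr r / (1 + S L / len L) powr (r - 1))) + (c * T R + len R * (x R powr r / (1 + S R / len R) powr (r - 1)))"
      by (simp add: LR algebra_simps)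
    also have "\<dots> \<le> isum N L (\<lambda>t. g t powr r) + isum N R (\<lambda>t. g t powr r)"
      using split(3,4) unfolding L_def R_def by (rule add_mono)
    also have "\<dots> = isum N I (\<lambda>t. g t powr r)" unfolding isum_split[OF split(1), of N] by (simp add: L_def R_def)
    finally show ?case .
  qed
  define U where "U = {0..<1::real}"
  have U: "U \<in> dyadic" "lev U \<le> N" using unit_dyadic by (auto simp: U_def)
  have CU: "{J\<in>C. J \<subseteq> U} = C" using fin dyadic_subset_unit by (auto simp: U_def)
  have "c * T U \<le> c * T U + len U * (x U powr r / (1 + S U / len U) powr (r - 1))" using len_pos[OF U(1)] by simp
  also have "\<dots> \<le> isum N U (\<lambda>t. g t powr r)" using main[OF U] .
  also have "\<dots> \<le> isum N UNIV (\<lambda>t. g t powr r)" by (intro isum_set_mono) auto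
  finally have "c * (\<Sum>J\<in>C. len J * x J powr r) \<le> M * isum N UNIV (\<lambda>t. g t powr r)"
    unfolding T_def CU using M by (simp add: field_simps sum_distrib_left flip: sum_divide_distrib)
  then show ?thesis using c r by (simp add: x_def c_def field_simps)
qed

section \<open>Shifts of a rearrangement\<close>

definition preserves_carleson :: "(real set \<Rightarrow> real set) \<Rightarrow> bool" where
  "preserves_carleson \<tau> \<longleftrightarrow> (\<forall>M. \<exists>M'\<ge>1. \<forall>C. carleson M C \<longrightarrow> carleson M' (\<tau> ` C))"

text \<open>The logarithm to base 2 of |\<tau>(J)| / |J|; it is positive where \<tau>
  enlarges.\<close>

definition shift :: "(real set \<Rightarrow> real set) \<Rightarrow> real set \<Rightarrow> int" where
  "shift \<tau> J = int (lev J) - int (lev (\<tau> J))"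

definition tops :: "(real set \<Rightarrow> real set) \<Rightarrow> real set set \<Rightarrow> int \<Rightarrow> real set set" where
  "tops \<tau> \<Lambda> k = maximal {J \<in> \<Lambda>. shift \<tau> J = k}"

lemma len_shift:
  assumes "J \<in> dyadic" "\<tau> J \<in> dyadic"
  shows "len (\<tau> J) = 2 powi (shift \<tau> J) * len J"
  using assms by (simp add: len_dyadic shift_def power_int_diff)

lemma sum_geometric_le:
  fixes x :: real
  assumes "finite A" "A \<subseteq> {1..}" "0 \<le> x" "x \<le> 1 / 2"
  shows "(\<Sum>n\<in>A. x ^ n) \<le> 2 * x"
proof -
  obtain m where m: "A \<subseteq> {1..m}" using assms(1,2) by (metis atLeastAtMost_iff atLeast_iff finite_nat_set_iff_bounded_le subset_iff)
  have "(\<Sum>n\<in>A. x ^ n) \<le> (\<Sum>n=1..m. x ^ n)" using m assms by (intro sum_mono2) auto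
  also have "\<dots> \<le> 2 * x"
  proof -
    have "(\<Sum>n=1..m. x ^ n) + 2 * x ^ Suc m \<le> 2 * x"
    proof (induction m)
      case (Suc m)
      have "x * x ^ Suc m \<le> 1 / 2 * x ^ Suc m" using assms by (intro mult_right_mono) auto
      then show ?case using Suc by simp
    qed simp
    moreover have "0 \<le> 2 * x ^ Suc m" using assms by simp
    ultimately show ?thesis by linarith
  qed
  finally show ?thesis .
qed

text \<open>The exponents are negative multiples of L, so a geometric series of ratio 2^(-L)
  dominates. A large gap L makes the sum as small as desired.\<close>

lemma sum_powi_le:
  fixes L :: nat
  assumes "finite S" "L \<ge> 1" "\<And>k. k \<in> S \<Longrightarrow> a < k \<and> k mod int L = a mod int L"
  shows "(\<Sum>k\<in>S. 2 powi (a - k)) \<le> (2 / 2 ^ L :: real)"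
proof -
  define f where "f = (\<lambda>k. nat ((k - a) div int L))"
  have f: "k = a + int L * int (f k)" "f k \<ge> 1" if k: "k \<in> S" for k
  proof -
    have "int L dvd k - a" using assms(3)[OF k] by (simp add: mod_eq_dvd_iff)
    then obtain d where d: "k - a = int L * d" by blast
    have "int L * d > 0" using assms(3)[OF k] d by linarith
    then have "d > 0" using assms(2) by (simp add: zero_less_mult_iff)
    moreover have "(k - a) div int L = d" using d assms(2) by simp
    ultimately show "k = a + int L * int (f k)" "f k \<ge> 1" using d by (auto simp: f_def)
  qed
  have inj: "inj_on f S" by (rule inj_onI) (metis f(1))
  have "(\<Sum>k\<in>S. 2 powi (a - k)) = (\<Sum>k\<in>S. (1 / 2 ^ L :: real) ^ f k)"
  proof (rule sum.cong)
    fix k assume "k \<in> S"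
    then have e: "a - k = - int (L * f k)" using f(1) by fastforce
    show "2 powi (a - k) = (1 / 2 ^ L :: real) ^ f k"
      unfolding e power_int_minus power_int_of_nat power_mult by (simp add: power_one_over inverse_eq_divide)
  qed simp
  also have "\<dots> = (\<Sum>n\<in>f ` S. (1 / 2 ^ L) ^ n)" using inj by (simp add: sum.reindex)
  also have "\<dots> \<le> 2 * (1 / 2 ^ L)"
  proof (rule sum_geometric_le)
    have "(2::real) ^ 1 \<le> 2 ^ L" using assms(2) by (intro power_increasing) auto
    then show "(1 / 2 ^ L :: real) \<le> 1 / 2" by (simp add: field_simps)
  qed (use assms f in auto)
  finally show ?thesis by simp
qed

text \<open>Few shifts occur below a given interval. Otherwise the maximal intervals of well separated shifts,
  after removal of a small part, would have a sparse image, although they pile up on \<open>Q\<close>.\<close>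

theorem shift_classes_packing:
  assumes bij: "bij_betw \<tau> dyadic dyadic" and pt: "preserves_carleson \<tau>"
    and ps: "preserves_carleson (inv_into dyadic \<tau>)"
  shows "\<exists>B\<ge>1. \<forall>Q\<in>dyadic. \<forall>\<Lambda> S. finite \<Lambda> \<longrightarrow> \<Lambda> \<subseteq> dyadic \<longrightarrow> (\<forall>J\<in>\<Lambda>. J \<subseteq> Q) \<longrightarrow> finite S \<longrightarrow>
     (\<Sum>k\<in>S. \<Sum>I\<in>tops \<tau> \<Lambda> k. len I) \<le> B * len Q"
proof -
  define \<sigma> where "\<sigma> = inv_into dyadic \<tau>"
  have \<tau>D: "\<tau> J \<in> dyadic" if "J \<in> dyadic" for J using bij that by (metis bij_betw_apply)
  have \<sigma>\<tau>: "\<sigma> (\<tau> J) = J" if "J \<in> dyadic" for J using bij that by (simp add: \<sigma>_def bij_betw_inv_into_left)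
  have inj: "\<tau> I = \<tau> J \<Longrightarrow> I = J" if "I \<in> dyadic" "J \<in> dyadic" for I J using \<sigma>\<tau> that by metis
  obtain M where M: "M \<ge> 1" "\<And>C. carleson 1 C \<Longrightarrow> carleson M (\<tau> ` C)"
    using pt unfolding preserves_carleson_def by blast
  obtain M' where M': "M' \<ge> 1" "\<And>C. carleson (M + 1) C \<Longrightarrow> carleson M' (\<sigma> ` C)"
    using ps unfolding preserves_carleson_def \<sigma>_def by blast
  \<comment> \<open>The gap L is chosen such that the loss 8 M / 2^L from the bad shifts is at most
    1/2 and can be absorbed.\<close>
  obtain L :: nat where "16 * M < 2 ^ L" using real_arch_pow[of 2 "16 * M"] by auto
  moreover have "L \<noteq> 0" using calculation M(1) by (intro notI) simp
  ultimately have L: "16 * M < 2 ^ L" "L \<ge> 1" by auto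
  have residue: "(\<Sum>k\<in>S. \<Sum>I\<in>tops \<tau> \<Lambda> k. len I) \<le> 4 * M' * len Q"
    if Q: "Q \<in> dyadic" and \<Lambda>: "finite \<Lambda>" "\<Lambda> \<subseteq> dyadic" "\<And>J. J \<in> \<Lambda> \<Longrightarrow> J \<subseteq> Q"
      and S: "finite S" "\<And>k l. k \<in> S \<Longrightarrow> l \<in> S \<Longrightarrow> k mod int L = l mod int L" for Q \<Lambda> S
  proof -
    define T where "T = tops \<tau> \<Lambda>"
    have T: "T k \<subseteq> \<Lambda>" "finite (T k)" "T k \<subseteq> dyadic" for k
    proof -
      show TL: "T k \<subseteq> \<Lambda>" using maximal_subset[of "{J \<in> \<Lambda>. shift \<tau> J = k}"] unfolding T_def tops_def by blast
      then show "finite (T k)" "T k \<subseteq> dyadic" using \<Lambda>(1,2) finite_subset by blast+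
    qed
    have TD: "I \<in> dyadic" "I \<in> \<Lambda>" if "I \<in> T k" for I k using T(1,3)[of k] that by blast+
    have Tsh: "shift \<tau> I = k" if "I \<in> T k" for I k using that maximal_subset unfolding T_def tops_def by blast
    have Tdis: "I \<inter> J = {}" if "I \<in> T k" "J \<in> T k" "I \<noteq> J" for I J k
      using maximal_disjoint[of "{J \<in> \<Lambda>. shift \<tau> J = k}" I J] that \<Lambda> by (auto simp: T_def tops_def)
    have carlT: "carleson M (\<tau> ` T k)" for k using T Tdis by (intro M(2) carleson_disjoint) blast+
    define u where "u = (\<lambda>k. \<Sum>I\<in>T k. len I)"
    define m where "m = (\<lambda>k. \<Sum>I\<in>T k. len (\<tau> I))"
    have m_eq: "m k = 2 powi k * u k" for k
      unfolding m_def u_def sum_distrib_left using T Tsh \<tau>D len_shift by (intro sum.cong refl) (metis subsetD)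
    have u0: "u k \<ge> 0" and m0: "m k \<ge> 0" for k by (auto simp: u_def m_def intro: sum_nonneg)
    \<comment> \<open>The images of the tops of all smaller shifts in S; \<open>W k\<close> bounds
      their total length.\<close>
    define Lw where "Lw = (\<lambda>k. \<Union>l\<in>{l\<in>S. l < k}. \<tau> ` T l)"
    have Lw: "finite (Lw k)" "Lw k \<subseteq> dyadic" for k using S T(2) TD(1) \<tau>D by (auto simp: Lw_def)
    define W where "W = (\<lambda>k. \<Sum>l\<in>{l\<in>S. l < k}. m l)"
    have LwW: "(\<Sum>K\<in>Lw k. len K) \<le> W k" for k
    proof -
      have "(\<Sum>K\<in>Lw k. len K) \<le> (\<Sum>l\<in>{l\<in>S. l < k}. \<Sum>K\<in>\<tau> ` T l. len K)"
        unfolding Lw_def using S T by (intro sum_UN_le) auto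
      moreover have "(\<Sum>K\<in>\<tau> ` T l. len K) = m l" for l
        unfolding m_def using inj TD(1) by (subst sum.reindex) (auto simp: inj_on_def)
      ultimately show ?thesis by (simp add: W_def)
    qed
    \<comment> \<open>Two kinds of tops are discarded: those whose image lies under an image of
      smaller shift, and those whose image is outweighed by images of smaller shift inside
      it.\<close>
    define ba where "ba = (\<lambda>k. {I\<in>T k. \<exists>K\<in>Lw k. \<tau> I \<subseteq> K})"
    define bb where "bb = (\<lambda>k. {I\<in>T k. len (\<tau> I) < (\<Sum>K\<in>{K\<in>Lw k. K \<subseteq> \<tau> I}. len K)})"
    have sumim: "(\<Sum>I\<in>A. len (\<tau> I)) = (\<Sum>K\<in>\<tau> ` A. len K)" if "A \<subseteq> dyadic" for A
      using inj that by (subst sum.reindex) (auto simp: inj_on_def)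
    have a: "(\<Sum>I\<in>ba k. len (\<tau> I)) \<le> M * W k" for k
    proof -
      have "(\<Sum>I\<in>ba k. len (\<tau> I)) = (\<Sum>K\<in>\<tau> ` ba k. len K)" using TD by (intro sumim) (auto simp: ba_def)
      also have "\<dots> \<le> M * (\<Sum>K\<in>Lw k. len K)"
        using Lw T by (intro carleson_tops carleson_subset[OF carlT[of k]]) (auto simp: ba_def)
      also have "\<dots> \<le> M * W k" using LwW M by simp
      finally show ?thesis .
    qed
    \<comment> \<open>The maximal ones among these images are disjoint and each is outweighed from
      inside, so together they are no longer than \<open>W k\<close>. The Carleson constant of the
      single class supplies the factor M.\<close>
    have b: "(\<Sum>I\<in>bb k. len (\<tau> I)) \<le> M * W k" for k
    proof -
      define D where "D = \<tau> ` bb k"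
      have D: "finite D" "D \<subseteq> dyadic" using T(2)[of k] TD(1) \<tau>D by (auto simp: D_def bb_def)
      have fm: "finite (maximal D)" "maximal D \<subseteq> dyadic" using D maximal_subset finite_subset by blast+
      have "(\<Sum>I\<in>bb k. len (\<tau> I)) = (\<Sum>K\<in>D. len K)" unfolding D_def using TD by (intro sumim) (auto simp: bb_def)
      also have "\<dots> \<le> M * (\<Sum>K\<in>maximal D. len K)"
        using fm maximal_above[OF D(2)] by (intro carleson_tops carleson_subset[OF carlT[of k]]) (auto simp: D_def bb_def)
      also have "(\<Sum>K\<in>maximal D. len K) \<le> (\<Sum>K\<in>maximal D. \<Sum>K'\<in>{K'\<in>Lw k. K' \<subseteq> K}. len K')"
      proof (rule sum_mono)
        fix K assume "K \<in> maximal D"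
        then have "K \<in> D" using maximal_subset by blast
        then show "len K \<le> (\<Sum>K'\<in>{K'\<in>Lw k. K' \<subseteq> K}. len K')" by (auto simp: D_def bb_def)
      qed
      also have "\<dots> = (\<Sum>K'\<in>(\<Union>K\<in>maximal D. {K'\<in>Lw k. K' \<subseteq> K}). len K')"
      proof (rule sum.UNION_disjoint[symmetric])
        show "\<forall>i\<in>maximal D. \<forall>j\<in>maximal D. i \<noteq> j \<longrightarrow> {K'\<in>Lw k. K' \<subseteq> i} \<inter> {K'\<in>Lw k. K' \<subseteq> j} = {}"
        proof (intro ballI impI)
          fix i j assume ij: "i \<in> maximal D" "j \<in> maximal D" "i \<noteq> j"
          have "i \<inter> j = {}" using maximal_disjoint[OF D(2) ij] .
          then show "{K'\<in>Lw k. K' \<subseteq> i} \<inter> {K'\<in>Lw k. K' \<subseteq> j} = {}" using dyadic_nonempty Lw(2)[of k] by blast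
        qed
      qed (use fm Lw in auto)
      also have "\<dots> \<le> (\<Sum>K'\<in>Lw k. len K')" using Lw by (intro sum_mono2) auto
      also have "\<dots> \<le> W k" using LwW .
      finally show ?thesis using M by simp
    qed
    \<comment> \<open>Good shifts: both removals together cost at most 2 M \<open>W k\<close>, which
      here is at most half of the image length \<open>m k\<close>.\<close>
    define G where "G = {k\<in>S. 4 * M * W k \<le> m k}"
    define T' where "T' = (\<lambda>k. T k - ba k - bb k)"
    have half: "u k \<le> 2 * (\<Sum>I\<in>T' k. len I)" if "k \<in> G" for k
    proof -
      have "m k \<le> (\<Sum>I\<in>T' k. len (\<tau> I)) + ((\<Sum>I\<in>ba k. len (\<tau> I)) + (\<Sum>I\<in>bb k. len (\<tau> I)))"
      proof -
        have fi: "finite (ba k)" "finite (bb k)" "finite (T' k)" using T[of k] by (auto simp: ba_def bb_def T'_def)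
        have "T k = T' k \<union> (ba k \<union> bb k)" by (auto simp: T'_def ba_def bb_def)
        then have "m k = (\<Sum>I\<in>T' k \<union> (ba k \<union> bb k). len (\<tau> I))" unfolding m_def by (rule arg_cong)
        also have "\<dots> \<le> (\<Sum>I\<in>T' k. len (\<tau> I)) + (\<Sum>I\<in>ba k \<union> bb k. len (\<tau> I))"
          using fi by (subst sum.union_inter[symmetric]) (auto intro: sum_nonneg)
        also have "(\<Sum>I\<in>ba k \<union> bb k. len (\<tau> I)) \<le> (\<Sum>I\<in>ba k. len (\<tau> I)) + (\<Sum>I\<in>bb k. len (\<tau> I))"
          using fi by (subst sum.union_inter[symmetric]) (auto intro: sum_nonneg)
        finally show ?thesis by simp
      qed
      then have "m k \<le> 2 * (\<Sum>I\<in>T' k. len (\<tau> I))" using a[of k] b[of k] that by (simp add: G_def)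
      also have "(\<Sum>I\<in>T' k. len (\<tau> I)) = 2 powi k * (\<Sum>I\<in>T' k. len I)"
        unfolding sum_distrib_left
      proof (rule sum.cong)
        fix I assume "I \<in> T' k"
        then have "I \<in> T k" by (simp add: T'_def)
        then show "len (\<tau> I) = 2 powi k * len I" using len_shift[of I \<tau>] Tsh T(3) \<tau>D by auto
      qed simp
      finally have "2 powi k * u k \<le> 2 powi k * (2 * (\<Sum>I\<in>T' k. len I))" unfolding m_eq by simp
      then show ?thesis by (rule mult_left_le_imp_le) simp
    qed
    define F where "F = (\<Union>k\<in>G. T' k)"
    have F: "finite F" "F \<subseteq> dyadic" "\<And>I. I \<in> F \<Longrightarrow> I \<subseteq> Q"
    proof -
      show "finite F" using S T(2) by (auto simp: F_def G_def T'_def)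
      have "F \<subseteq> \<Lambda>" using TD(2) by (auto simp: F_def T'_def)
      then show "F \<subseteq> dyadic" "\<And>I. I \<in> F \<Longrightarrow> I \<subseteq> Q" using \<Lambda>(2,3) by blast+
    qed
    \<comment> \<open>Below an image R of shift k, images of the same shift contribute at most M
      |R|. Those of smaller shift contribute at most |R|, since R survived the second removal, and
      those of larger shift would have fallen to the first.\<close>
    have "carleson (M + 1) (\<tau> ` F)"
    proof (rule carleson_check)
      fix R assume "R \<in> \<tau> ` F"
      then obtain k I where kI: "k \<in> G" "I \<in> T' k" "R = \<tau> I" by (auto simp: F_def)
      have I: "I \<in> T k" "I \<notin> bb k" "I \<in> dyadic" using kI T(3)[of k] by (auto simp: T'_def)
      have sub: "{K \<in> \<tau> ` F. K \<subseteq> R} \<subseteq> {K \<in> \<tau> ` T k. K \<subseteq> R} \<union> {K \<in> Lw k. K \<subseteq> R}"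
      proof
        fix K assume "K \<in> {K \<in> \<tau> ` F. K \<subseteq> R}"
        then obtain l J where J: "l \<in> G" "J \<in> T' l" "K = \<tau> J" "K \<subseteq> R" by (auto simp: F_def)
        have JT: "J \<in> T l" "J \<notin> ba l" using J by (auto simp: T'_def)
        consider "l = k" | "l < k" | "k < l" by linarith
        then show "K \<in> {K \<in> \<tau> ` T k. K \<subseteq> R} \<union> {K \<in> Lw k. K \<subseteq> R}"
        proof cases
          case 1
          then show ?thesis using J JT by auto
        next
          case 2
          then show ?thesis using J JT by (auto simp: Lw_def G_def)
        next
          case 3
          have "R \<in> Lw l" using kI I 3 by (auto simp: Lw_def G_def)
          then have "J \<in> ba l" using JT J by (auto simp: ba_def)
          then show ?thesis using JT by blast
        qed
      qed
      have "(\<Sum>K\<in>{K \<in> \<tau> ` F. K \<subseteq> R}. len K) \<le> (\<Sum>K\<in>{K \<in> \<tau> ` T k. K \<subseteq> R} \<union> {K \<in> Lw k. K \<subseteq> R}. len K)"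
        using sub T Lw by (intro sum_mono2) auto
      also have "\<dots> \<le> (\<Sum>K\<in>{K \<in> \<tau> ` T k. K \<subseteq> R}. len K) + (\<Sum>K\<in>{K \<in> Lw k. K \<subseteq> R}. len K)"
        using T Lw by (subst sum.union_inter[symmetric]) (auto intro: sum_nonneg)
      also have "\<dots> \<le> M * len R + len R"
      proof (rule add_mono)
        show "(\<Sum>K\<in>{K \<in> \<tau> ` T k. K \<subseteq> R}. len K) \<le> M * len R"
          using carlesonD[OF carlT[of k], of R] \<tau>D I kI by simp
        show "(\<Sum>K\<in>{K \<in> Lw k. K \<subseteq> R}. len K) \<le> len R" using I kI(3) by (auto simp: bb_def)
      qed
      finally show "(\<Sum>K\<in>{K \<in> \<tau> ` F. K \<subseteq> R}. len K) \<le> (M + 1) * len R" by (simp add: algebra_simps)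
    qed (use F \<tau>D M in auto)
    then have "carleson M' (\<sigma> ` \<tau> ` F)" by (rule M'(2))
    moreover have "\<sigma> ` \<tau> ` F = F" using F(2) \<sigma>\<tau> by (force simp: image_iff)
    ultimately have "carleson M' F" by simp
    then have "(\<Sum>I\<in>{I\<in>F. I \<subseteq> Q}. len I) \<le> M' * len Q" using Q by (rule carlesonD)
    then have FQ: "(\<Sum>I\<in>F. len I) \<le> M' * len Q" using F(3) by (simp add: Collect_conj_eq Int_absorb2 subset_iff)
    have "(\<Sum>k\<in>G. u k) \<le> (\<Sum>k\<in>G. 2 * (\<Sum>I\<in>T' k. len I))" using half by (intro sum_mono) auto
    also have "\<dots> = 2 * (\<Sum>I\<in>F. len I)"
    proof -
      have "(\<Sum>I\<in>F. len I) = (\<Sum>k\<in>G. \<Sum>I\<in>T' k. len I)"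
        unfolding F_def
      proof (rule sum.UNION_disjoint)
        show "\<forall>i\<in>G. \<forall>j\<in>G. i \<noteq> j \<longrightarrow> T' i \<inter> T' j = {}" using Tsh unfolding T'_def by blast
      qed (use S T in \<open>auto simp: G_def T'_def\<close>)
      then show ?thesis by (simp add: sum_distrib_left)
    qed
    also have "\<dots> \<le> 2 * M' * len Q" using FQ by simp
    finally have good: "(\<Sum>k\<in>G. u k) \<le> 2 * M' * len Q" .
    \<comment> \<open>At a bad shift the image length is controlled by that of smaller shifts.
      Because \<open>m k\<close> is 2^k times \<open>u k\<close>, this bounds \<open>u k\<close> by
      earlier values with geometric weights 2^(l-k).\<close>
    have "(\<Sum>k\<in>S - G. u k) \<le> (\<Sum>k\<in>S - G. 4 * M * (\<Sum>l\<in>{l\<in>S. l < k}. 2 powi (l - k) * u l))"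
    proof (rule sum_mono)
      fix k assume "k \<in> S - G"
      then have "2 powi k * u k \<le> 4 * M * W k" unfolding G_def m_eq[symmetric] by auto
      also have "4 * M * W k = 2 powi k * (4 * M * (\<Sum>l\<in>{l\<in>S. l < k}. 2 powi (l - k) * u l))"
        by (simp add: W_def m_eq sum_distrib_left power_int_diff)
      finally show "u k \<le> 4 * M * (\<Sum>l\<in>{l\<in>S. l < k}. 2 powi (l - k) * u l)" by (rule mult_left_le_imp_le) simp
    qed
    also have "\<dots> \<le> (\<Sum>k\<in>S. 4 * M * (\<Sum>l\<in>{l\<in>S. l < k}. 2 powi (l - k) * u l))"
      using S M u0 by (intro sum_mono2) (auto intro!: mult_nonneg_nonneg sum_nonneg)
    also have "\<dots> = 4 * M * (\<Sum>k\<in>S. \<Sum>l\<in>S. if l < k then 2 powi (l - k) * u l else 0)"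
      using S by (simp add: sum_distrib_left sum.inter_filter)
    also have "(\<Sum>k\<in>S. \<Sum>l\<in>S. if l < k then 2 powi (l - k) * u l else 0) = (\<Sum>l\<in>S. (\<Sum>k\<in>{k\<in>S. l < k}. 2 powi (l - k)) * u l)"
    proof (subst sum.swap, rule sum.cong[OF refl])
      fix l
      show "(\<Sum>k\<in>S. if l < k then 2 powi (l - k) * u l else 0) = (\<Sum>k\<in>{k\<in>S. l < k}. 2 powi (l - k)) * u l"
        unfolding sum_distrib_right using S by (intro sum.inter_filter[symmetric]) auto
    qed
    also have "\<dots> \<le> (\<Sum>l\<in>S. (2 / 2 ^ L) * u l)"
    proof (intro sum_mono mult_right_mono sum_powi_le u0 L(2))
      show "finite {k \<in> S. l < k}" for l using S(1) by simp
      show "l < k \<and> k mod int L = l mod int L" if "l \<in> S" "k \<in> {k \<in> S. l < k}" for k l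
        using that S(2)[of k l] by blast
    qed
    finally have "(\<Sum>k\<in>S - G. u k) \<le> 4 * M * (\<Sum>l\<in>S. (2 / 2 ^ L) * u l)" using M by simp
    also have "\<dots> = (8 * M / 2 ^ L) * (\<Sum>l\<in>S. u l)" by (simp add: sum_distrib_left mult.assoc)
    also have "\<dots> \<le> 1 / 2 * (\<Sum>l\<in>S. u l)"
    proof (rule mult_right_mono)
      show "8 * M / 2 ^ L \<le> 1 / 2" using L(1) by (simp add: field_simps)
      show "0 \<le> (\<Sum>l\<in>S. u l)" using u0 by (rule sum_nonneg)
    qed
    finally have bad: "(\<Sum>k\<in>S - G. u k) \<le> 1 / 2 * (\<Sum>l\<in>S. u l)" .
    have "(\<Sum>l\<in>S. u l) = (\<Sum>k\<in>S - G. u k) + (\<Sum>k\<in>G. u k)"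
      using S by (intro sum.subset_diff) (auto simp: G_def)
    then have "(\<Sum>l\<in>S. u l) \<le> 4 * M' * len Q" using good bad by linarith
    then show ?thesis by (simp add: u_def T_def)
  qed
  show ?thesis
  \<comment> \<open>The factor L counts the residue classes; within each, absorbing the bad half
    doubles the bound 2 M' of the good shifts.\<close>
  proof (intro exI[of _ "real L * (4 * M')"] conjI ballI allI impI)
    show "1 \<le> real L * (4 * M')" using L M' mult_mono[of 1 "real L" 1 "4 * M'"] by simp
    fix Q \<Lambda> S
    assume H: "Q \<in> dyadic" "finite \<Lambda>" "\<Lambda> \<subseteq> dyadic" "\<forall>J\<in>\<Lambda>. J \<subseteq> Q" "finite (S :: int set)"
    define u where "u = (\<lambda>k. \<Sum>I\<in>tops \<tau> \<Lambda> k. len I)"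
    have "(\<Sum>k\<in>S. u k) = (\<Sum>i\<in>{0..<int L}. \<Sum>k\<in>{k\<in>S. k mod int L = i}. u k)"
      using H L by (intro sum.group[symmetric]) auto
    also have "\<dots> \<le> (\<Sum>i\<in>{0..<int L}. 4 * M' * len Q)"
      unfolding u_def using H by (intro sum_mono residue) auto
    finally show "(\<Sum>k\<in>S. \<Sum>I\<in>tops \<tau> \<Lambda> k. len I) \<le> real L * (4 * M') * len Q" by (simp add: u_def)
  qed
qed

section \<open>Principal intervals\<close>

definition hsum :: "real \<Rightarrow> (real set \<Rightarrow> real set) \<Rightarrow> (real set \<Rightarrow> real) \<Rightarrow> (real set \<Rightarrow> 'a::real_normed_vector)
    \<Rightarrow> real set set \<Rightarrow> real \<Rightarrow> 'a" where
  "hsum p \<tau> \<theta> a F t = (\<Sum>I\<in>F. (\<theta> I * haar (\<tau> I) t / len (\<tau> I) powr (1 / p)) *\<^sub>R a I)"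

definition Lp_pow :: "nat \<Rightarrow> real \<Rightarrow> (real \<Rightarrow> 'a::real_normed_vector) \<Rightarrow> real" where
  "Lp_pow N p f = isum N UNIV (\<lambda>t. norm (f t) powr p)"

text \<open>
  The multipliers \<open>\<theta>\<close> build unconditionality into boundedness, so that a bound passes to all
  subfamilies of intervals.
\<close>

definition haar_bdd :: "'a::real_normed_vector itself \<Rightarrow> real \<Rightarrow> (real set \<Rightarrow> real set) \<Rightarrow> bool" where
  "haar_bdd _ p \<tau> \<longleftrightarrow> (\<exists>D\<ge>0. \<forall>N F (a :: real set \<Rightarrow> 'a) \<theta>. F \<subseteq> dyadic \<longrightarrow> (\<forall>I\<in>F. lev I < N \<and> lev (\<tau> I) < N) \<longrightarrow>
     (\<forall>I. \<bar>\<theta> I\<bar> \<le> 1) \<longrightarrow> Lp_pow N p (hsum p \<tau> \<theta> a F) \<le> D * Lp_pow N p (hsum p id (\<lambda>_. 1) a F))"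

lemma sum_Un_le:
  fixes f :: "'b \<Rightarrow> real"
  assumes "finite A" "finite B" "\<And>x. f x \<ge> 0"
  shows "(\<Sum>x\<in>A \<union> B. f x) \<le> (\<Sum>x\<in>A. f x) + (\<Sum>x\<in>B. f x)"
  using sum.union_inter[OF assms(1,2), of f] sum_nonneg[of "A \<inter> B" f, OF assms(3)] by linarith

lemma Lp_pow_nonneg [simp]: "0 \<le> Lp_pow N p f"
  by (simp add: Lp_pow_def isum_nonneg)

text \<open>Orthogonality isolates the coefficient. The sum over the grid is not averaged, hence the
  factor 2^N.\<close>

lemma haar_coeff:
  fixes b :: "real set \<Rightarrow> 'a::real_vector"
  assumes "F \<subseteq> dyadic" "\<And>J. J \<in> F \<Longrightarrow> lev J < N" "finite F" "I \<in> dyadic" "lev I < N"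
  shows "(\<Sum>t\<in>grid N. haar I t *\<^sub>R (\<Sum>J\<in>F. haar J t *\<^sub>R b J)) = (if I \<in> F then (2 ^ N * len I) *\<^sub>R b I else 0)"
proof -
  have o: "(\<Sum>t\<in>grid N. haar I t * haar J t) = (if I = J then 2 ^ N * len I else 0)" if J: "J \<in> F" for J
  proof -
    have "J \<in> dyadic" "lev J < N" using assms(1,2) J by auto
    then have "(\<Sum>t\<in>grid N. haar I t * haar J t) / 2 ^ N = (if I = J then len I else 0)"
      using haar_orth[of I J N] assms(4,5) unfolding isum_def by simp
    then show ?thesis by (cases "I = J") (auto simp: field_simps)
  qed
  have "(\<Sum>t\<in>grid N. haar I t *\<^sub>R (\<Sum>J\<in>F. haar J t *\<^sub>R b J)) = (\<Sum>J\<in>F. \<Sum>t\<in>grid N. (haar I t * haar J t) *\<^sub>R b J)"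
    by (simp add: scaleR_sum_right sum.swap[of _ F])
  also have "\<dots> = (\<Sum>J\<in>F. (if I = J then 2 ^ N * len I else 0) *\<^sub>R b J)"
    by (intro sum.cong refl) (simp add: o flip: scaleR_left.sum)
  also have "\<dots> = (\<Sum>J\<in>F. if I = J then (2 ^ N * len I) *\<^sub>R b J else 0)"
    by (intro sum.cong refl) auto
  finally show ?thesis using assms(3) by simp
qed

lemma dyadic_chain_Union:
  assumes "S \<subseteq> dyadic" "S \<noteq> {}" "\<And>K. K \<in> S \<Longrightarrow> t \<in> K"
  shows "\<Union>S \<in> S"
proof -
  obtain K where K: "K \<in> S" "\<And>K'. K' \<in> S \<Longrightarrow> lev K \<le> lev K'"
    using assms(2) ex_has_least_nat[of "\<lambda>K. K \<in> S" _ lev] by blast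
  have "K' \<subseteq> K" if "K' \<in> S" for K'
    using dyadic_nested[of K K' t] K assms that by blast
  then have "\<Union>S = K" using K by blast
  then show ?thesis using K by simp
qed

lemma ex_power2_bracket:
  fixes m :: real
  assumes "m > 0"
  shows "2 powi \<lfloor>log 2 m\<rfloor> \<le> m" "m < 2 powi (\<lfloor>log 2 m\<rfloor> + 1)"
proof -
  have e: "2 powi j = (2::real) powr (of_int j)" for j :: int by (simp add: powr_real_of_int')
  have m: "m = 2 powr (log 2 m)" using assms by simp
  show "2 powi \<lfloor>log 2 m\<rfloor> \<le> m" unfolding e by (subst (2) m) (simp only: powr_le_cancel_iff, simp)
  show "m < 2 powi (\<lfloor>log 2 m\<rfloor> + 1)" unfolding e by (subst (1) m) (simp only: powr_less_cancel_iff, simp)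
qed

text \<open>Let m J be the largest mean of g over the dyadic intervals containing J, and j J the
  integer part of its logarithm to base 2. As j can only grow downwards, \<pi> J may be taken as the
  largest interval above J with the same j, and everything between J and \<pi> J shares it. This
  describes the stopping intervals in closed form, without a recursion over generations.\<close>

lemma principal_intervals:
  fixes g :: "real \<Rightarrow> real"
  assumes g: "\<And>t. g t \<ge> 0" and pos: "isum N {0..<1} g > 0"
  defines "\<alpha> \<equiv> \<lambda>J. isum N J g / len J"
  obtains \<pi> where "\<And>J. J \<in> dyadic_upto N \<Longrightarrow> \<pi> J \<in> dyadic_upto N \<and> J \<subseteq> \<pi> J"
    and "\<And>J R. J \<in> dyadic_upto N \<Longrightarrow> R \<in> dyadic \<Longrightarrow> J \<subseteq> R \<Longrightarrow> R \<subseteq> \<pi> J \<Longrightarrow> \<pi> R = \<pi> J"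
    and "\<And>J. J \<in> dyadic_upto N \<Longrightarrow> \<alpha> J \<le> 2 * \<alpha> (\<pi> J)"
    and "carleson 3 (\<pi> ` dyadic_upto N)"
proof -
  define U where "U = {0..<1::real}"
  have U: "U \<in> dyadic" "lev U = 0" "\<And>J. J \<in> dyadic \<Longrightarrow> J \<subseteq> U" using unit_dyadic dyadic_subset_unit by (auto simp: U_def)
  \<comment> \<open>A positive mean over [0,1) makes every m J positive, so its logarithm is
    meaningful.\<close>
  have aU: "\<alpha> U > 0" using pos len_pos[OF U(1)] by (simp add: \<alpha>_def U_def)
  define anc where "anc = (\<lambda>J. {K \<in> dyadic. J \<subseteq> K})"
  have anc: "finite (anc J)" "J \<in> anc J" "U \<in> anc J" if "J \<in> dyadic" for J
    using finite_ancestors that U by (auto simp: anc_def)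
  define m where "m = (\<lambda>J. Max (\<alpha> ` anc J))"
  have m_ge: "\<alpha> K \<le> m J" if "J \<in> dyadic" "K \<in> anc J" for J K unfolding m_def using anc that by (intro Max_ge) auto
  have m_ex: "\<exists>K\<in>anc J. m J = \<alpha> K" if "J \<in> dyadic" for J
  proof -
    have "m J \<in> \<alpha> ` anc J" unfolding m_def using anc[OF that] by (intro Max_in) auto
    then show ?thesis by blast
  qed
  have m_mono: "m K \<le> m J" if H: "J \<in> dyadic" "K \<in> dyadic" "J \<subseteq> K" for J K
  proof -
    obtain K' where K': "K' \<in> anc K" "m K = \<alpha> K'" using m_ex H(2) by blast
    have "K' \<in> anc J" using K'(1) H(3) by (auto simp: anc_def)
    then show ?thesis using m_ge[OF H(1)] K'(2) by simp
  qed
  have m_pos: "m J > 0" if "J \<in> dyadic" for J using m_ge[OF that anc(3)[OF that]] aU by linarith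
  define j where "j = (\<lambda>J. \<lfloor>log 2 (m J)\<rfloor>)"
  have j1: "2 powi (j J) \<le> m J" and j2: "m J < 2 powi (j J + 1)" if "J \<in> dyadic" for J
    using ex_power2_bracket[OF m_pos[OF that]] by (auto simp: j_def)
  have j_mono: "j K \<le> j J" if "J \<in> dyadic" "K \<in> dyadic" "J \<subseteq> K" for J K
    unfolding j_def using m_mono[OF that] m_pos[OF that(2)] by (intro floor_mono) simp
  define S where "S = (\<lambda>J. {K \<in> anc J. j K = j J})"
  define \<pi> where "\<pi> = (\<lambda>J. \<Union>(S J))"
  have \<pi>S: "\<pi> J \<in> S J" if H: "J \<in> dyadic" for J
  proof -
    obtain t where t: "t \<in> J" using dyadic_nonempty H by blast
    show ?thesis unfolding \<pi>_def
    proof (rule dyadic_chain_Union)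
      show "S J \<noteq> {}" using anc(2)[OF H] by (auto simp: S_def)
    qed (use t in \<open>auto simp: S_def anc_def\<close>)
  qed
  have \<pi>: "\<pi> J \<in> dyadic" "J \<subseteq> \<pi> J" "j (\<pi> J) = j J" if "J \<in> dyadic" for J
    using \<pi>S[OF that] by (auto simp: S_def anc_def)
  have P2: "\<pi> R = \<pi> J" if H: "J \<in> dyadic" "R \<in> dyadic" "J \<subseteq> R" "R \<subseteq> \<pi> J" for J R
  proof -
    have jR: "j R = j J" using j_mono[of J R] j_mono[of R "\<pi> J"] \<pi>[OF H(1)] H by simp
    have "S R \<subseteq> S J" using jR H(3) by (auto simp: S_def anc_def)
    then have 1: "\<pi> R \<subseteq> \<pi> J" by (auto simp: \<pi>_def)
    have "\<pi> J \<in> S R" using \<pi>[OF H(1)] H jR by (auto simp: S_def anc_def)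
    then have "\<pi> J \<subseteq> \<pi> R" unfolding \<pi>_def[of ] by blast
    then show ?thesis using 1 by blast
  qed
  \<comment> \<open>The largest mean above \<pi> J is attained at \<pi> J itself: an interval K
    attaining it has the same j, hence is contained in \<pi> J, the largest such interval.\<close>
  have alpha_pi: "2 powi (j J) \<le> \<alpha> (\<pi> J)" if H: "J \<in> dyadic" for J
  proof -
    obtain K where K: "K \<in> anc (\<pi> J)" "m (\<pi> J) = \<alpha> K" using m_ex \<pi> H by blast
    have KD: "K \<in> dyadic" "\<pi> J \<subseteq> K" using K by (auto simp: anc_def)
    have "m K \<ge> \<alpha> K" using m_ge anc KD by blast
    then have "m K = m (\<pi> J)" using m_mono[OF \<pi>(1)[OF H] KD] K by simp
    then have "j K = j J" using \<pi>(3)[OF H] by (simp add: j_def)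
    then have "K \<in> S J" using KD \<pi>(2)[OF H] by (auto simp: S_def anc_def)
    then have "K \<subseteq> \<pi> J" by (auto simp: \<pi>_def)
    then have "K = \<pi> J" using KD by blast
    then show ?thesis using K(2) j1[OF \<pi>(1)[OF H]] \<pi>(3)[OF H] by simp
  qed
  have P3: "\<alpha> J \<le> 2 * \<alpha> (\<pi> J)" if H: "J \<in> dyadic" for J
  proof -
    have "\<alpha> J \<le> m J" using m_ge anc H by blast
    also have "\<dots> \<le> 2 powi (j J + 1)" using j2[OF H] by simp
    also have "\<dots> = 2 * 2 powi (j J)" by (simp add: power_int_add)
    also have "\<dots> \<le> 2 * \<alpha> (\<pi> J)" using alpha_pi[OF H] by simp
    finally show ?thesis .
  qed
  have upto: "J \<in> dyadic_upto N \<longleftrightarrow> J \<in> dyadic \<and> lev J \<le> N" for J by (simp add: dyadic_upto_def)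
  have P1: "\<pi> J \<in> dyadic_upto N \<and> J \<subseteq> \<pi> J" if "J \<in> dyadic_upto N" for J
    using \<pi>[of J] that subset_lev_mono[of "\<pi> J" J] by (auto simp: upto)
  have P4: "carleson 3 (\<pi> ` dyadic_upto N)"
  proof (rule carleson_check)
    define C where "C = \<pi> ` dyadic_upto N"
    have C: "finite C" "C \<subseteq> dyadic_upto N" using P1 by (auto simp: C_def)
    have fix_pi: "\<pi> Q = Q" if "Q \<in> C" for Q
    proof -
      obtain J where J: "J \<in> dyadic" "Q = \<pi> J" using \<open>Q \<in> C\<close> unfolding C_def upto[abs_def] by (auto simp: upto)
      show ?thesis using P2[of J Q] \<pi>[OF J(1)] J by simp
    qed
    fix R assume "R \<in> \<pi> ` dyadic_upto N"
    then have R: "R \<in> dyadic" "lev R \<le> N" using C by (auto simp: C_def upto)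
    define E where "E = {Q \<in> C. Q \<subseteq> R}"
    have E: "finite E" "E \<subseteq> dyadic_upto N" using C by (auto simp: E_def)
    have ED: "Q \<in> dyadic" "Q \<subseteq> R" "\<pi> Q = Q" if "Q \<in> E" for Q using that C fix_pi by (auto simp: E_def upto)
    have E0: "Q = R" if "Q \<in> E" "j Q \<le> j R" for Q
    proof -
      have "j Q = j R" using j_mono[of Q R] ED that R by force
      then have "R \<in> S Q" using ED that R by (auto simp: S_def anc_def)
      then have "R \<subseteq> \<pi> Q" by (auto simp: \<pi>_def)
      then show ?thesis using ED that by blast
    qed
    define T where "T = j ` {Q\<in>E. j R < j Q}"
    have T: "finite T" "\<And>k. k \<in> T \<Longrightarrow> j R < k" using E by (auto simp: T_def)
    \<comment> \<open>Principal intervals of equal value k inside R are disjoint and have means at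
      least 2^k, while the mean over R is at most 2^(j R + 1). Comparing integrals gives the decay
      in k.\<close>
    have layer: "(\<Sum>Q\<in>{Q\<in>E. j Q = k}. len Q) \<le> 2 powi (j R + 1 - k) * len R" for k
    proof -
      define D where "D = {Q\<in>E. j Q = k}"
      have D: "finite D" "D \<subseteq> dyadic_upto N" using E by (auto simp: D_def)
      have dis: "Q \<inter> Q' = {}" if Q: "Q \<in> D" "Q' \<in> D" "Q \<noteq> Q'" for Q Q'
      proof (rule ccontr)
        assume ne: "Q \<inter> Q' \<noteq> {}"
        have QD: "Q \<in> dyadic" "Q' \<in> dyadic" "\<pi> Q = Q" "\<pi> Q' = Q'" "j Q = j Q'" using Q ED by (auto simp: D_def)
        consider "Q' \<subseteq> Q" | "Q \<subseteq> Q'" using dyadic_nested_cases[OF QD(1,2)] ne by blast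
        then show False
        proof cases
          case 1
          then have "Q \<in> S Q'" using QD by (auto simp: S_def anc_def)
          then have "Q \<subseteq> \<pi> Q'" by (auto simp: \<pi>_def)
          then show False using QD 1 Q by simp
        next
          case 2
          then have "Q' \<in> S Q" using QD by (auto simp: S_def anc_def)
          then have "Q' \<subseteq> \<pi> Q" by (auto simp: \<pi>_def)
          then show False using QD 2 Q by simp
        qed
      qed
      have "2 powi k * (\<Sum>Q\<in>D. len Q) \<le> (\<Sum>Q\<in>D. isum N Q g)"
        unfolding sum_distrib_left
      proof (rule sum_mono)
        fix Q assume Q: "Q \<in> D"
        then have QD: "Q \<in> dyadic" "\<pi> Q = Q" "j Q = k" using ED by (auto simp: D_def)
        have "2 powi k \<le> isum N Q g / len Q" using alpha_pi[OF QD(1)] QD by (simp add: \<alpha>_def)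
        then show "2 powi k * len Q \<le> isum N Q g" using len_pos[OF QD(1)] by (simp add: field_simps)
      qed
      also have "\<dots> = isum N (\<Union>D) g" using D dis by (intro disjoint_sum_isum)
      also have "\<dots> \<le> isum N R g" using g ED by (intro isum_set_mono) (auto simp: D_def)
      also have "\<dots> = \<alpha> R * len R" using len_pos[OF R(1)] by (simp add: \<alpha>_def)
      also have "\<dots> \<le> 2 powi (j R + 1) * len R"
      proof (rule mult_right_mono)
        show "\<alpha> R \<le> 2 powi (j R + 1)" using m_ge[OF R(1) anc(2)[OF R(1)]] j2[OF R(1)] by linarith
      qed simp
      finally have "2 powi k * (\<Sum>Q\<in>D. len Q) \<le> 2 powi k * (2 powi (j R + 1 - k) * len R)"
        by (simp add: power_int_diff)
      then show ?thesis unfolding D_def by (rule mult_left_le_imp_le) simp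
    qed
    \<comment> \<open>R itself accounts for 1 and the layers above \<open>j R\<close> for 2, whence
      the constant 3.\<close>
    have "(\<Sum>Q\<in>E. len Q) \<le> (\<Sum>Q\<in>{R} \<union> (\<Union>k\<in>T. {Q\<in>E. j Q = k}). len Q)"
    proof (rule sum_mono2)
      show "E \<subseteq> {R} \<union> (\<Union>k\<in>T. {Q\<in>E. j Q = k})"
      proof
        fix Q assume "Q \<in> E"
        then show "Q \<in> {R} \<union> (\<Union>k\<in>T. {Q\<in>E. j Q = k})" using E0[of Q] by (cases "j Q \<le> j R") (auto simp: T_def)
      qed
    qed (use T E in auto)
    also have "\<dots> \<le> len R + (\<Sum>Q\<in>(\<Union>k\<in>T. {Q\<in>E. j Q = k}). len Q)"
      using sum_Un_le[of "{R}" "\<Union>k\<in>T. {Q\<in>E. j Q = k}" len] T(1) E(1) by simp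
    also have "(\<Sum>Q\<in>(\<Union>k\<in>T. {Q\<in>E. j Q = k}). len Q) \<le> (\<Sum>k\<in>T. \<Sum>Q\<in>{Q\<in>E. j Q = k}. len Q)"
      using T E by (intro sum_UN_le) auto
    also have "\<dots> \<le> (\<Sum>k\<in>T. 2 powi (j R + 1 - k) * len R)" by (intro sum_mono layer)
    also have "\<dots> = 2 * len R * (\<Sum>k\<in>T. 2 powi (j R - k))"
      by (simp add: sum_distrib_left power_int_diff power_int_add mult_ac)
    also have "\<dots> \<le> 2 * len R * (2 / 2 ^ 1)"
      using T by (intro mult_left_mono sum_powi_le) auto
    finally show "(\<Sum>Q\<in>{Q \<in> \<pi> ` dyadic_upto N. Q \<subseteq> R}. len Q) \<le> 3 * len R" by (simp add: E_def C_def)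
  qed (use P1 in \<open>auto simp: upto\<close>)
  show ?thesis
  proof (rule that[OF P1 _ _ P4])
    show "\<pi> R = \<pi> J" if "J \<in> dyadic_upto N" "R \<in> dyadic" "J \<subseteq> R" "R \<subseteq> \<pi> J" for J R
      using P2 that by (auto simp: upto)
    show "\<alpha> J \<le> 2 * \<alpha> (\<pi> J)" if "J \<in> dyadic_upto N" for J using P3 that by (auto simp: upto)
  qed
qed

text \<open>Haar functions of intervals inside L have mean zero over L, those of strictly larger
  intervals are constant there. Means over L are thus partial sums of the Haar series.\<close>

lemma mean_haar_sum:
  fixes b :: "real set \<Rightarrow> 'a::real_normed_vector"
  assumes F: "finite F" "F \<subseteq> dyadic" "\<And>J. J \<in> F \<Longrightarrow> lev J < N"
    and L: "L \<in> dyadic" "lev L \<le> N" "t \<in> L"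
  shows "(\<Sum>s\<in>grid N \<inter> L. \<Sum>J\<in>F. haar J s *\<^sub>R b J) = (2 ^ N * len L) *\<^sub>R (\<Sum>J\<in>{J\<in>F. L \<subset> J}. haar J t *\<^sub>R b J)"
proof -
  have one: "(\<Sum>s\<in>grid N \<inter> L. haar J s *\<^sub>R b J) = (if L \<subset> J then (2 ^ N * len L) *\<^sub>R (haar J t *\<^sub>R b J) else 0)"
    if J: "J \<in> F" for J
  proof -
    have JD: "J \<in> dyadic" "lev J < N" using F J by auto
    consider "L \<subset> J" | "J \<subseteq> L" | "L \<inter> J = {}" using dyadic_nested_cases[OF L(1) JD(1)] by blast
    then show ?thesis
    proof cases
      case 1
      have "haar J s = haar J t" if "s \<in> L" for s using haar_const_on[OF JD(1) L(1)] 1 L(3) that by blast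
      then have "(\<Sum>s\<in>grid N \<inter> L. haar J s *\<^sub>R b J) = (\<Sum>s\<in>grid N \<inter> L. haar J t *\<^sub>R b J)" by (intro sum.cong) auto
      also have "\<dots> = (2 ^ N * len L) *\<^sub>R (haar J t *\<^sub>R b J)"
        using isum_1[OF L(1,2)] by (simp add: isum_def sum_constant_scaleR field_simps)
      finally show ?thesis using 1 by simp
    next
      case 2
      then show ?thesis using sum_haar_vec[OF JD, of L "b J"] by (auto simp: psubset_eq)
    next
      case 3
      then have "haar J s = 0" if "s \<in> L" for s using that haar_outside by (metis disjoint_iff)
      then have "(\<Sum>s\<in>grid N \<inter> L. haar J s *\<^sub>R b J) = 0" by (intro sum.neutral) auto
      moreover have "\<not> L \<subset> J" using 3 L(3) by blast
      ultimately show ?thesis by simp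
    qed
  qed
  have "(\<Sum>s\<in>grid N \<inter> L. \<Sum>J\<in>F. haar J s *\<^sub>R b J) = (\<Sum>J\<in>F. \<Sum>s\<in>grid N \<inter> L. haar J s *\<^sub>R b J)" by (rule sum.swap)
  also have "\<dots> = (\<Sum>J\<in>F. if L \<subset> J then (2 ^ N * len L) *\<^sub>R (haar J t *\<^sub>R b J) else 0)" by (intro sum.cong one) auto
  also have "\<dots> = (\<Sum>J\<in>{J\<in>F. L \<subset> J}. (2 ^ N * len L) *\<^sub>R (haar J t *\<^sub>R b J))" by (rule sum.inter_filter[OF F(1), symmetric])
  finally show ?thesis by (simp add: scaleR_sum_right)
qed

text \<open>At t the block is a difference of two partial sums, that is, of the means of f over I
  and over a half L of the smallest block interval K containing t. Passing from L to K costs a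
  factor 2, passing to \<pi> another 2, which gives 4 + 2 = 6. The second property of \<pi> ensures
  that the block has no gaps between K and I.\<close>

lemma block_bound:
  fixes b :: "real set \<Rightarrow> 'a::real_normed_vector"
  assumes F: "finite F" "F \<subseteq> dyadic" "\<And>J. J \<in> F \<Longrightarrow> lev J < N"
  defines "f \<equiv> \<lambda>t. \<Sum>J\<in>F. haar J t *\<^sub>R b J"
  defines "\<alpha> \<equiv> \<lambda>J. isum N J (\<lambda>t. norm (f t)) / len J"
  assumes P1: "\<And>J. J \<in> dyadic_upto N \<Longrightarrow> J \<subseteq> \<pi> J"
    and P2: "\<And>J R. J \<in> dyadic_upto N \<Longrightarrow> R \<in> dyadic \<Longrightarrow> J \<subseteq> R \<Longrightarrow> R \<subseteq> \<pi> J \<Longrightarrow> \<pi> R = \<pi> J"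
    and P3: "\<And>J. J \<in> dyadic_upto N \<Longrightarrow> \<alpha> J \<le> 2 * \<alpha> (\<pi> J)"
    and I: "I \<in> F" "t \<in> I"
  shows "norm (\<Sum>J\<in>{J\<in>F. \<pi> J = \<pi> I \<and> J \<subseteq> I}. haar J t *\<^sub>R b J) \<le> 6 * \<alpha> (\<pi> I)"
proof -
  define Q where "Q = \<pi> I"
  have ID: "I \<in> dyadic" "lev I < N" "I \<in> dyadic_upto N" using I F by (auto simp: dyadic_upto_def less_imp_le)
  define Z where "Z = {J \<in> F. t \<in> J \<and> J \<subseteq> I \<and> \<pi> J = Q}"
  have Z: "finite Z" "I \<in> Z" using F I by (auto simp: Z_def Q_def)
  obtain K where K: "K \<in> Z" "\<And>J. J \<in> Z \<Longrightarrow> lev J \<le> lev K"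
  proof -
    have "Max (lev ` Z) \<in> lev ` Z" using Z by (intro Max_in) auto
    then obtain K where "K \<in> Z" "lev K = Max (lev ` Z)" by auto
    then show ?thesis using that[of K] Z Max_ge[of "lev ` Z"] by auto
  qed
  have KD: "K \<in> dyadic" "lev K < N" "t \<in> K" "K \<subseteq> I" "\<pi> K = Q" "K \<in> dyadic_upto N"
    using K(1) F by (auto simp: Z_def dyadic_upto_def less_imp_le)
  have "\<exists>L. L \<in> dyadic \<and> lev L = Suc (lev K) \<and> t \<in> L \<and> L \<subseteq> K \<and> len L = len K / 2"
    using children[OF KD(1)] len_children[OF KD(1)] KD(3) by blast
  then obtain L where L: "L \<in> dyadic" "lev L = Suc (lev K)" "t \<in> L" "L \<subseteq> K" "len L = len K / 2" by blast
  have A: "norm (\<Sum>J\<in>{J\<in>F. L' \<subset> J}. haar J t *\<^sub>R b J) \<le> \<alpha> L'" if L': "L' \<in> dyadic" "lev L' \<le> N" "t \<in> L'" for L'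
  proof -
    have "(2 ^ N * len L') * norm (\<Sum>J\<in>{J\<in>F. L' \<subset> J}. haar J t *\<^sub>R b J) = norm (\<Sum>s\<in>grid N \<inter> L'. f s)"
      using mean_haar_sum[OF F L', where b = b] by (simp add: f_def)
    also have "\<dots> \<le> (\<Sum>s\<in>grid N \<inter> L'. norm (f s))" by (rule norm_sum)
    also have "\<dots> = (2 ^ N * len L') * \<alpha> L'" using len_pos[OF L'(1)] by (simp add: \<alpha>_def isum_def)
    finally show ?thesis using len_pos[OF L'(1)] by simp
  qed
  have sub: "{J\<in>F. I \<subset> J} \<subseteq> {J\<in>F. L \<subset> J}" using L(4) KD(4) by blast
  have eq: "{J\<in>F. \<pi> J = Q \<and> J \<subseteq> I \<and> t \<in> J} = {J\<in>F. L \<subset> J} - {J\<in>F. I \<subset> J}"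
  proof (intro equalityI subsetI)
    fix J assume J: "J \<in> {J\<in>F. \<pi> J = Q \<and> J \<subseteq> I \<and> t \<in> J}"
    then have JZ: "J \<in> Z" "J \<in> dyadic" using F by (auto simp: Z_def)
    have "K \<subseteq> J" using dyadic_nested[OF JZ(2) KD(1) _ KD(3)] J K(2)[OF JZ(1)] by blast
    moreover have "L \<noteq> K" using L(2) by auto
    ultimately show "J \<in> {J\<in>F. L \<subset> J} - {J\<in>F. I \<subset> J}" using J L(4) by blast
  next
    fix J assume J: "J \<in> {J\<in>F. L \<subset> J} - {J\<in>F. I \<subset> J}"
    then have JD: "J \<in> F" "J \<in> dyadic" "L \<subset> J" "\<not> I \<subset> J" "t \<in> J" using F L(3) by auto
    have "J \<subseteq> I" using dyadic_nested_cases[OF ID(1) JD(2)] JD I by blast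
    have "lev J \<le> lev K" using psubset_lev[OF JD(2) L(1) JD(3)] L(2) by simp
    then have KJ: "K \<subseteq> J" using dyadic_nested[OF JD(2) KD(1) JD(5) KD(3)] by simp
    have "J \<subseteq> \<pi> K" using \<open>J \<subseteq> I\<close> P1[OF ID(3)] KD(5) Q_def by blast
    then have "\<pi> J = Q" using P2[OF KD(6) JD(2) KJ] KD(5) by simp
    then show "J \<in> {J\<in>F. \<pi> J = Q \<and> J \<subseteq> I \<and> t \<in> J}" using JD \<open>J \<subseteq> I\<close> by simp
  qed
  have "(\<Sum>J\<in>{J\<in>F. \<pi> J = Q \<and> J \<subseteq> I}. haar J t *\<^sub>R b J) = (\<Sum>J\<in>{J\<in>F. \<pi> J = Q \<and> J \<subseteq> I \<and> t \<in> J}. haar J t *\<^sub>R b J)"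
    using F(1) by (intro sum.mono_neutral_right) (auto simp: haar_outside)
  also have "\<dots> = (\<Sum>J\<in>{J\<in>F. L \<subset> J}. haar J t *\<^sub>R b J) - (\<Sum>J\<in>{J\<in>F. I \<subset> J}. haar J t *\<^sub>R b J)"
    unfolding eq using F(1) sub by (intro sum_diff) auto
  also have "norm \<dots> \<le> \<alpha> L + \<alpha> I"
    using A[of L] A[of I] L KD ID I by (intro order_trans[OF norm_triangle_ineq4] add_mono) auto
  also have "\<alpha> L \<le> 2 * \<alpha> K"
  proof -
    have "isum N L (\<lambda>t. norm (f t)) \<le> isum N K (\<lambda>t. norm (f t))" using L by (intro isum_set_mono) auto
    then show ?thesis using len_pos[OF KD(1)] by (simp add: \<alpha>_def L(5) field_simps)
  qed
  also have "\<alpha> K \<le> 2 * \<alpha> Q" using P3[OF KD(6)] KD(5) by simp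
  also have "\<alpha> I \<le> 2 * \<alpha> Q" using P3[OF ID(3)] by (simp add: Q_def)
  finally show ?thesis by (simp add: Q_def)
qed

text \<open>\<open>A Q k\<close> collects the intervals with principal interval Q and shift k;
  \<open>JJ Q k\<close> are those with maximal image, and their images carry the support of the
  corresponding part of the output. Disjointness of these images is pulled back at the price M, and
  B bounds the shifts below one principal interval.\<close>

lemma image_tops_carleson:
  assumes \<tau>: "\<And>J. J \<in> dyadic \<Longrightarrow> \<tau> J \<in> dyadic" "inj_on \<tau> dyadic"
    and F: "finite F" "F \<subseteq> dyadic_upto N"
    and M: "M \<ge> 1" "\<And>C. C \<subseteq> dyadic \<Longrightarrow> carleson 1 (\<tau> ` C) \<Longrightarrow> carleson M C"
    and B: "B \<ge> 1" "\<And>Q \<Lambda> S. Q \<in> dyadic \<Longrightarrow> finite \<Lambda> \<Longrightarrow> \<Lambda> \<subseteq> dyadic \<Longrightarrow> (\<forall>J\<in>\<Lambda>. J \<subseteq> Q) \<Longrightarrow> finite S \<Longrightarrow>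
     (\<Sum>k\<in>S. \<Sum>I\<in>tops \<tau> \<Lambda> k. len I) \<le> B * len Q"
    and P1: "\<And>J. J \<in> dyadic_upto N \<Longrightarrow> \<pi> J \<in> dyadic_upto N \<and> J \<subseteq> \<pi> J"
    and P2: "\<And>J R. J \<in> dyadic_upto N \<Longrightarrow> R \<in> dyadic \<Longrightarrow> J \<subseteq> R \<Longrightarrow> R \<subseteq> \<pi> J \<Longrightarrow> \<pi> R = \<pi> J"
    and P4: "carleson 3 (\<pi> ` dyadic_upto N)"
  defines "A \<equiv> \<lambda>Q k. {J\<in>F. \<pi> J = Q \<and> shift \<tau> J = k}"
  defines "JJ \<equiv> \<lambda>Q k. {J\<in>A Q k. \<tau> J \<in> maximal (\<tau> ` A Q k)}"
  shows "\<And>Q k. (\<Sum>J\<in>JJ Q k. len J) \<le> M * (\<Sum>I\<in>maximal (A Q k). len I)"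
    and "\<And>Q S. Q \<in> \<pi> ` F \<Longrightarrow> finite S \<Longrightarrow> (\<Sum>k\<in>S. \<Sum>I\<in>maximal (A Q k). len I) \<le> B * len Q"
    and "carleson (4 * M * B) (\<Union>Q\<in>\<pi> ` F. \<Union>k\<in>shift \<tau> ` F. JJ Q k)"
proof -
  have FD: "F \<subseteq> dyadic" using F dyadic_upto_memD by blast
  have JJA: "JJ Q k \<subseteq> A Q k" "A Q k \<subseteq> F" "finite (A Q k)" "finite (JJ Q k)" for Q k
    using F(1) by (auto simp: JJ_def A_def)
  have AD: "A Q k \<subseteq> dyadic" "\<tau> ` A Q k \<subseteq> dyadic" for Q k using JJA(2)[of Q k] FD \<tau>(1) by auto
  have carl: "carleson M (JJ Q k)" for Q k
  proof (rule M(2))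
    show "JJ Q k \<subseteq> dyadic" using JJA(1) AD(1) by blast
    have "\<tau> ` JJ Q k \<subseteq> maximal (\<tau> ` A Q k)" by (auto simp: JJ_def)
    moreover have "carleson 1 (maximal (\<tau> ` A Q k))"
    proof (rule carleson_disjoint)
      show "finite (maximal (\<tau> ` A Q k))" by (rule finite_subset[OF maximal_subset]) (simp add: JJA)
      show "maximal (\<tau> ` A Q k) \<subseteq> dyadic" using maximal_subset AD(2) by blast
      show "\<And>I J. I \<in> maximal (\<tau> ` A Q k) \<Longrightarrow> J \<in> maximal (\<tau> ` A Q k) \<Longrightarrow> I \<noteq> J \<Longrightarrow> I \<inter> J = {}"
        using maximal_disjoint[OF AD(2)] by blast
    qed
    ultimately show "carleson 1 (\<tau> ` JJ Q k)" by (rule carleson_subset[rotated])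
  qed
  show JM: "(\<Sum>J\<in>JJ Q k. len J) \<le> M * (\<Sum>I\<in>maximal (A Q k). len I)" for Q k
  proof (rule carleson_tops[OF carl])
    show "finite (maximal (A Q k))" by (rule finite_subset[OF maximal_subset]) (simp add: JJA)
    show "maximal (A Q k) \<subseteq> dyadic" using maximal_subset AD(1) by blast
    show "\<And>I. I \<in> JJ Q k \<Longrightarrow> \<exists>K\<in>maximal (A Q k). I \<subseteq> K" using maximal_above[OF AD(1)] JJA(1) by blast
  qed
  have QD: "Q \<in> dyadic" if "Q \<in> \<pi> ` F" for Q using that P1 F(2) dyadic_upto_memD by blast
  show BQ: "(\<Sum>k\<in>S. \<Sum>I\<in>maximal (A Q k). len I) \<le> B * len Q" if Q: "Q \<in> \<pi> ` F" "finite S" for Q S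
  proof -
    have "tops \<tau> {J\<in>F. \<pi> J = Q} k = maximal (A Q k)" for k
      unfolding tops_def A_def by (rule arg_cong[of _ _ maximal]) auto
    moreover have "(\<Sum>k\<in>S. \<Sum>I\<in>tops \<tau> {J\<in>F. \<pi> J = Q} k. len I) \<le> B * len Q"
    proof (rule B(2)[OF QD[OF Q(1)] _ _ _ Q(2)])
      show "finite {J\<in>F. \<pi> J = Q}" "{J\<in>F. \<pi> J = Q} \<subseteq> dyadic" using F FD by auto
      show "\<forall>J\<in>{J\<in>F. \<pi> J = Q}. J \<subseteq> Q" using P1 F(2) by blast
    qed
    ultimately show ?thesis by simp
  qed
  define S where "S = shift \<tau> ` F"
  have S: "finite S" using F by (simp add: S_def)
  define C where "C = (\<Union>Q\<in>\<pi> ` F. \<Union>k\<in>S. JJ Q k)"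
  have C: "finite C" "C \<subseteq> F" using S F JJA by (auto simp: C_def) blast
  have "carleson (4 * M * B) C"
    unfolding carleson_def
  proof (intro conjI ballI)
    show "finite C" "C \<subseteq> dyadic" using C FD by auto
    fix R assume R: "R \<in> dyadic"
    \<comment> \<open>If \<pi> J lies in R, the packing of the principal intervals in R yields 3 M
      B. Otherwise R lies between J and \<pi> J, so \<pi> J = \<pi> R is a single interval, and the
      packing of shifts below R yields M B.\<close>
    define C1 where "C1 = {J\<in>C. J \<subseteq> R \<and> \<pi> J \<subseteq> R}"
    define C2 where "C2 = {J\<in>C. J \<subseteq> R \<and> \<not> \<pi> J \<subseteq> R}"
    have fin: "finite C1" "finite C2" using C by (auto simp: C1_def C2_def)
    have "(\<Sum>J\<in>{J\<in>C. J \<subseteq> R}. len J) = (\<Sum>J\<in>C1 \<union> C2. len J)"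
      by (rule arg_cong[of _ _ "sum len"]) (auto simp: C1_def C2_def)
    also have "\<dots> = (\<Sum>J\<in>C1. len J) + (\<Sum>J\<in>C2. len J)"
      using fin by (intro sum.union_disjoint) (auto simp: C1_def C2_def)
    also have "(\<Sum>J\<in>C1. len J) \<le> 3 * M * B * len R"
    proof -
      define QQ where "QQ = {Q\<in>\<pi> ` F. Q \<subseteq> R}"
      have QQ: "finite QQ" using F by (auto simp: QQ_def)
      have "(\<Sum>J\<in>C1. len J) \<le> (\<Sum>J\<in>(\<Union>Q\<in>QQ. \<Union>k\<in>S. JJ Q k). len J)"
      proof (rule sum_mono2)
        show "C1 \<subseteq> (\<Union>Q\<in>QQ. \<Union>k\<in>S. JJ Q k)"
        proof
          fix J assume J: "J \<in> C1"
          then obtain Q k where Qk: "Q \<in> \<pi> ` F" "k \<in> S" "J \<in> JJ Q k" by (auto simp: C1_def C_def)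
          then have "\<pi> J = Q" by (auto simp: JJ_def A_def)
          then have "Q \<in> QQ" using J Qk by (auto simp: QQ_def C1_def)
          then show "J \<in> (\<Union>Q\<in>QQ. \<Union>k\<in>S. JJ Q k)" using Qk by blast
        qed
      qed (use QQ S JJA in auto)
      also have "\<dots> \<le> (\<Sum>Q\<in>QQ. \<Sum>J\<in>(\<Union>k\<in>S. JJ Q k). len J)" using QQ S JJA by (intro sum_UN_le) auto
      also have "\<dots> \<le> (\<Sum>Q\<in>QQ. \<Sum>k\<in>S. \<Sum>J\<in>JJ Q k. len J)" using S JJA by (intro sum_mono sum_UN_le) auto
      also have "\<dots> \<le> (\<Sum>Q\<in>QQ. \<Sum>k\<in>S. M * (\<Sum>I\<in>maximal (A Q k). len I))" by (intro sum_mono JM)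
      also have "\<dots> \<le> (\<Sum>Q\<in>QQ. M * (B * len Q))"
        using M(1) S BQ by (intro sum_mono) (auto simp: QQ_def simp flip: sum_distrib_left)
      also have "\<dots> = M * B * (\<Sum>Q\<in>QQ. len Q)" by (simp add: sum_distrib_left mult_ac)
      also have "\<dots> \<le> M * B * (3 * len R)"
      proof (rule mult_left_mono)
        have "(\<Sum>Q\<in>QQ. len Q) \<le> (\<Sum>Q\<in>{Q\<in>\<pi> ` dyadic_upto N. Q \<subseteq> R}. len Q)"
          using F(2) by (intro sum_mono2) (auto simp: QQ_def)
        then show "(\<Sum>Q\<in>QQ. len Q) \<le> 3 * len R" using carlesonD[OF P4 R] by linarith
        show "0 \<le> M * B" using M(1) B(1) by simp
      qed
      finally show ?thesis by (simp add: mult_ac)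
    qed
    also have "(\<Sum>J\<in>C2. len J) \<le> M * B * len R"
    proof -
      define \<Lambda> where "\<Lambda> = {J\<in>F. \<pi> J = \<pi> R \<and> J \<subseteq> R}"
      have \<Lambda>: "finite \<Lambda>" "\<Lambda> \<subseteq> dyadic" using F FD by (auto simp: \<Lambda>_def)
      have C2sub: "C2 \<subseteq> (\<Union>k\<in>S. {J\<in>JJ (\<pi> R) k. J \<in> \<Lambda>})"
      proof
        fix J assume J: "J \<in> C2"
        then obtain Q k where Qk: "Q \<in> \<pi> ` F" "k \<in> S" "J \<in> JJ Q k" by (auto simp: C2_def C_def)
        have JF: "J \<in> F" "J \<in> dyadic_upto N" "J \<in> dyadic" using J C(2) F(2) FD by (auto simp: C2_def)
        have Qe: "\<pi> J = Q" using Qk by (auto simp: JJ_def A_def)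
        have "J \<subseteq> R" "\<not> \<pi> J \<subseteq> R" using J by (auto simp: C2_def)
        moreover have "\<pi> J \<in> dyadic" "J \<subseteq> \<pi> J" using P1[OF JF(2)] dyadic_upto_memD by auto
        ultimately have "R \<subseteq> \<pi> J" using dyadic_nested_cases[of R "\<pi> J"] R dyadic_nonempty[OF JF(3)] by blast
        then have "\<pi> R = \<pi> J" using P2[OF JF(2) R \<open>J \<subseteq> R\<close>] by simp
        then show "J \<in> (\<Union>k\<in>S. {J\<in>JJ (\<pi> R) k. J \<in> \<Lambda>})" using Qk Qe JF \<open>J \<subseteq> R\<close> by (auto simp: \<Lambda>_def)
      qed
      have "(\<Sum>J\<in>C2. len J) \<le> (\<Sum>J\<in>(\<Union>k\<in>S. {J\<in>JJ (\<pi> R) k. J \<in> \<Lambda>}). len J)"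
        using C2sub S \<Lambda> by (intro sum_mono2) auto
      also have "\<dots> \<le> (\<Sum>k\<in>S. \<Sum>J\<in>{J\<in>JJ (\<pi> R) k. J \<in> \<Lambda>}. len J)" using S \<Lambda> by (intro sum_UN_le) auto
      also have "\<dots> \<le> (\<Sum>k\<in>S. M * (\<Sum>I\<in>tops \<tau> \<Lambda> k. len I))"
      proof (rule sum_mono, rule carleson_tops)
        fix k
        show "carleson M {J\<in>JJ (\<pi> R) k. J \<in> \<Lambda>}" by (rule carleson_subset[OF carl[of "\<pi> R" k]]) auto
        have sub: "{J \<in> \<Lambda>. shift \<tau> J = k} \<subseteq> dyadic" using \<Lambda> by auto
        show "finite (tops \<tau> \<Lambda> k)" unfolding tops_def by (rule finite_subset[OF maximal_subset]) (simp add: \<Lambda>)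
        show "tops \<tau> \<Lambda> k \<subseteq> dyadic" unfolding tops_def using maximal_subset sub by blast
        show "\<exists>K\<in>tops \<tau> \<Lambda> k. I \<subseteq> K" if "I \<in> {J\<in>JJ (\<pi> R) k. J \<in> \<Lambda>}" for I
          unfolding tops_def using that by (intro maximal_above[OF sub]) (auto simp: JJ_def A_def)
      qed
      also have "\<dots> \<le> M * (B * len R)"
        unfolding sum_distrib_left[symmetric] using M(1) \<Lambda> S R by (intro mult_left_mono B(2)) (auto simp: \<Lambda>_def)
      finally show ?thesis by simp
    qed
    finally show "(\<Sum>J\<in>{J\<in>C. J \<subseteq> R}. len J) \<le> 4 * M * B * len R" by (simp add: algebra_simps)
  qed
  then show "carleson (4 * M * B) (\<Union>Q\<in>\<pi> ` F. \<Union>k\<in>shift \<tau> ` F. JJ Q k)" by (simp add: C_def S_def)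
qed

section \<open>Extrapolation to smaller exponents\<close>

lemma holder_isum:
  assumes "p > 1" "q > 1" "1/p + 1/q = 1" "\<And>t. f t \<ge> 0" "\<And>t. g t \<ge> 0"
  shows "isum N W (\<lambda>t. f t * g t) \<le> isum N W (\<lambda>t. f t powr p) powr (1/p) * isum N W (\<lambda>t. g t powr q) powr (1/q)"
proof -
  have "(\<Sum>t\<in>grid N \<inter> W. f t * g t)
      \<le> (\<Sum>t\<in>grid N \<inter> W. f t powr p) powr (1/p) * (\<Sum>t\<in>grid N \<inter> W. g t powr q) powr (1/q)"
    using assms by (intro holder_sum) auto
  then have "isum N W (\<lambda>t. f t * g t)
      \<le> (\<Sum>t\<in>grid N \<inter> W. f t powr p) powr (1/p) * (\<Sum>t\<in>grid N \<inter> W. g t powr q) powr (1/q) / 2 ^ N"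
    unfolding isum_def by (rule divide_right_mono) simp
  also have "(2::real) ^ N = (2 ^ N) powr (1/p) * (2 ^ N) powr (1/q)"
    using assms(3) by (simp flip: powr_add)
  finally show ?thesis
    unfolding isum_def by (simp add: powr_divide sum_nonneg)
qed

text \<open>Division by Y^(1/q'): the absorption that follows whenever a function is tested against
  its own power.\<close>

lemma self_improve:
  fixes X Y c :: real
  assumes "Y \<le> c * X powr (1/q) * Y powr (1/q')" "X \<ge> 0" "Y \<ge> 0" "c \<ge> 0" "q > 1" "1/q + 1/q' = 1"
  shows "Y \<le> c powr q * X"
proof (cases "Y = 0")
  case False
  then have Y: "Y > 0" using assms by simp
  have "Y powr (1/q) * Y powr (1/q') = Y" using Y assms(6) by (simp flip: powr_add)
  then have "Y powr (1/q) * Y powr (1/q') \<le> (c * X powr (1/q)) * Y powr (1/q')" using assms(1) by simp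
  then have "Y powr (1/q) \<le> c * X powr (1/q)" using Y by (simp add: mult_le_cancel_right)
  then have "(Y powr (1/q)) powr q \<le> (c * X powr (1/q)) powr q" using assms(5) by (intro powr_mono2) auto
  then show ?thesis using assms Y by (simp add: powr_mult powr_powr)
qed (use assms in simp)

lemma carleson_of_image:
  assumes bij: "bij_betw \<tau> dyadic dyadic" and ps: "preserves_carleson (inv_into dyadic \<tau>)"
  obtains M where "M \<ge> 1" "\<And>C. C \<subseteq> dyadic \<Longrightarrow> carleson 1 (\<tau> ` C) \<Longrightarrow> carleson M C"
proof -
  obtain M where M: "M \<ge> 1" "\<And>C. carleson 1 C \<Longrightarrow> carleson M (inv_into dyadic \<tau> ` C)"
    using ps unfolding preserves_carleson_def by blast
  show ?thesis
  proof (rule that[OF M(1)])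
    fix C assume C: "C \<subseteq> dyadic" "carleson 1 (\<tau> ` C)"
    have "inv_into dyadic \<tau> ` \<tau> ` C = C" using bij C(1) unfolding bij_betw_def by (metis inv_into_image_cancel)
    then show "carleson M C" using M(2)[OF C(2)] by simp
  qed
qed

text \<open>On the classes of constant shift the operators for \<open>p\<close> and for \<open>q\<close> agree up to a factor. The class
  pieces of the principal blocks are therefore estimated in \<open>L\<^sup>p\<close> and summed by testing against
  \<open>\<phi>\<^bsup>q - 1\<^esup>\<close>, with Carleson embeddings on the source and on the image side.\<close>

theorem haar_bdd_extrapolate_down:
  assumes bij: "bij_betw \<tau> dyadic dyadic" and pt: "preserves_carleson \<tau>"
    and ps: "preserves_carleson (inv_into dyadic \<tau>)"
    and q: "1 < q" and qp: "q < p" and bp: "haar_bdd TYPE('a::real_normed_vector) p \<tau>"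
  shows "haar_bdd TYPE('a) q \<tau>"
proof -
  obtain D where D: "D \<ge> 0" "\<And>N F (a :: real set \<Rightarrow> 'a) \<theta>. F \<subseteq> dyadic \<Longrightarrow> (\<forall>I\<in>F. lev I < N \<and> lev (\<tau> I) < N) \<Longrightarrow>
     (\<forall>I. \<bar>\<theta> I\<bar> \<le> 1) \<Longrightarrow> Lp_pow N p (hsum p \<tau> \<theta> a F) \<le> D * Lp_pow N p (hsum p id (\<lambda>_. 1) a F)"
    using bp unfolding haar_bdd_def by blast
  obtain M where M: "M \<ge> 1" "\<And>C. C \<subseteq> dyadic \<Longrightarrow> carleson 1 (\<tau> ` C) \<Longrightarrow> carleson M C"
    using carleson_of_image[OF bij ps] by blast
  obtain B where B1: "B \<ge> 1" and B2: "\<forall>Q\<in>dyadic. \<forall>\<Lambda> S. finite \<Lambda> \<longrightarrow> \<Lambda> \<subseteq> dyadic \<longrightarrow> (\<forall>J\<in>\<Lambda>. J \<subseteq> Q) \<longrightarrow> finite S \<longrightarrow>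
     (\<Sum>k\<in>S. \<Sum>I\<in>tops \<tau> \<Lambda> k. len I) \<le> B * len Q"
    using shift_classes_packing[OF bij pt ps] by (elim exE conjE) (rule that)
  have B: "B \<ge> 1" "\<And>Q \<Lambda> S. Q \<in> dyadic \<Longrightarrow> finite \<Lambda> \<Longrightarrow> \<Lambda> \<subseteq> dyadic \<Longrightarrow> (\<forall>J\<in>\<Lambda>. J \<subseteq> Q) \<Longrightarrow> finite S \<Longrightarrow>
     (\<Sum>k\<in>S. \<Sum>I\<in>tops \<tau> \<Lambda> k. len I) \<le> B * len Q"
    using B1 B2 by simp_all
  obtain M2 where M2: "M2 \<ge> 1" "\<And>C. carleson (4 * M * B) C \<Longrightarrow> carleson M2 (\<tau> ` C)"
    using pt unfolding preserves_carleson_def by blast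
  have \<tau>D: "\<tau> J \<in> dyadic" if "J \<in> dyadic" for J using bij that by (metis bij_betw_apply)
  have \<tau>inj: "inj_on \<tau> dyadic" using bij by (rule bij_betw_imp_inj_on)
  define p' q' where "p' = p / (p - 1)" and "q' = q / (q - 1)"
  have p: "p > 1" using q qp by simp
  have p': "p' > 1" "1/p + 1/p' = 1" using p by (auto simp: p'_def field_simps)
  have q': "q' > 1" "1/q + 1/q' = 1" using q by (auto simp: q'_def field_simps)
  \<comment> \<open>The gap \<delta> is the same for the exponents and for their conjugates. It is
    positive as q < p, which makes r = q'/p' exceed 1, as needed for Jensen and for the embedding on
    the image side.\<close>
  define \<delta> where "\<delta> = 1/q - 1/p"
  have \<delta>: "\<delta> > 0" "1/p' - 1/q' = \<delta>" using q qp p' q' by (auto simp: \<delta>_def frac_less2)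
  define r where "r = q' / p'"
  have "1/q' < 1/p'" using \<delta> by linarith
  then have "p' < q'" using p' q' by (simp add: field_simps)
  then have r: "r > 1" using p' by (simp add: r_def)
  have r1: "(r - 1) / q' = \<delta>" using p' q' \<delta>(2) by (simp add: r_def diff_divide_distrib)
  define Kq Kr where "Kq = 2 powr q / (q - 1)" and "Kr = 2 powr r / (r - 1)"
  have K0: "Kq > 0" "Kr > 0" using q r by (auto simp: Kq_def Kr_def)
  define C1 where "C1 = D powr (1/p) * 6 * M powr \<delta>"
  have C1: "C1 \<ge> 0" by (simp add: C1_def)
  define C2 where "C2 = C1 * (3 * B * Kq) powr (1/q) * (M2 * Kr) powr (1/q')"
  have C2: "C2 \<ge> 0" using C1 by (simp add: C2_def)
  have "Lp_pow N q (hsum q \<tau> \<theta> a F) \<le> C2 powr q * Lp_pow N q (hsum q id (\<lambda>_. 1) a F)"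
    if F: "F \<subseteq> dyadic" "\<forall>I\<in>F. lev I < N \<and> lev (\<tau> I) < N" and \<theta>: "\<forall>I. \<bar>\<theta> I\<bar> \<le> 1"
    for N F \<theta> and a :: "real set \<Rightarrow> 'a"
  proof -
    define b where "b = (\<lambda>I. (1 / len I powr (1/q)) *\<^sub>R a I)"
    define f where "f = (\<lambda>t. \<Sum>J\<in>F. haar J t *\<^sub>R b J)"
    define g where "g = (\<lambda>t. norm (f t))"
    have f_eq: "hsum q id (\<lambda>_. 1) a F = f" by (rule ext) (simp add: hsum_def f_def b_def)
    have Fup: "F \<subseteq> dyadic_upto N" using F by (force simp: dyadic_upto_def)
    then have Ff: "finite F" using finite_dyadic_upto finite_subset by blast
    have Flev: "lev J < N" if "J \<in> F" for J using F(2) that by blast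
    show ?thesis
    proof (cases "isum N {0..<1} g = 0")
      \<comment> \<open>Principal intervals require a positive mean. Here f vanishes on the grid,
        and orthogonality annihilates all coefficients.\<close>
      case True
      have "\<forall>t\<in>grid N \<inter> {0..<1}. g t = 0"
        using True by (simp add: isum_def sum_nonneg_eq_0_iff g_def)
      then have f0: "f t = 0" if "t \<in> grid N" for t using that grid_unit by (auto simp: g_def)
      have "a I = 0" if I: "I \<in> F" for I
      proof -
        have ID: "I \<in> dyadic" using F I by blast
        have "(2 ^ N * len I) *\<^sub>R b I = (\<Sum>t\<in>grid N. haar I t *\<^sub>R f t)"
          unfolding f_def using haar_coeff[OF F(1) Flev Ff ID Flev[OF I], of b] I by simp
        also have "\<dots> = 0" using f0 by simp
        finally have "b I = 0" using len_pos[OF ID] by auto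
        then show ?thesis using len_pos[OF ID] by (simp add: b_def)
      qed
      then have "hsum q \<tau> \<theta> a F = (\<lambda>_. 0)" by (intro ext) (simp add: hsum_def)
      then have "Lp_pow N q (hsum q \<tau> \<theta> a F) = 0" by (simp add: Lp_pow_def isum_def)
      then show ?thesis by simp
    next
      case False
      then have pos: "isum N {0..<1} g > 0" using isum_nonneg[of g N "{0..<1}"] by (simp add: g_def less_le)
      define \<alpha> where "\<alpha> = (\<lambda>J. isum N J g / len J)"
      obtain \<pi> where P1: "\<And>J. J \<in> dyadic_upto N \<Longrightarrow> \<pi> J \<in> dyadic_upto N \<and> J \<subseteq> \<pi> J"
        and P2: "\<And>J R. J \<in> dyadic_upto N \<Longrightarrow> R \<in> dyadic \<Longrightarrow> J \<subseteq> R \<Longrightarrow> R \<subseteq> \<pi> J \<Longrightarrow> \<pi> R = \<pi> J"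
        and P3: "\<And>J. J \<in> dyadic_upto N \<Longrightarrow> \<alpha> J \<le> 2 * \<alpha> (\<pi> J)"
        and P4: "carleson 3 (\<pi> ` dyadic_upto N)"
        using principal_intervals[of g N] pos unfolding \<alpha>_def by (auto simp: g_def)
      have P1': "\<And>J. J \<in> dyadic_upto N \<Longrightarrow> J \<subseteq> \<pi> J" using P1 by blast
      have \<alpha>0: "\<alpha> J \<ge> 0" for J by (simp add: \<alpha>_def g_def isum_nonneg)
      define A where "A = (\<lambda>Q k. {J\<in>F. \<pi> J = Q \<and> shift \<tau> J = k})"
      define JJ where "JJ = (\<lambda>Q k. {J\<in>A Q k. \<tau> J \<in> maximal (\<tau> ` A Q k)})"
      define u where "u = (\<lambda>Q k. \<Sum>I\<in>maximal (A Q k). len I)"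
      define S where "S = shift \<tau> ` F"
      have Sf: "finite S" using Ff by (simp add: S_def)
      have JJu: "(\<Sum>J\<in>JJ Q k. len J) \<le> M * u Q k" for Q k
        unfolding u_def JJ_def A_def
        by (rule image_tops_carleson(1)[where N = N and B = B and \<pi> = \<pi> and \<tau> = \<tau> and F = F]; fact)
      have uQ: "(\<Sum>k\<in>S. u Q k) \<le> B * len Q" if "Q \<in> \<pi> ` F" for Q
        unfolding u_def A_def
        by (rule image_tops_carleson(2)[where N = N and M = M and \<pi> = \<pi> and \<tau> = \<tau> and F = F]; fact)
      have JJc: "carleson (4 * M * B) (\<Union>Q\<in>\<pi> ` F. \<Union>k\<in>S. JJ Q k)"
        unfolding JJ_def A_def S_def
        by (rule image_tops_carleson(3)[where N = N and \<pi> = \<pi> and \<tau> = \<tau> and F = F]; fact)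
      have AF: "A Q k \<subseteq> F" "finite (A Q k)" "A Q k \<subseteq> dyadic" "JJ Q k \<subseteq> A Q k" "finite (JJ Q k)" for Q k
        using Ff F(1) by (auto simp: A_def JJ_def)
      have \<tau>A: "\<tau> ` A Q k \<subseteq> dyadic" for Q k using AF(3)[of Q k] \<tau>D by blast
      have u0: "u Q k \<ge> 0" for Q k unfolding u_def by (intro sum_nonneg) simp
      define KK where "KK = (\<lambda>Q k. maximal (\<tau> ` A Q k))"
      have KJ: "KK Q k = \<tau> ` JJ Q k" for Q k
        using maximal_subset[of "\<tau> ` A Q k"] by (auto simp: KK_def JJ_def)
      have KKf: "finite (KK Q k)" "KK Q k \<subseteq> dyadic" "KK Q k \<subseteq> dyadic_upto N" for Q k
      proof -
        show "finite (KK Q k)" unfolding KJ using AF(5) by simp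
        show 1: "KK Q k \<subseteq> dyadic" unfolding KK_def using maximal_subset \<tau>A by blast
        show "KK Q k \<subseteq> dyadic_upto N"
        proof
          fix K assume K: "K \<in> KK Q k"
          then obtain J where "J \<in> F" "K = \<tau> J" unfolding KJ using AF(1,4) by blast
          then have "lev K \<le> N" using F(2) by (simp add: less_imp_le)
          then show "K \<in> dyadic_upto N" using 1 K by (auto simp: dyadic_upto_def)
        qed
      qed
      have KKdis: "I \<inter> J = {}" if "I \<in> KK Q k" "J \<in> KK Q k" "I \<noteq> J" for I J Q k
        using maximal_disjoint[OF \<tau>A] that unfolding KK_def by blast
      define G where "G = (\<lambda>Q k t. \<Sum>J\<in>A Q k. (\<theta> J * haar (\<tau> J) t / len (\<tau> J) powr (1/q)) *\<^sub>R a J)"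
      have G_p: "Lp_pow N p (G Q k) \<le> ((2 powi k) powr (-\<delta>)) powr p * (D * ((6 * \<alpha> Q) powr p * u Q k))" for Q k
      proof -
        \<comment> \<open>The class \<open>A Q k\<close> alone may have gaps, so its sums need not
          be differences of means. F' fills it up with all block intervals below its tops, where
          \<open>block_bound\<close> applies, and the multipliers \<theta>' cut back to the class.
          Here unconditionality enters.\<close>
        define F' where "F' = {J\<in>F. \<pi> J = Q \<and> (\<exists>I\<in>maximal (A Q k). J \<subseteq> I)}"
        have F': "F' \<subseteq> F" "finite F'" using Ff by (auto simp: F'_def)
        have AF': "A Q k \<subseteq> F'"
        proof
          fix J assume J: "J \<in> A Q k"
          then show "J \<in> F'" using maximal_above[OF AF(3) J] by (auto simp: F'_def A_def)
        qed
        \<comment> \<open>The coefficients are rescaled from the normalisation for q to the one for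
          p, which keeps the coefficients b of the input.\<close>
        define c where "c = (\<lambda>J. (len J powr (1/p - 1/q)) *\<^sub>R a J)"
        define \<theta>' where "\<theta>' = (\<lambda>J. if J \<in> A Q k then \<theta> J else 0)"
        have G_eq: "G Q k t = ((2 powi k) powr (-\<delta>)) *\<^sub>R hsum p \<tau> \<theta>' c F' t" for t
        proof -
          have "hsum p \<tau> \<theta>' c F' t = (\<Sum>J\<in>A Q k. (\<theta> J * haar (\<tau> J) t / len (\<tau> J) powr (1/p)) *\<^sub>R c J)"
            unfolding hsum_def using F'(2) AF' by (intro sum.mono_neutral_cong_right) (auto simp: \<theta>'_def)
          also have "((2 powi k) powr (-\<delta>)) *\<^sub>R \<dots> = G Q k t"
            unfolding G_def scaleR_sum_right
          proof (rule sum.cong)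
            fix J assume J: "J \<in> A Q k"
            then have JD: "J \<in> dyadic" "shift \<tau> J = k" using AF(3) by (auto simp: A_def)
            have l: "len (\<tau> J) = 2 powi k * len J" "len J > 0" using len_shift[of J \<tau>] \<tau>D[of J] JD len_pos by auto
            \<comment> \<open>As the shift is constant on the class, the ratio of the normalisations
              is the single factor 2^(-k \<delta>).\<close>
            have E: "(2 powi k) powr (-\<delta>) * (len J powr (1/p - 1/q) / len (\<tau> J) powr (1/p)) = 1 / len (\<tau> J) powr (1/q)"
            proof -
              have "len J powr (1/p - 1/q) * (2 powi k) powr (-\<delta>) = len (\<tau> J) powr (1/p - 1/q)"
                unfolding l(1) using l(2) by (simp add: powr_mult \<delta>_def mult.commute)
              also have "\<dots> = len (\<tau> J) powr (1/p) / len (\<tau> J) powr (1/q)" by (rule powr_diff)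
              finally show ?thesis using l by (simp add: field_simps)
            qed
            have "(2 powi k) powr (-\<delta>) * (\<theta> J * haar (\<tau> J) t / len (\<tau> J) powr (1/p) * len J powr (1/p - 1/q))
                = \<theta> J * haar (\<tau> J) t * ((2 powi k) powr (-\<delta>) * (len J powr (1/p - 1/q) / len (\<tau> J) powr (1/p)))"
              by simp
            also have "\<dots> = \<theta> J * haar (\<tau> J) t * (1 / len (\<tau> J) powr (1/q))" unfolding E ..
            finally show "(2 powi k) powr (-\<delta>) *\<^sub>R (\<theta> J * haar (\<tau> J) t / len (\<tau> J) powr (1/p)) *\<^sub>R c J
                = (\<theta> J * haar (\<tau> J) t / len (\<tau> J) powr (1/q)) *\<^sub>R a J"
              by (simp add: c_def)
          qed simp
          finally show ?thesis by simp
        qed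
        define \<phi> where "\<phi> = hsum p id (\<lambda>_. 1) c F'"
        have \<phi>_eq: "\<phi> t = (\<Sum>J\<in>F'. haar J t *\<^sub>R b J)" for t
          unfolding \<phi>_def hsum_def
        proof (rule sum.cong)
          fix J assume "J \<in> F'"
          then have "len J > 0" using F' F len_pos by blast
          then show "(1 * haar (id J) t / len (id J) powr (1/p)) *\<^sub>R c J = haar J t *\<^sub>R b J"
            by (simp add: c_def b_def powr_diff)
        qed simp
        have tops_fin: "finite (maximal (A Q k))" "maximal (A Q k) \<subseteq> A Q k" using maximal_subset AF(2) finite_subset by blast+
        have tops_up: "maximal (A Q k) \<subseteq> dyadic_upto N" using tops_fin AF(1) Fup by blast
        have tops_dis: "\<And>I J. I \<in> maximal (A Q k) \<Longrightarrow> J \<in> maximal (A Q k) \<Longrightarrow> I \<noteq> J \<Longrightarrow> I \<inter> J = {}"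
          using maximal_disjoint[OF AF(3)] by blast
        have \<phi>0: "\<phi> t = 0" if "t \<notin> \<Union>(maximal (A Q k))" for t
          unfolding \<phi>_eq
        proof (intro sum.neutral ballI)
          fix J assume "J \<in> F'"
          then have "t \<notin> J" using that unfolding F'_def by blast
          then show "haar J t *\<^sub>R b J = 0" by (simp add: haar_outside)
        qed
        have \<phi>b: "norm (\<phi> t) \<le> 6 * \<alpha> Q" if I: "I \<in> maximal (A Q k)" "t \<in> I" for I t
        proof -
          have IF: "I \<in> F" "\<pi> I = Q" using I tops_fin(2) by (auto simp: A_def)
          have sub: "{J\<in>F. \<pi> J = Q \<and> J \<subseteq> I} \<subseteq> F'" using I by (auto simp: F'_def)
          have "\<phi> t = (\<Sum>J\<in>{J\<in>F. \<pi> J = Q \<and> J \<subseteq> I}. haar J t *\<^sub>R b J)"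
            unfolding \<phi>_eq
          proof (rule sum.mono_neutral_right[OF F'(2) sub], intro ballI)
            fix J assume J: "J \<in> F' - {J\<in>F. \<pi> J = Q \<and> J \<subseteq> I}"
            then obtain I' where I': "I' \<in> maximal (A Q k)" "J \<subseteq> I'" "\<not> J \<subseteq> I" by (auto simp: F'_def)
            then have "I \<inter> I' = {}" using tops_dis[OF I(1) I'(1)] by blast
            then have "t \<notin> J" using I I' by blast
            then show "haar J t *\<^sub>R b J = 0" by (simp add: haar_outside)
          qed
          moreover have "norm (\<Sum>J\<in>{J\<in>F. \<pi> J = \<pi> I \<and> J \<subseteq> I}. haar J t *\<^sub>R b J) \<le> 6 * \<alpha> (\<pi> I)"
            using block_bound[OF Ff F(1) Flev, of \<pi> b I t] P1' P2 P3 IF(1) I(2) unfolding \<alpha>_def g_def f_def by blast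
          ultimately show ?thesis using IF(2) by simp
        qed
        have "Lp_pow N p \<phi> = isum N (\<Union>(maximal (A Q k))) (\<lambda>t. norm (\<phi> t) powr p)"
          unfolding Lp_pow_def by (rule isum_restrict) (auto simp: \<phi>0)
        also have "\<dots> = (\<Sum>I\<in>maximal (A Q k). isum N I (\<lambda>t. norm (\<phi> t) powr p))"
          using tops_fin tops_up tops_dis by (intro disjoint_sum_isum[symmetric])
        also have "\<dots> \<le> (\<Sum>I\<in>maximal (A Q k). (6 * \<alpha> Q) powr p * len I)"
        proof (rule sum_mono)
          fix I assume I: "I \<in> maximal (A Q k)"
          have "isum N I (\<lambda>t. norm (\<phi> t) powr p) \<le> isum N I (\<lambda>t. (6 * \<alpha> Q) powr p)"
            using \<phi>b[OF I] p by (intro isum_mono powr_mono2) auto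
          also have "\<dots> = (6 * \<alpha> Q) powr p * len I"
            using I tops_up by (intro isum_const) (auto simp: dyadic_upto_def)
          finally show "isum N I (\<lambda>t. norm (\<phi> t) powr p) \<le> (6 * \<alpha> Q) powr p * len I" .
        qed
        also have "\<dots> = (6 * \<alpha> Q) powr p * u Q k" by (simp add: u_def sum_distrib_left)
        finally have \<phi>p: "Lp_pow N p \<phi> \<le> (6 * \<alpha> Q) powr p * u Q k" .
        have "Lp_pow N p (hsum p \<tau> \<theta>' c F') \<le> D * Lp_pow N p \<phi>"
          unfolding \<phi>_def using F' F \<theta> by (intro D(2)) (auto simp: \<theta>'_def)
        also have "\<dots> \<le> D * ((6 * \<alpha> Q) powr p * u Q k)" using \<phi>p D(1) by (rule mult_left_mono)
        finally have h: "Lp_pow N p (hsum p \<tau> \<theta>' c F') \<le> D * ((6 * \<alpha> Q) powr p * u Q k)" .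
        have "Lp_pow N p (G Q k) = ((2 powi k) powr (-\<delta>)) powr p * Lp_pow N p (hsum p \<tau> \<theta>' c F')"
          unfolding Lp_pow_def isum_cmult[symmetric] G_eq by (simp add: powr_mult)
        then show ?thesis using mult_left_mono[OF h, of "((2 powi k) powr (-\<delta>)) powr p"] by simp
      qed
      have G0: "G Q k t = 0" if "t \<notin> \<Union>(KK Q k)" for Q k t
        unfolding G_def
      proof (intro sum.neutral ballI)
        fix J assume "J \<in> A Q k"
        then obtain K where "K \<in> KK Q k" "\<tau> J \<subseteq> K" using maximal_above[OF \<tau>A] unfolding KK_def by blast
        then have "t \<notin> \<tau> J" using that by blast
        then show "(\<theta> J * haar (\<tau> J) t / len (\<tau> J) powr (1/q)) *\<^sub>R a J = 0" by (simp add: haar_outside)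
      qed
      define P where "P = \<pi> ` F \<times> S"
      have Pf: "finite P" using Ff Sf by (simp add: P_def)
      \<comment> \<open>The sum of the norms of all pieces majorises the output, and testing it
        against its own power splits the estimate over the classes.\<close>
      define \<phi> where "\<phi> = (\<lambda>t. \<Sum>x\<in>P. norm (G (fst x) (snd x) t))"
      have \<phi>0: "\<phi> t \<ge> 0" for t by (simp add: \<phi>_def sum_nonneg)
      define g' where "g' = (\<lambda>t. \<phi> t powr (q - 1))"
      have g'0: "g' t \<ge> 0" for t by (simp add: g'_def)
      define \<beta> where "\<beta> = (\<lambda>K. isum N K (\<lambda>t. g' t powr p') / len K)"
      have \<beta>0: "\<beta> K \<ge> 0" for K by (simp add: \<beta>_def isum_nonneg)
      define \<gamma> where "\<gamma> = (\<lambda>Q k. \<Sum>K\<in>KK Q k. len K * \<beta> K powr r)"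
      have \<gamma>0: "\<gamma> Q k \<ge> 0" for Q k unfolding \<gamma>_def by (intro sum_nonneg) simp
      \<comment> \<open>Hoelder's inequality with p and p' on the support of the piece, a disjoint
        union of maximal images.\<close>
      have piece: "isum N UNIV (\<lambda>t. norm (G Q k t) * g' t) \<le> C1 * ((\<alpha> Q * u Q k powr (1/q)) * \<gamma> Q k powr (1/q'))" for Q k
      proof -
        define W where "W = \<Union>(KK Q k)"
        have "isum N UNIV (\<lambda>t. norm (G Q k t) * g' t) = isum N W (\<lambda>t. norm (G Q k t) * g' t)"
          unfolding W_def by (rule isum_restrict) (auto simp: G0)
        also have "\<dots> \<le> isum N W (\<lambda>t. norm (G Q k t) powr p) powr (1/p) * isum N W (\<lambda>t. g' t powr p') powr (1/p')"
          using p p' g'0 by (intro holder_isum) auto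
        also have "\<dots> \<le> (((2 powi k) powr (-\<delta>)) powr p * (D * ((6 * \<alpha> Q) powr p * u Q k))) powr (1/p)
            * ((2 powi k * (M * u Q k)) powr \<delta> * \<gamma> Q k powr (1/q'))"
        proof (intro mult_mono)
          have "isum N W (\<lambda>t. norm (G Q k t) powr p) \<le> Lp_pow N p (G Q k)"
            unfolding Lp_pow_def by (intro isum_set_mono) auto
          also note G_p
          finally show "isum N W (\<lambda>t. norm (G Q k t) powr p) powr (1/p)
              \<le> (((2 powi k) powr (-\<delta>)) powr p * (D * ((6 * \<alpha> Q) powr p * u Q k))) powr (1/p)"
            using p by (intro powr_mono2) (auto intro: isum_nonneg)
          define s where "s = (\<Sum>K\<in>KK Q k. len K)"
          have s0: "s \<ge> 0" by (simp add: s_def sum_nonneg)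
          have "JJ Q k \<subseteq> dyadic" using AF(3,4) by blast
          then have inj: "inj_on \<tau> (JJ Q k)" by (rule inj_on_subset[OF \<tau>inj])
          \<comment> \<open>The maximal images are 2^k times as long as their preimages. Raised to
            the power \<delta>, this cancels the factor 2^(-k \<delta>) in
            \<open>G_p\<close>.\<close>
          have "s = (\<Sum>J\<in>JJ Q k. len (\<tau> J))" unfolding s_def KJ by (simp add: sum.reindex[OF inj])
          also have "\<dots> = (\<Sum>J\<in>JJ Q k. 2 powi k * len J)"
          proof (rule sum.cong)
            fix J assume "J \<in> JJ Q k"
            then have "J \<in> A Q k" using AF(4) by blast
            then have "J \<in> dyadic" "shift \<tau> J = k" using AF(3) by (blast, simp add: A_def)
            then show "len (\<tau> J) = 2 powi k * len J" using len_shift[of J \<tau>] \<tau>D[of J] by simp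
          qed simp
          also have "\<dots> \<le> 2 powi k * (M * u Q k)"
            unfolding sum_distrib_left[symmetric] using JJu by (intro mult_left_mono) auto
          finally have s: "s \<le> 2 powi k * (M * u Q k)" .
          have "isum N W (\<lambda>t. g' t powr p') = (\<Sum>K\<in>KK Q k. len K * \<beta> K)"
          proof -
            have "isum N W (\<lambda>t. g' t powr p') = (\<Sum>K\<in>KK Q k. isum N K (\<lambda>t. g' t powr p'))"
              unfolding W_def using KKf KKdis by (intro disjoint_sum_isum[symmetric])
            also have "\<dots> = (\<Sum>K\<in>KK Q k. len K * \<beta> K)"
            proof (rule sum.cong)
              fix K assume "K \<in> KK Q k"
              then have "len K > 0" using KKf(2) len_pos by blast
              then show "isum N K (\<lambda>t. g' t powr p') = len K * \<beta> K" by (simp add: \<beta>_def)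
            qed simp
            finally show ?thesis .
          qed
          then have "isum N W (\<lambda>t. g' t powr p') powr (1/p') = (\<Sum>K\<in>KK Q k. len K * \<beta> K) powr (1/p')" by simp
          also have "\<dots> = ((\<Sum>K\<in>KK Q k. len K * \<beta> K) powr r) powr (1/q')"
            using p' q' by (simp add: powr_powr r_def)
          \<comment> \<open>Jensen's inequality with weights \<open>len K\<close>; the total length
            s then enters with exponent (r - 1)/q', which is \<delta>.\<close>
          also have "\<dots> \<le> (s powr (r - 1) * \<gamma> Q k) powr (1/q')"
            unfolding s_def \<gamma>_def using q' r \<beta>0 KKf by (intro powr_mono2 jensen_sum) auto
          also have "\<dots> = s powr \<delta> * \<gamma> Q k powr (1/q')"
            using \<gamma>0 r1 by (simp add: powr_mult powr_powr)
          also have "\<dots> \<le> (2 powi k * (M * u Q k)) powr \<delta> * \<gamma> Q k powr (1/q')"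
            using s s0 \<delta> by (intro mult_right_mono powr_mono2) auto
          finally show "isum N W (\<lambda>t. g' t powr p') powr (1/p') \<le> (2 powi k * (M * u Q k)) powr \<delta> * \<gamma> Q k powr (1/q')" .
        qed auto
        also have "\<dots> = C1 * ((\<alpha> Q * u Q k powr (1/q)) * \<gamma> Q k powr (1/q'))"
        proof -
          define w :: real where "w = 2 powi k"
          have w: "w > 0" by (simp add: w_def)
          have e1: "((w powr (-\<delta>)) powr p * (D * ((6 * \<alpha> Q) powr p * u Q k))) powr (1/p)
              = w powr (-\<delta>) * (D powr (1/p) * (6 * \<alpha> Q * u Q k powr (1/p)))"
            using w D(1) \<alpha>0[of Q] u0[of Q k] p by (simp add: powr_mult powr_powr)
          have e2: "(w * (M * u Q k)) powr \<delta> = w powr \<delta> * (M powr \<delta> * u Q k powr \<delta>)"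
            using w M(1) u0[of Q k] by (simp add: powr_mult)
          have e3: "w powr (-\<delta>) * w powr \<delta> = 1" using w by (simp flip: powr_add)
          have e4: "u Q k powr (1/p) * u Q k powr \<delta> = u Q k powr (1/q)" by (simp add: \<delta>_def flip: powr_add)
          have "((w powr (-\<delta>)) powr p * (D * ((6 * \<alpha> Q) powr p * u Q k))) powr (1/p) * ((w * (M * u Q k)) powr \<delta> * \<gamma> Q k powr (1/q'))
            = (w powr (-\<delta>) * w powr \<delta>) * (D powr (1/p) * 6 * M powr \<delta>) * (\<alpha> Q * (u Q k powr (1/p) * u Q k powr \<delta>) * \<gamma> Q k powr (1/q'))"
            unfolding e1 e2 by (simp add: mult_ac)
          then show ?thesis unfolding e3 e4 C1_def w_def[symmetric] by (simp add: mult_ac)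
        qed
        finally show ?thesis .
      qed
      define X Y where "X = Lp_pow N q f" and "Y = isum N UNIV (\<lambda>t. \<phi> t powr q)"
      have XY: "X \<ge> 0" "Y \<ge> 0" by (auto simp: X_def Y_def isum_nonneg)
      \<comment> \<open>On the source side the packing of shifts removes the sum over k, and the
        embedding for the principal intervals with exponent q returns the norm of f.\<close>
      have src: "(\<Sum>x\<in>P. (\<alpha> (fst x) * u (fst x) (snd x) powr (1/q)) powr q) \<le> 3 * B * Kq * X"
      proof -
        have "(\<Sum>x\<in>P. (\<alpha> (fst x) * u (fst x) (snd x) powr (1/q)) powr q) = (\<Sum>Q\<in>\<pi> ` F. \<Sum>k\<in>S. \<alpha> Q powr q * u Q k)"
          unfolding P_def sum.cartesian_product using \<alpha>0 u0 q by (intro sum.cong) (auto simp: powr_mult powr_powr)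
        also have "\<dots> \<le> (\<Sum>Q\<in>\<pi> ` F. B * (len Q * \<alpha> Q powr q))"
        proof (rule sum_mono)
          fix Q assume "Q \<in> \<pi> ` F"
          then have "\<alpha> Q powr q * (\<Sum>k\<in>S. u Q k) \<le> \<alpha> Q powr q * (B * len Q)" using uQ by (intro mult_left_mono) auto
          then show "(\<Sum>k\<in>S. \<alpha> Q powr q * u Q k) \<le> B * (len Q * \<alpha> Q powr q)"
            by (subst sum_distrib_left[symmetric]) (simp add: mult_ac)
        qed
        also have "\<dots> = B * (\<Sum>Q\<in>\<pi> ` F. len Q * \<alpha> Q powr q)" by (simp add: sum_distrib_left)
        also have "\<dots> \<le> B * (3 * Kq * X)"
        proof (rule mult_left_mono)
          have "\<pi> ` F \<subseteq> \<pi> ` dyadic_upto N" "\<pi> ` F \<subseteq> dyadic_upto N" using Fup P1 by blast+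
          then show "(\<Sum>Q\<in>\<pi> ` F. len Q * \<alpha> Q powr q) \<le> 3 * Kq * X"
            using carleson_embedding[of 3 "\<pi> ` F" N q g] carleson_subset[OF P4] q
            by (simp add: \<alpha>_def Kq_def X_def Lp_pow_def g_def)
        qed (use B in simp)
        finally show ?thesis by simp
      qed
      \<comment> \<open>On the image side the families \<open>KK\<close> of distinct classes are
        disjoint since \<tau> is injective, and their union is the image of the Carleson family of
        all \<open>JJ\<close>.\<close>
      have img: "(\<Sum>x\<in>P. (\<gamma> (fst x) (snd x) powr (1/q')) powr q') \<le> M2 * Kr * Y"
      proof -
        define KA where "KA = (\<Union>x\<in>P. KK (fst x) (snd x))"
        have KAe: "KA = \<tau> ` (\<Union>Q\<in>\<pi> ` F. \<Union>k\<in>S. JJ Q k)" unfolding KA_def KJ P_def image_UN by force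
        have "(\<Sum>x\<in>P. (\<gamma> (fst x) (snd x) powr (1/q')) powr q') = (\<Sum>x\<in>P. \<gamma> (fst x) (snd x))"
          using \<gamma>0 q' by (intro sum.cong) (auto simp: powr_powr)
        also have "\<dots> = (\<Sum>K\<in>KA. len K * \<beta> K powr r)"
          unfolding KA_def \<gamma>_def
        proof (rule sum.UNION_disjoint[symmetric])
          show "\<forall>x\<in>P. \<forall>y\<in>P. x \<noteq> y \<longrightarrow> KK (fst x) (snd x) \<inter> KK (fst y) (snd y) = {}"
          proof (intro ballI impI, rule ccontr)
            fix x y assume xy: "x \<noteq> y" "KK (fst x) (snd x) \<inter> KK (fst y) (snd y) \<noteq> {}"
            then obtain I J where IJ: "I \<in> A (fst x) (snd x)" "J \<in> A (fst y) (snd y)" "\<tau> I = \<tau> J"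
              unfolding KJ using AF(4) by blast
            then have "I = J" using \<tau>inj AF(3) by (meson inj_onD subsetD)
            then show False using IJ xy(1) by (auto simp: A_def prod_eq_iff)
          qed
        qed (use Pf KKf in auto)
        also have "\<dots> \<le> M2 * Kr * isum N UNIV (\<lambda>t. (g' t powr p') powr r)"
          unfolding Kr_def \<beta>_def
        proof (rule carleson_embedding)
          show "carleson M2 KA" unfolding KAe using M2(2)[OF JJc] .
          show "KA \<subseteq> dyadic_upto N" unfolding KA_def using KKf(3) by blast
        qed (use M2 r in auto)
        also have "isum N UNIV (\<lambda>t. (g' t powr p') powr r) = Y"
        proof -
          \<comment> \<open>Since p' r = q' and (q - 1) q' = q, the embedding with exponent r
            returns Y itself, ready for absorption.\<close>
          have "(q - 1) * (p' * r) = q" using p' q by (simp add: r_def q'_def)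
          then show ?thesis unfolding Y_def g'_def by (simp add: powr_powr mult.assoc)
        qed
        finally show ?thesis .
      qed
      have "Y = isum N UNIV (\<lambda>t. \<Sum>x\<in>P. norm (G (fst x) (snd x) t) * g' t)"
      proof -
        have "\<phi> t powr q = (\<Sum>x\<in>P. norm (G (fst x) (snd x) t) * g' t)" for t
        proof -
          have "\<phi> t powr q = \<phi> t * g' t" using \<phi>0[of t] by (cases "\<phi> t = 0") (auto simp: g'_def powr_diff)
          then show ?thesis by (simp add: \<phi>_def sum_distrib_right)
        qed
        then show ?thesis by (simp add: Y_def)
      qed
      also have "\<dots> \<le> (\<Sum>x\<in>P. C1 * ((\<alpha> (fst x) * u (fst x) (snd x) powr (1/q)) * \<gamma> (fst x) (snd x) powr (1/q')))"
        unfolding isum_sum by (intro sum_mono piece)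
      also have "\<dots> = C1 * (\<Sum>x\<in>P. (\<alpha> (fst x) * u (fst x) (snd x) powr (1/q)) * \<gamma> (fst x) (snd x) powr (1/q'))"
        by (simp add: sum_distrib_left)
      also have "\<dots> \<le> C1 * ((\<Sum>x\<in>P. (\<alpha> (fst x) * u (fst x) (snd x) powr (1/q)) powr q) powr (1/q)
          * (\<Sum>x\<in>P. (\<gamma> (fst x) (snd x) powr (1/q')) powr q') powr (1/q'))"
        using Pf q q' \<alpha>0 C1 by (intro mult_left_mono holder_sum) auto
      also have "\<dots> \<le> C1 * ((3 * B * Kq * X) powr (1/q) * (M2 * Kr * Y) powr (1/q'))"
        using src img C1 q q' by (intro mult_left_mono mult_mono powr_mono2) (auto intro!: sum_nonneg)
      also have "\<dots> = C2 * X powr (1/q) * Y powr (1/q')"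
        using B(1) M2(1) K0 XY by (simp add: C2_def powr_mult)
      finally have "Y \<le> C2 powr q * X" using XY C2 q q' by (intro self_improve)
      moreover have "Lp_pow N q (hsum q \<tau> \<theta> a F) \<le> Y"
        unfolding Lp_pow_def Y_def
      proof (intro isum_mono powr_mono2)
        fix t
        have "hsum q \<tau> \<theta> a F t = (\<Sum>x\<in>P. \<Sum>J\<in>{J\<in>F. (\<pi> J, shift \<tau> J) = x}. (\<theta> J * haar (\<tau> J) t / len (\<tau> J) powr (1/q)) *\<^sub>R a J)"
          unfolding hsum_def using Ff Pf by (intro sum.group[symmetric]) (auto simp: P_def S_def)
        also have "\<dots> = (\<Sum>x\<in>P. G (fst x) (snd x) t)"
          unfolding G_def A_def by (intro sum.cong refl) (auto simp: prod_eq_iff)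
        finally show "norm (hsum q \<tau> \<theta> a F t) \<le> \<phi> t" unfolding \<phi>_def by (simp add: norm_sum)
      qed (use q in auto)
      ultimately show ?thesis by (simp add: f_eq X_def)
    qed
  qed
  then show ?thesis unfolding haar_bdd_def by (intro exI[of _ "C2 powr q"]) auto
qed

section \<open>Duality\<close>

text \<open>Hahn-Banach at one vector. Partial functionals are encoded by their graphs, as subspaces
  on which the second coordinate never exceeds the norm of the first. Applied to differences, this
  bound makes every such subspace single valued, so a maximal one is a graph.\<close>

lemma norming_functional:
  fixes x :: "'a::real_normed_vector"
  shows "\<exists>\<phi> :: 'a \<Rightarrow>\<^sub>L real. norm \<phi> \<le> 1 \<and> blinfun_apply \<phi> x = norm x"
proof -
  define \<G> where "\<G> = {G :: ('a \<times> real) set. subspace G \<and> (x, norm x) \<in> G \<and> (\<forall>(v, r)\<in>G. r \<le> norm v)}"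
  have "range (\<lambda>c. (c *\<^sub>R x, c * norm x)) \<in> \<G>"
  proof -
    have "subspace (range (\<lambda>c. (c *\<^sub>R x, c * norm x)))"
      unfolding subspace_def
    proof (intro conjI ballI allI)
      show "0 \<in> range (\<lambda>c. (c *\<^sub>R x, c * norm x))" by (rule range_eqI[of _ _ 0]) (simp add: zero_prod_def)
      fix a b assume "a \<in> range (\<lambda>c. (c *\<^sub>R x, c * norm x))" "b \<in> range (\<lambda>c. (c *\<^sub>R x, c * norm x))"
      then obtain c d where "a = (c *\<^sub>R x, c * norm x)" "b = (d *\<^sub>R x, d * norm x)" by blast
      then show "a + b \<in> range (\<lambda>c. (c *\<^sub>R x, c * norm x))"
        by (intro range_eqI[of _ _ "c + d"]) (simp add: algebra_simps)
    next
      fix e a assume "a \<in> range (\<lambda>c. (c *\<^sub>R x, c * norm x))"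
      then obtain c where "a = (c *\<^sub>R x, c * norm x)" by blast
      then show "e *\<^sub>R a \<in> range (\<lambda>c. (c *\<^sub>R x, c * norm x))"
        by (intro range_eqI[of _ _ "e * c"]) simp
    qed
    moreover have "(x, norm x) \<in> range (\<lambda>c. (c *\<^sub>R x, c * norm x))" by (rule range_eqI[of _ _ 1]) simp
    moreover have "c * norm x \<le> norm (c *\<^sub>R x)" for c by (simp add: mult_right_mono)
    ultimately show ?thesis unfolding \<G>_def by blast
  qed
  then have ne: "\<G> \<noteq> {}" by blast
  have "\<Union>\<C> \<in> \<G>" if ch: "\<C> \<noteq> {}" "subset.chain \<G> \<C>" for \<C>
  proof -
    have sub: "G \<in> \<G>" if "G \<in> \<C>" for G using ch(2) that by (auto simp: subset.chain_def)
    have lin: "G \<subseteq> H \<or> H \<subseteq> G" if "G \<in> \<C>" "H \<in> \<C>" for G H using ch(2) that by (auto simp: subset_chain_def)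
    have "subspace (\<Union>\<C>)"
      unfolding subspace_def
    proof (intro conjI ballI allI)
      show "0 \<in> \<Union>\<C>" using ch(1) sub unfolding \<G>_def subspace_def by blast
      fix a b assume "a \<in> \<Union>\<C>" "b \<in> \<Union>\<C>"
      then obtain G H where GH: "G \<in> \<C>" "H \<in> \<C>" "a \<in> G" "b \<in> H" by blast
      then obtain K where K: "K \<in> \<C>" "a \<in> K" "b \<in> K" using lin[of G H] by blast
      then have "subspace K" using sub by (simp add: \<G>_def)
      then show "a + b \<in> \<Union>\<C>" using K subspace_add by blast
    next
      fix c :: real and a assume "a \<in> \<Union>\<C>"
      then obtain G where "G \<in> \<C>" "a \<in> G" by blast
      then show "c *\<^sub>R a \<in> \<Union>\<C>" using sub subspace_scale unfolding \<G>_def by blast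
    qed
    then show ?thesis using ch(1) sub unfolding \<G>_def by blast
  qed
  then obtain G where G: "G \<in> \<G>" "\<And>H. H \<in> \<G> \<Longrightarrow> G \<subseteq> H \<Longrightarrow> H = G"
    using subset_Zorn_nonempty[OF ne] by blast
  have sG: "subspace G" and xG: "(x, norm x) \<in> G" and bG: "\<And>v r. (v, r) \<in> G \<Longrightarrow> r \<le> norm v"
    using G(1) by (auto simp: \<G>_def)
  have addG: "(v + w, r + s) \<in> G" if "(v, r) \<in> G" "(w, s) \<in> G" for v w r s
    using subspace_add[OF sG that] by simp
  have scG: "(c *\<^sub>R v, c * r) \<in> G" if "(v, r) \<in> G" for c v r
    using subspace_scale[OF sG that, of c] by simp
  have uniq: "r = s" if "(v, r) \<in> G" "(v, s) \<in> G" for v r s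
    using bG[OF addG[OF that(1) scG[OF that(2), of "-1"]]] bG[OF addG[OF that(2) scG[OF that(1), of "-1"]]] by simp
  have total: "\<exists>r. (y, r) \<in> G" for y
  proof -
    \<comment> \<open>An admissible value \<xi> at y must lie above all r -
      \<open>norm (v - y)\<close> and below all \<open>norm (w + y)\<close> - s. By
      \<open>key\<close> these demands are compatible, and the supremum of the lower ones meets
      them.\<close>
    define L where "L = {r - norm (v - y) | v r. (v, r) \<in> G}"
    have key: "r - norm (v - y) \<le> norm (w + y) - s" if "(v, r) \<in> G" "(w, s) \<in> G" for v r w s
    proof -
      have "r + s \<le> norm (v + w)" using bG[OF addG[OF that]] .
      also have "\<dots> \<le> norm (v - y) + norm (w + y)" using norm_triangle_ineq[of "v - y" "w + y"] by simp
      finally show ?thesis by simp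
    qed
    have Lne: "L \<noteq> {}" using xG by (auto simp: L_def)
    have Lb: "bdd_above L" using key[OF _ xG] by (intro bdd_aboveI[of _ "norm (x + y) - norm x"]) (auto simp: L_def)
    define \<xi> where "\<xi> = Sup L"
    have lo: "r - norm (v - y) \<le> \<xi>" if "(v, r) \<in> G" for v r
      unfolding \<xi>_def using that Lb by (intro cSup_upper) (auto simp: L_def)
    have hi: "\<xi> \<le> norm (w + y) - s" if "(w, s) \<in> G" for w s
      unfolding \<xi>_def using that Lne key by (intro cSup_least) (auto simp: L_def)
    define H where "H = {(v + c *\<^sub>R y, r + c * \<xi>) | v r c. (v, r) \<in> G}"
    have HI: "(v + c *\<^sub>R y, r + c * \<xi>) \<in> H" if "(v, r) \<in> G" for v r c using that by (auto simp: H_def)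
    have "subspace H"
      unfolding subspace_def
    proof (intro conjI ballI allI)
      have "(0, 0) \<in> G" using subspace_0[OF sG] by (simp add: zero_prod_def)
      from HI[OF this, of 0] show "0 \<in> H" by (simp add: zero_prod_def)
      fix a b assume "a \<in> H" "b \<in> H"
      then obtain v r c w s d where *: "(v, r) \<in> G" "a = (v + c *\<^sub>R y, r + c * \<xi>)" "(w, s) \<in> G" "b = (w + d *\<^sub>R y, s + d * \<xi>)"
        unfolding H_def by blast
      show "a + b \<in> H" using HI[OF addG[OF *(1,3)], of "c + d"] by (simp add: * algebra_simps)
    next
      fix e a assume "a \<in> H"
      then obtain v r c where *: "(v, r) \<in> G" "a = (v + c *\<^sub>R y, r + c * \<xi>)" unfolding H_def by blast
      show "e *\<^sub>R a \<in> H" using HI[OF scG[OF *(1), of e], of "e * c"] by (simp add: * algebra_simps)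
    qed
    moreover have GH: "G \<subseteq> H"
    proof
      fix a assume "a \<in> G"
      then show "a \<in> H" using HI[of "fst a" "snd a" 0] by simp
    qed
    moreover have "r + c * \<xi> \<le> norm (v + c *\<^sub>R y)" if vr: "(v, r) \<in> G" for v r c
    proof -
      consider "c = 0" | "c > 0" | "c < 0" by linarith
      then show ?thesis
      proof cases
        case 1
        then show ?thesis using bG[OF vr] by simp
      next
        case 2
        define w where "w = (1/c) *\<^sub>R v + y"
        have cw: "c *\<^sub>R w = v + c *\<^sub>R y" using 2 by (simp add: w_def scaleR_add_right)
        have n: "norm (v + c *\<^sub>R y) = c * norm w" unfolding cw[symmetric] using 2 by simp
        have "c * \<xi> \<le> c * (norm w - (1/c) * r)" using 2 hi[OF scG[OF vr, of "1/c"]] by (intro mult_left_mono) (auto simp: w_def)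
        then show ?thesis unfolding n using 2 by (simp add: right_diff_distrib)
      next
        case 3
        define d where "d = - c"
        have d: "d > 0" "c = - d" using 3 by (auto simp: d_def)
        define w where "w = (1/d) *\<^sub>R v - y"
        have cw: "d *\<^sub>R w = v + c *\<^sub>R y" using d by (simp add: w_def scaleR_diff_right)
        have n: "norm (v + c *\<^sub>R y) = d * norm w" unfolding cw[symmetric] using d by simp
        have "d * ((1/d) * r - norm w) \<le> d * \<xi>" using d lo[OF scG[OF vr, of "1/d"]] by (intro mult_left_mono) (auto simp: w_def)
        then show ?thesis unfolding n using d by (simp add: right_diff_distrib)
      qed
    qed
    ultimately have "H \<in> \<G>" using xG unfolding \<G>_def H_def by blast
    then have "H = G" using G(2) GH by blast
    moreover have "(0 + 1 *\<^sub>R y, 0 + 1 * \<xi>) \<in> H" using subspace_0[OF sG] by (intro HI) (simp add: zero_prod_def)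
    ultimately show ?thesis by auto
  qed
  define f where "f = (\<lambda>v. THE r. (v, r) \<in> G)"
  have f: "(v, f v) \<in> G" for v
    unfolding f_def using total[of v] uniq by (metis (mono_tags, lifting) theI)
  have fe: "f v = r" if "(v, r) \<in> G" for v r using uniq[OF f that] .
  have bl: "bounded_linear f"
  proof (rule bounded_linear_intro[of _ 1])
    show "f (v + w) = f v + f w" for v w by (rule fe[OF addG[OF f f]])
    show "f (c *\<^sub>R v) = c *\<^sub>R f v" for c v using fe[OF scG[OF f]] by simp
    show "norm (f v) \<le> norm v * 1" for v
      using bG[OF f[of v]] bG[OF scG[OF f[of v], of "-1"]] by simp
  qed
  have ab: "\<bar>f v\<bar> \<le> norm v" for v
    using bG[OF f[of v]] bG[OF scG[OF f[of v], of "-1"]] by simp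
  show ?thesis
  proof (intro exI[of _ "Blinfun f"] conjI)
    show "norm (Blinfun f) \<le> 1"
      by (rule norm_blinfun_bound) (use bl ab in \<open>auto simp: bounded_linear_Blinfun_apply\<close>)
    show "blinfun_apply (Blinfun f) x = norm x" using bl fe[OF xG] by (simp add: bounded_linear_Blinfun_apply)
  qed
qed

section \<open>Finite Haar expansions and change of the grid\<close>

definition haar_upto :: "nat \<Rightarrow> real set set" where
  "haar_upto N = {I \<in> dyadic. lev I < N}"

lemma finite_haar_upto [simp]: "finite (haar_upto N)"
  by (rule finite_subset[OF _ finite_dyadic_upto[of N]]) (auto simp: haar_upto_def dyadic_upto_def)

text \<open>Telescoping in k: the means over the cells of levels k and k + 1 around t differ by the
  one Haar term of level k that lives there. At k = N the cell contains a single grid point.\<close>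

lemma haar_expansion:
  fixes y :: "real \<Rightarrow> 'a::real_vector"
  assumes t: "t \<in> grid N"
  defines "m \<equiv> \<lambda>I. (1 / (2 ^ N * len I)) *\<^sub>R (\<Sum>s\<in>grid N. haar I s *\<^sub>R y s)"
  shows "y t = (1 / 2 ^ N) *\<^sub>R (\<Sum>s\<in>grid N. y s) + (\<Sum>I\<in>haar_upto N. haar I t *\<^sub>R m I)"
proof -
  have tU: "t \<in> {0..<1}" using t grid_unit by blast
  have "(2 ^ k / 2 ^ N) *\<^sub>R (\<Sum>s\<in>grid N \<inter> cell k t. y s) = (1 / 2 ^ N) *\<^sub>R (\<Sum>s\<in>grid N. y s) + (\<Sum>I\<in>haar_upto k. haar I t *\<^sub>R m I)"
    if "k \<le> N" for k
    using that
  proof (induction k)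
    case 0
    have "cell 0 t = {0..<1}" using unit_dyadic dyadic_cell[OF unit_dyadic(1) tU] by simp
    then have "grid N \<inter> cell 0 t = grid N" using grid_unit by blast
    moreover have "haar_upto 0 = {}" by (auto simp: haar_upto_def)
    ultimately show ?case by simp
  next
    case (Suc k)
    define L where "L = cell k t"
    have L: "L \<in> dyadic" "lev L = k" "t \<in> L" "len L = 1 / 2 ^ k" using tU by (auto simp: L_def len_cell)
    define a b where "a = (\<Sum>s\<in>grid N \<inter> lft L. y s)" and "b = (\<Sum>s\<in>grid N \<inter> rgt L. y s)"
    have ab: "(\<Sum>s\<in>grid N \<inter> L. y s) = a + b"
    proof -
      have "grid N \<inter> L = (grid N \<inter> lft L) \<union> (grid N \<inter> rgt L)" using children(5)[OF L(1)] by blast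
      then show ?thesis unfolding a_def b_def using children(6)[OF L(1)]
        by (simp add: sum.union_disjoint disjoint_iff)
    qed
    have mL: "m L = (2 ^ k / 2 ^ N) *\<^sub>R (a - b)"
    proof -
      have "(\<Sum>s\<in>grid N. haar L s *\<^sub>R y s) = (\<Sum>s\<in>(grid N \<inter> lft L) \<union> (grid N \<inter> rgt L). haar L s *\<^sub>R y s)"
        by (rule sum.mono_neutral_right) (auto simp: haar_eq[OF L(1)])
      also have "\<dots> = (\<Sum>s\<in>grid N \<inter> lft L. haar L s *\<^sub>R y s) + (\<Sum>s\<in>grid N \<inter> rgt L. haar L s *\<^sub>R y s)"
        using children(6)[OF L(1)] by (intro sum.union_disjoint) auto
      also have "(\<Sum>s\<in>grid N \<inter> lft L. haar L s *\<^sub>R y s) = a"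
        unfolding a_def by (rule sum.cong) (auto simp: haar_eq[OF L(1)])
      also have "(\<Sum>s\<in>grid N \<inter> rgt L. haar L s *\<^sub>R y s) = - b"
        unfolding b_def sum_negf[symmetric] using children(6)[OF L(1)]
        by (intro sum.cong) (auto simp: haar_eq[OF L(1)])
      finally show ?thesis using L(4) by (simp add: m_def)
    qed
    have new: "(\<Sum>I\<in>haar_upto (Suc k). haar I t *\<^sub>R m I) = (\<Sum>I\<in>haar_upto k. haar I t *\<^sub>R m I) + haar L t *\<^sub>R m L"
    proof -
      have "(\<Sum>I\<in>haar_upto (Suc k). haar I t *\<^sub>R m I) = (\<Sum>I\<in>insert L (haar_upto k). haar I t *\<^sub>R m I)"
      proof (rule sum.mono_neutral_right)
        show "\<forall>I\<in>haar_upto (Suc k) - insert L (haar_upto k). haar I t *\<^sub>R m I = 0"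
        proof
          fix I assume "I \<in> haar_upto (Suc k) - insert L (haar_upto k)"
          then have I: "I \<in> dyadic" "lev I = k" "I \<noteq> L" by (auto simp: haar_upto_def)
          have "t \<notin> I" using dyadic_cell[OF I(1), of t] I by (auto simp: L_def)
          then show "haar I t *\<^sub>R m I = 0" by (simp add: haar_outside)
        qed
      next
        show "insert L (haar_upto k) \<subseteq> haar_upto (Suc k)" using L by (auto simp: haar_upto_def)
      qed simp
      also have "\<dots> = haar L t *\<^sub>R m L + (\<Sum>I\<in>haar_upto k. haar I t *\<^sub>R m I)"
      proof (rule sum.insert[OF finite_haar_upto])
        show "L \<notin> haar_upto k" using L by (simp add: haar_upto_def)
      qed
      finally show ?thesis by simp
    qed
    have IH: "(2 ^ k / 2 ^ N) *\<^sub>R (a + b) = (1 / 2 ^ N) *\<^sub>R (\<Sum>s\<in>grid N. y s) + (\<Sum>I\<in>haar_upto k. haar I t *\<^sub>R m I)"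
      using Suc ab by (simp add: L_def)
    define w where "w = (2 ^ k / 2 ^ N :: real)"
    have w2: "2 ^ Suc k / 2 ^ N = 2 * w" by (simp add: w_def)
    consider "t \<in> lft L" | "t \<in> rgt L" using children(5)[OF L(1)] L(3) by blast
    then show ?case
    proof cases
      case 1
      then have "cell (Suc k) t = lft L" using dyadic_cell[OF children(1)[OF L(1)] 1] children(3)[OF L(1)] L(2) by simp
      moreover have "(2 * w) *\<^sub>R a = w *\<^sub>R (a + b) + 1 *\<^sub>R (w *\<^sub>R (a - b))" by (simp add: scaleR_add_right scaleR_diff_right flip: scaleR_add_left)
      ultimately show ?thesis unfolding new mL w2 a_def[symmetric] using IH 1 by (simp add: haar_eq[OF L(1)] w_def[symmetric] a_def[symmetric])
    next
      case 2
      then have nl: "t \<notin> lft L" using children(6)[OF L(1)] by blast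
      have "cell (Suc k) t = rgt L" using dyadic_cell[OF children(2)[OF L(1)] 2] children(4)[OF L(1)] L(2) by simp
      moreover have "(2 * w) *\<^sub>R b = w *\<^sub>R (a + b) + (-1) *\<^sub>R (w *\<^sub>R (a - b))" by (simp add: scaleR_add_right scaleR_diff_right flip: scaleR_add_left)
      ultimately show ?thesis unfolding new mL w2 using IH 2 nl by (simp add: haar_eq[OF L(1)] w_def[symmetric] b_def[symmetric])
    qed
  qed
  from this[of N] have "(\<Sum>s\<in>grid N \<inter> cell N t. y s) = (1 / 2 ^ N) *\<^sub>R (\<Sum>s\<in>grid N. y s) + (\<Sum>I\<in>haar_upto N. haar I t *\<^sub>R m I)" by simp
  moreover have "grid N \<inter> cell N t = {t}" using t grid_cell_inj by auto
  ultimately show ?thesis by simp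
qed

lemma stepfun_haar: "I \<in> dyadic \<Longrightarrow> lev I < N \<Longrightarrow> stepfun N (haar I)"
  unfolding stepfun_def
proof (intro allI impI)
  fix s t :: real
  assume H: "I \<in> dyadic" "lev I < N" "s \<in> {0..<1}" "t \<in> cell N s"
  show "haar I t = haar I s" using haar_const_lev[OF H(1) cell_dyadic[OF H(3), of N] _ H(4) cell_refl] H(2,3) by simp
qed

lemma stepfun_mono: "stepfun N f \<Longrightarrow> N \<le> N' \<Longrightarrow> stepfun N' f"
  using cell_mono unfolding stepfun_def by blast

lemma stepfun_hsum:
  assumes "\<And>I. I \<in> F \<Longrightarrow> \<tau> I \<in> dyadic \<and> lev (\<tau> I) < N"
  shows "stepfun N (hsum p \<tau> \<theta> a F)"
  unfolding stepfun_def hsum_def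
proof (intro allI impI sum.cong refl)
  fix s t I assume "s \<in> {0..<1::real}" "t \<in> cell N s" "I \<in> F"
  then have "haar (\<tau> I) t = haar (\<tau> I) s" using stepfun_haar[of "\<tau> I" N] assms unfolding stepfun_def by blast
  then show "(\<theta> I * haar (\<tau> I) t / len (\<tau> I) powr (1 / p)) *\<^sub>R a I = (\<theta> I * haar (\<tau> I) s / len (\<tau> I) powr (1 / p)) *\<^sub>R a I" by simp
qed

lemma Lp_pow_refine:
  assumes "stepfun N f" "N \<le> N'"
  shows "Lp_pow N' p f = Lp_pow N p f"
proof -
  have "stepfun N (\<lambda>t. norm (f t) powr p)" using assms(1) unfolding stepfun_def by metis
  then show ?thesis unfolding Lp_pow_def using lebesgue_stepfun stepfun_mono[OF _ assms(2)] by metis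
qed

text \<open>In the duality argument a test function is expanded over all intervals of level below N,
  whose images may be arbitrarily short; only those with nonzero multiplier stay on the grid. The
  bound is used on a finer grid, and both sides return by \<open>Lp_pow_refine\<close>.\<close>

lemma haar_bdd_partial:
  assumes bp: "haar_bdd TYPE('a::real_normed_vector) p \<tau>" and \<tau>: "\<And>J. J \<in> dyadic \<Longrightarrow> \<tau> J \<in> dyadic"
  obtains D where "D \<ge> 0" "\<And>N F (a :: real set \<Rightarrow> 'a) \<theta>. F \<subseteq> haar_upto N \<Longrightarrow>
     (\<And>I. I \<in> F \<Longrightarrow> \<theta> I \<noteq> 0 \<Longrightarrow> lev (\<tau> I) < N) \<Longrightarrow> (\<And>I. \<bar>\<theta> I\<bar> \<le> 1) \<Longrightarrow>
     Lp_pow N p (hsum p \<tau> \<theta> a F) \<le> D * Lp_pow N p (hsum p id (\<lambda>_. 1) a F)"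
proof -
  obtain D where D: "D \<ge> 0" "\<And>N F (a :: real set \<Rightarrow> 'a) \<theta>. F \<subseteq> dyadic \<Longrightarrow> (\<forall>I\<in>F. lev I < N \<and> lev (\<tau> I) < N) \<Longrightarrow>
     (\<forall>I. \<bar>\<theta> I\<bar> \<le> 1) \<Longrightarrow> Lp_pow N p (hsum p \<tau> \<theta> a F) \<le> D * Lp_pow N p (hsum p id (\<lambda>_. 1) a F)"
    using bp unfolding haar_bdd_def by blast
  show ?thesis
  proof (rule that[OF D(1)])
    fix N F and \<theta> :: "real set \<Rightarrow> real" and a :: "real set \<Rightarrow> 'a"
    assume F: "F \<subseteq> haar_upto N" and nz: "\<And>I. I \<in> F \<Longrightarrow> \<theta> I \<noteq> 0 \<Longrightarrow> lev (\<tau> I) < N" and \<theta>: "\<And>I. \<bar>\<theta> I\<bar> \<le> 1"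
    have Ff: "finite F" "F \<subseteq> dyadic" using finite_subset[OF F finite_haar_upto] F by (auto simp: haar_upto_def)
    obtain N' where N': "\<And>n. n \<ge> N' \<Longrightarrow> \<tau> ` F \<subseteq> dyadic_upto n" using finite_subset_upto[of "\<tau> ` F"] Ff \<tau> by blast
    define n where "n = max N (Suc N')"
    have lev: "lev I < n \<and> lev (\<tau> I) < n" if "I \<in> F" for I
      using F N'[of N'] that by (fastforce simp: n_def haar_upto_def dyadic_upto_def)
    have "Lp_pow n p (hsum p \<tau> \<theta> a F) \<le> D * Lp_pow n p (hsum p id (\<lambda>_. 1) a F)" using Ff lev \<theta> by (intro D(2)) auto
    moreover have "Lp_pow n p (hsum p id (\<lambda>_. 1) a F) = Lp_pow N p (hsum p id (\<lambda>_. 1) a F)"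
      using F by (intro Lp_pow_refine stepfun_hsum) (auto simp: haar_upto_def n_def)
    moreover have "hsum p \<tau> \<theta> a F = hsum p \<tau> \<theta> a {I\<in>F. \<theta> I \<noteq> 0}"
      unfolding hsum_def using Ff by (intro ext sum.mono_neutral_right) auto
    moreover have "Lp_pow n p (hsum p \<tau> \<theta> a {I\<in>F. \<theta> I \<noteq> 0}) = Lp_pow N p (hsum p \<tau> \<theta> a {I\<in>F. \<theta> I \<noteq> 0})"
      using Ff \<tau> nz by (intro Lp_pow_refine stepfun_hsum) (auto simp: n_def)
    ultimately show "Lp_pow N p (hsum p \<tau> \<theta> a F) \<le> D * Lp_pow N p (hsum p id (\<lambda>_. 1) a F)" by simp
  qed
qed

text \<open>Jensen's inequality bounds the mean by the norm. The mean must go because Haar functions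
  span only mean zero functions.\<close>

lemma Lp_pow_minus_mean:
  fixes y :: "real \<Rightarrow> 'a::real_normed_vector"
  assumes "p > 1"
  shows "Lp_pow N p (\<lambda>t. y t - (1 / 2 ^ N) *\<^sub>R (\<Sum>s\<in>grid N. y s)) \<le> 2 * 2 powr p * Lp_pow N p y"
proof -
  define c where "c = (1 / 2 ^ N) *\<^sub>R (\<Sum>s\<in>grid N. y s)"
  have one: "isum N UNIV (\<lambda>_. 1) = 1"
    using isum_restrict[of UNIV "{0..<1}" "\<lambda>_. 1" N] isum_1[OF unit_dyadic(1), of N] unit_dyadic grid_unit
    by (simp add: isum_def Int_absorb2)
  have "norm c powr p \<le> Lp_pow N p y"
  proof -
    have "norm c \<le> (\<Sum>s\<in>grid N. (1 / 2 ^ N) * norm (y s))"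
      unfolding c_def by (simp add: norm_sum divide_right_mono flip: sum_divide_distrib)
    then have "norm c powr p \<le> (\<Sum>s\<in>grid N. (1 / 2 ^ N) * norm (y s)) powr p" using assms by (intro powr_mono2) auto
    also have "\<dots> \<le> (\<Sum>s\<in>grid N. 1 / 2 ^ N) powr (p - 1) * (\<Sum>s\<in>grid N. (1 / 2 ^ N) * norm (y s) powr p)"
      using assms by (intro jensen_sum) auto
    also have "(\<Sum>s\<in>grid N. 1 / 2 ^ N) = (1::real)" using one by (simp add: isum_def)
    finally show ?thesis by (simp add: Lp_pow_def isum_def sum_divide_distrib)
  qed
  moreover have "Lp_pow N p (\<lambda>t. y t - c) \<le> isum N UNIV (\<lambda>t. 2 powr p * (norm (y t) powr p + norm c powr p))"
    unfolding Lp_pow_def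
  proof (rule isum_mono)
    fix t
    have "norm (y t - c) powr p \<le> (norm (y t) + norm c) powr p" using assms by (intro powr_mono2 norm_triangle_ineq4) auto
    also have "\<dots> \<le> 2 powr p * (norm (y t) powr p + norm c powr p)" using assms by (intro powr_add_le) auto
    finally show "norm (y t - c) powr p \<le> 2 powr p * (norm (y t) powr p + norm c powr p)" .
  qed
  moreover have "isum N UNIV (\<lambda>t. 2 powr p * (norm (y t) powr p + norm c powr p)) = 2 powr p * (Lp_pow N p y + norm c powr p)"
  proof -
    have "isum N UNIV (\<lambda>t. norm (y t) powr p + norm c powr p) = Lp_pow N p y + norm c powr p * isum N UNIV (\<lambda>_. 1)"
      by (simp add: isum_def Lp_pow_def sum.distrib add_divide_distrib)
    then show ?thesis by (simp add: isum_cmult one)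
  qed
  ultimately have "Lp_pow N p (\<lambda>t. y t - c) \<le> 2 powr p * (Lp_pow N p y + Lp_pow N p y)"
    by (smt (verit) mult_left_mono powr_ge_zero)
  then show ?thesis by (simp add: c_def)
qed

text \<open>The adjoint of the operator for \<tau> and p is the one for the inverse and p', so the
  rearrangement can be moved onto a test function. The pairing is abstract because it serves twice:
  for the dual against the space, and for the space against its dual. Norming up to the factor 1/2
  is asked for, since the norm of a functional need not be attained.\<close>

theorem haar_bdd_dual:
  fixes pair :: "'x::real_normed_vector \<Rightarrow> 'y::real_normed_vector \<Rightarrow> real"
  assumes bil: "bounded_bilinear pair" and le: "\<And>x y. \<bar>pair x y\<bar> \<le> norm x * norm y"
    and norming: "\<And>x. \<exists>y. norm y \<le> 1 \<and> norm x / 2 \<le> pair x y"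
    and bij: "bij_betw \<tau> dyadic dyadic" and p: "p > 1" "1/p + 1/p' = 1"
    and bp: "haar_bdd TYPE('y) p \<tau>"
  shows "haar_bdd TYPE('x) p' (inv_into dyadic \<tau>)"
proof -
  interpret pair: bounded_bilinear pair by (rule bil)
  define \<sigma> where "\<sigma> = inv_into dyadic \<tau>"
  have \<tau>D: "\<tau> J \<in> dyadic" if "J \<in> dyadic" for J using bij that by (metis bij_betw_apply)
  have \<sigma>D: "\<sigma> J \<in> dyadic" "\<tau> (\<sigma> J) = J" if "J \<in> dyadic" for J
    using bij that unfolding \<sigma>_def bij_betw_def by (auto intro: inv_into_into simp: f_inv_into_f)
  obtain D where D: "D \<ge> 0" "\<And>N F (a :: real set \<Rightarrow> 'y) \<theta>. F \<subseteq> haar_upto N \<Longrightarrow>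
     (\<And>I. I \<in> F \<Longrightarrow> \<theta> I \<noteq> 0 \<Longrightarrow> lev (\<tau> I) < N) \<Longrightarrow> (\<And>I. \<bar>\<theta> I\<bar> \<le> 1) \<Longrightarrow>
     Lp_pow N p (hsum p \<tau> \<theta> a F) \<le> D * Lp_pow N p (hsum p id (\<lambda>_. 1) a F)"
    using haar_bdd_partial[OF bp \<tau>D] by blast
  have p': "p' > 1" "p' = p / (p - 1)" using conj_exp_gt_1 p by auto
  have pp: "(p' - 1) * p = p'" using p p' by (simp add: field_simps)
  define K where "K = D * (2 * 2 powr p)"
  have K: "K \<ge> 0" using D(1) by (simp add: K_def)
  define c0 where "c0 = 2 * K powr (1/p)"
  have "Lp_pow N p' (hsum p' \<sigma> \<theta> b F) \<le> c0 powr p' * Lp_pow N p' (hsum p' id (\<lambda>_. 1) b F)"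
    if F: "F \<subseteq> dyadic" "\<forall>I\<in>F. lev I < N \<and> lev (\<sigma> I) < N" and \<theta>: "\<forall>I. \<bar>\<theta> I\<bar> \<le> 1"
    for N F \<theta> and b :: "real set \<Rightarrow> 'x"
  proof -
    have Fup: "F \<subseteq> haar_upto N" using F by (auto simp: haar_upto_def)
    then have Ff: "finite F" by (rule finite_subset[OF _ finite_haar_upto])
    define h where "h = hsum p' id (\<lambda>_. 1) b F"
    define H where "H = hsum p' \<sigma> \<theta> b F"
    define X Y where "X = Lp_pow N p' h" and "Y = Lp_pow N p' H"
    have XY: "X \<ge> 0" "Y \<ge> 0" by (auto simp: X_def Y_def)
    obtain e where e: "\<And>x. norm (e x) \<le> 1" "\<And>x. norm x / 2 \<le> pair x (e x)" using norming by metis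
    \<comment> \<open>The pointwise extremiser for the output H. The identity (p' - 1) p = p' bounds
      its norm in L^p by that of H in L^p'.\<close>
    define y where "y = (\<lambda>t. norm (H t) powr (p' - 1) *\<^sub>R e (H t))"
    have yp: "Lp_pow N p y \<le> Y"
      unfolding Lp_pow_def Y_def
    proof (rule isum_mono)
      fix t
      have "norm (y t) \<le> norm (H t) powr (p' - 1)" using e(1)[of "H t"] by (simp add: y_def mult_left_le)
      then have "norm (y t) powr p \<le> (norm (H t) powr (p' - 1)) powr p" using p by (intro powr_mono2) auto
      also have "\<dots> = norm (H t) powr p'" by (simp add: powr_powr pp)
      finally show "norm (y t) powr p \<le> norm (H t) powr p'" .
    qed
    have lower: "Y / 2 \<le> isum N UNIV (\<lambda>t. pair (H t) (y t))"
    proof -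
      have "Y / 2 = isum N UNIV (\<lambda>t. norm (H t) powr p' / 2)" by (simp add: Y_def Lp_pow_def isum_def sum_divide_distrib mult.commute)
      also have "\<dots> \<le> isum N UNIV (\<lambda>t. pair (H t) (y t))"
      proof (rule isum_mono)
        fix t
        have "norm (H t) powr p' = norm (H t) powr (p' - 1) * norm (H t)"
          by (cases "H t = 0") (auto simp: powr_diff)
        then have "norm (H t) powr p' / 2 = norm (H t) powr (p' - 1) * (norm (H t) / 2)" by simp
        also have "\<dots> \<le> norm (H t) powr (p' - 1) * pair (H t) (e (H t))" using e(2) by (intro mult_left_mono) auto
        finally show "norm (H t) powr p' / 2 \<le> pair (H t) (y t)" by (simp add: y_def pair.scaleR_right)
      qed
      finally show ?thesis .
    qed
    \<comment> \<open>The Haar coefficients of y, normalised so that on the grid their Haar sum for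
      p is y minus its mean.\<close>
    define c where "c = (\<lambda>I. (1 / 2 ^ N) *\<^sub>R (\<Sum>t\<in>grid N. (haar I t / len I powr (1/p')) *\<^sub>R y t))"
    have left: "isum N UNIV (\<lambda>t. pair (H t) (y t)) = (\<Sum>J\<in>F. \<theta> J * pair (b J) (c (\<sigma> J)))"
    proof -
      have "(\<Sum>t\<in>grid N. pair (H t) (y t)) = (\<Sum>t\<in>grid N. \<Sum>J\<in>F. \<theta> J * (haar (\<sigma> J) t / len (\<sigma> J) powr (1/p') * pair (b J) (y t)))"
        by (simp add: H_def hsum_def pair.sum_left pair.scaleR_left mult.assoc)
      also have "\<dots> = (\<Sum>J\<in>F. \<theta> J * (\<Sum>t\<in>grid N. haar (\<sigma> J) t / len (\<sigma> J) powr (1/p') * pair (b J) (y t)))"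
        by (subst sum.swap) (simp add: sum_distrib_left)
      finally have e1: "(\<Sum>t\<in>grid N. pair (H t) (y t))
        = (\<Sum>J\<in>F. \<theta> J * (\<Sum>t\<in>grid N. haar (\<sigma> J) t / len (\<sigma> J) powr (1/p') * pair (b J) (y t)))" .
      have e2: "pair (b J) (c I) = (\<Sum>t\<in>grid N. haar I t / len I powr (1/p') * pair (b J) (y t)) / 2 ^ N" for J I
        by (simp add: c_def pair.sum_right pair.scaleR_right)
      show ?thesis unfolding isum_def e2 Int_UNIV_right e1
        by (simp only: sum_divide_distrib[where A = F] times_divide_eq_right)
    qed
    define z where "z = (\<lambda>t. \<Sum>J\<in>F. (\<theta> J * haar J t / len J powr (1/p)) *\<^sub>R c (\<sigma> J))"
    have right: "isum N UNIV (\<lambda>t. pair (h t) (z t)) = (\<Sum>J\<in>F. \<theta> J * pair (b J) (c (\<sigma> J)))"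
    proof -
      have "isum N UNIV (\<lambda>t. pair (h t) (z t)) = isum N UNIV (\<lambda>t. \<Sum>J\<in>F. \<Sum>L\<in>F.
          (\<theta> L / (len J powr (1/p') * len L powr (1/p)) * pair (b J) (c (\<sigma> L))) * (haar J t * haar L t))"
      proof (rule arg_cong[of _ _ "isum N UNIV"], rule ext)
        fix t
        have "pair (h t) (z t) = (\<Sum>J\<in>F. pair ((1 * haar (id J) t / len (id J) powr (1/p')) *\<^sub>R b J) (z t))"
          unfolding h_def hsum_def by (rule pair.sum_left)
        also have "\<dots> = (\<Sum>J\<in>F. \<Sum>L\<in>F.
          (\<theta> L / (len J powr (1/p') * len L powr (1/p)) * pair (b J) (c (\<sigma> L))) * (haar J t * haar L t))"
          unfolding z_def pair.sum_right
          by (intro sum.cong refl) (simp add: pair.scaleR_left pair.scaleR_right mult_ac)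
        finally show "pair (h t) (z t) = (\<Sum>J\<in>F. \<Sum>L\<in>F.
          (\<theta> L / (len J powr (1/p') * len L powr (1/p)) * pair (b J) (c (\<sigma> L))) * (haar J t * haar L t))" .
      qed
      also have "\<dots> = (\<Sum>J\<in>F. \<Sum>L\<in>F.
          (\<theta> L / (len J powr (1/p') * len L powr (1/p)) * pair (b J) (c (\<sigma> L))) * isum N UNIV (\<lambda>t. haar J t * haar L t))"
        unfolding isum_sum isum_cmult ..
      also have "\<dots> = (\<Sum>J\<in>F. \<Sum>L\<in>F. if J = L then \<theta> J * pair (b J) (c (\<sigma> J)) else 0)"
      proof (intro sum.cong refl)
        fix J L assume JL: "J \<in> F" "L \<in> F"
        have o: "isum N UNIV (\<lambda>t. haar J t * haar L t) = (if J = L then len J else 0)"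
          using JL F by (intro haar_orth) auto
        have "len J > 0" using JL(1) F(1) len_pos by blast
        then have "len J powr (1/p') * len J powr (1/p) = len J" using p(2) by (simp add: add.commute flip: powr_add)
        then show "(\<theta> L / (len J powr (1/p') * len L powr (1/p)) * pair (b J) (c (\<sigma> L))) * isum N UNIV (\<lambda>t. haar J t * haar L t)
            = (if J = L then \<theta> J * pair (b J) (c (\<sigma> J)) else 0)"
          unfolding o using \<open>len J > 0\<close> by auto
      qed
      also have "\<dots> = (\<Sum>J\<in>F. \<theta> J * pair (b J) (c (\<sigma> J)))" using Ff by simp
      finally show ?thesis .
    qed
    have zp: "Lp_pow N p z \<le> K * Y"
    proof -
      \<comment> \<open>The multipliers are transported to the source intervals and vanish off
        \<sigma>(F), since only there the level of the image is known to be below N.\<close>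
      define \<theta>' where "\<theta>' = (\<lambda>I. if I \<in> \<sigma> ` F then \<theta> (\<tau> I) else 0)"
      have inj: "inj_on \<sigma> F" using F(1) \<sigma>D(2) by (metis inj_onI subsetD)
      have sub: "\<sigma> ` F \<subseteq> haar_upto N" using F \<sigma>D by (auto simp: haar_upto_def)
      have z_eq: "z = hsum p \<tau> \<theta>' c (haar_upto N)"
      proof
        fix t
        have "hsum p \<tau> \<theta>' c (haar_upto N) t = (\<Sum>I\<in>\<sigma> ` F. (\<theta> (\<tau> I) * haar (\<tau> I) t / len (\<tau> I) powr (1/p)) *\<^sub>R c I)"
          unfolding hsum_def using sub by (intro sum.mono_neutral_cong_right) (auto simp: \<theta>'_def)
        also have "\<dots> = z t"
          unfolding z_def using \<sigma>D(2) F(1) by (subst sum.reindex[OF inj]) (auto intro!: sum.cong simp: subset_iff)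
        finally show "z t = hsum p \<tau> \<theta>' c (haar_upto N) t" by simp
      qed
      have "Lp_pow N p z \<le> D * Lp_pow N p (hsum p id (\<lambda>_. 1) c (haar_upto N))"
        unfolding z_eq
      proof (rule D(2))
        fix I assume "\<theta>' I \<noteq> 0"
        then obtain J where "J \<in> F" "I = \<sigma> J" by (auto simp: \<theta>'_def split: if_splits)
        then show "lev (\<tau> I) < N" using \<sigma>D(2)[of J] F by auto
      qed (use \<theta> in \<open>auto simp: \<theta>'_def\<close>)
      also have "Lp_pow N p (hsum p id (\<lambda>_. 1) c (haar_upto N)) = Lp_pow N p (\<lambda>t. y t - (1 / 2 ^ N) *\<^sub>R (\<Sum>s\<in>grid N. y s))"
      proof -
        have "hsum p id (\<lambda>_. 1) c (haar_upto N) t = y t - (1 / 2 ^ N) *\<^sub>R (\<Sum>s\<in>grid N. y s)" if t: "t \<in> grid N" for t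
        proof -
          have "hsum p id (\<lambda>_. 1) c (haar_upto N) t
            = (\<Sum>I\<in>haar_upto N. haar I t *\<^sub>R ((1 / (2 ^ N * len I)) *\<^sub>R (\<Sum>s\<in>grid N. haar I s *\<^sub>R y s)))"
            unfolding hsum_def
          proof (rule sum.cong)
            fix I assume "I \<in> haar_upto N"
            then have l: "len I > 0" using len_pos by (auto simp: haar_upto_def)
            then have e: "len I powr (1/p) * len I powr (1/p') = len I" using p(2) by (simp flip: powr_add)
            have "c I = (1 / (2 ^ N * len I powr (1/p'))) *\<^sub>R (\<Sum>s\<in>grid N. haar I s *\<^sub>R y s)"
              unfolding c_def scaleR_sum_right by (intro sum.cong refl) simp
            then have "(1 * haar (id I) t / len (id I) powr (1/p)) *\<^sub>R c I
              = (haar I t * (1 / (2 ^ N * (len I powr (1/p) * len I powr (1/p'))))) *\<^sub>R (\<Sum>s\<in>grid N. haar I s *\<^sub>R y s)"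
              by (simp add: mult_ac)
            then show "(1 * haar (id I) t / len (id I) powr (1/p)) *\<^sub>R c I
              = haar I t *\<^sub>R ((1 / (2 ^ N * len I)) *\<^sub>R (\<Sum>s\<in>grid N. haar I s *\<^sub>R y s))" unfolding e by simp
          qed simp
          then show ?thesis using haar_expansion[OF t, of y] by simp
        qed
        then show ?thesis by (simp add: Lp_pow_def isum_def)
      qed
      also have "D * Lp_pow N p (\<lambda>t. y t - (1 / 2 ^ N) *\<^sub>R (\<Sum>s\<in>grid N. y s)) \<le> D * (2 * 2 powr p * Lp_pow N p y)"
        using D(1) p Lp_pow_minus_mean by (intro mult_left_mono) auto
      also have "\<dots> \<le> K * Y" using mult_left_mono[OF yp K] by (simp add: K_def mult_ac)
      finally show ?thesis .
    qed
    have "Y / 2 \<le> isum N UNIV (\<lambda>t. pair (h t) (z t))" using lower left right by simp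
    also have "\<dots> \<le> isum N UNIV (\<lambda>t. norm (h t) * norm (z t))"
      using le by (intro isum_mono) (meson abs_le_D1)
    also have "\<dots> \<le> X powr (1/p') * (Lp_pow N p z) powr (1/p)"
      unfolding X_def Lp_pow_def using p p' by (intro holder_isum) auto
    also have "\<dots> \<le> X powr (1/p') * (K * Y) powr (1/p)"
      using zp p by (intro mult_left_mono powr_mono2) auto
    also have "\<dots> = K powr (1/p) * X powr (1/p') * Y powr (1/p)" using K XY by (simp add: powr_mult)
    finally have "Y \<le> c0 * X powr (1/p') * Y powr (1/p)" by (simp add: c0_def)
    then have "Y \<le> c0 powr p' * X" using XY p p' by (intro self_improve) (auto simp: c0_def)
    then show ?thesis by (simp add: X_def Y_def h_def H_def)
  qed
  then show ?thesis unfolding haar_bdd_def \<sigma>_def[symmetric] by (intro exI[of _ "c0 powr p'"]) auto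
qed

section \<open>Carleson families under bounded rearrangements\<close>

text \<open>The variant without multipliers, which a finite rearrangement norm provides directly.
  Unconditionality adds the multipliers later.\<close>

definition rearr_bdd :: "'a::real_normed_vector itself \<Rightarrow> real \<Rightarrow> (real set \<Rightarrow> real set) \<Rightarrow> bool" where
  "rearr_bdd _ p \<tau> \<longleftrightarrow> (\<exists>D\<ge>0. \<forall>N F (a :: real set \<Rightarrow> 'a). F \<subseteq> dyadic \<longrightarrow> (\<forall>I\<in>F. lev I < N \<and> lev (\<tau> I) < N) \<longrightarrow>
     Lp_pow N p (hsum p \<tau> (\<lambda>_. 1) a F) \<le> D * Lp_pow N p (hsum p id (\<lambda>_. 1) a F))"

text \<open>With Haar functions replaced by indicators, testing the sum \<phi> against \<phi>^(p-1)
  produces means over the members of C, which the embedding with exponent p' controls. Up to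
  constants the Haar functions of a Carleson family obey the upper bound of disjointly supported
  ones.\<close>

lemma carleson_Lp_upper:
  assumes C: "carleson M C" and CN: "C \<subseteq> haar_upto N" and M: "M > 0" and p: "p > 1" "1/p + 1/p' = 1"
  shows "Lp_pow N p (hsum p id (\<lambda>_. 1) (\<alpha> :: real set \<Rightarrow> real) C)
    \<le> ((M * (2 powr p' / (p' - 1))) powr (1/p')) powr p * (\<Sum>I\<in>C. \<bar>\<alpha> I\<bar> powr p)"
proof -
  have p': "p' > 1" "p' = p / (p - 1)" using conj_exp_gt_1 p by auto
  have Cf: "finite C" "C \<subseteq> dyadic" using C by (auto simp: carleson_def)
  have Cup: "C \<subseteq> dyadic_upto N" using CN by (auto simp: haar_upto_def dyadic_upto_def)
  define \<phi> where "\<phi> = (\<lambda>t. \<Sum>I\<in>C. \<bar>\<alpha> I\<bar> / len I powr (1/p) * indicator I t)"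
  have \<phi>0: "\<phi> t \<ge> 0" for t unfolding \<phi>_def by (intro sum_nonneg) auto
  define g where "g = (\<lambda>t. \<phi> t powr (p - 1))"
  have g0: "g t \<ge> 0" for t by (simp add: g_def)
  define K where "K = M * (2 powr p' / (p' - 1))"
  have K: "K \<ge> 0" using M p' by (simp add: K_def)
  define X Y where "X = (\<Sum>I\<in>C. \<bar>\<alpha> I\<bar> powr p)" and "Y = isum N UNIV (\<lambda>t. \<phi> t powr p)"
  have XY: "X \<ge> 0" "Y \<ge> 0" by (auto simp: X_def Y_def isum_nonneg sum_nonneg)
  define \<beta> where "\<beta> = (\<lambda>I. isum N I g / len I)"
  have \<beta>0: "\<beta> I \<ge> 0" for I by (simp add: \<beta>_def isum_nonneg g0)
  have "Y = isum N UNIV (\<lambda>t. \<Sum>I\<in>C. \<bar>\<alpha> I\<bar> / len I powr (1/p) * (indicator I t * g t))"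
  proof -
    have "\<phi> t powr p = (\<Sum>I\<in>C. \<bar>\<alpha> I\<bar> / len I powr (1/p) * (indicator I t * g t))" for t
    proof -
      have "\<phi> t powr p = \<phi> t * g t" using \<phi>0[of t] by (cases "\<phi> t = 0") (auto simp: g_def powr_diff)
      then show ?thesis by (simp add: \<phi>_def sum_distrib_right mult.assoc)
    qed
    then show ?thesis by (simp add: Y_def)
  qed
  also have "\<dots> = (\<Sum>I\<in>C. \<bar>\<alpha> I\<bar> * (len I powr (1/p') * \<beta> I))"
    unfolding isum_sum isum_cmult
  proof (rule sum.cong)
    fix I assume "I \<in> C"
    then have l: "len I > 0" using Cf len_pos by blast
    have "isum N UNIV (\<lambda>t. indicator I t * g t) = isum N I (\<lambda>t. indicator I t * g t)" by (rule isum_restrict) auto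
    also have "\<dots> = isum N I g" by (simp add: isum_def)
    finally have i: "isum N UNIV (\<lambda>t. indicator I t * g t) = isum N I g" .
    have "len I powr (1/p') * len I powr (1/p) = len I" using p(2) l by (simp add: add.commute flip: powr_add)
    then have "len I powr (1/p') / len I = 1 / len I powr (1/p)" using l by (simp add: field_simps)
    then show "\<bar>\<alpha> I\<bar> / len I powr (1/p) * isum N UNIV (\<lambda>t. indicator I t * g t) = \<bar>\<alpha> I\<bar> * (len I powr (1/p') * \<beta> I)"
      unfolding i \<beta>_def by (metis (no_types, lifting) mult.commute mult.right_neutral times_divide_eq_left times_divide_eq_right)
  qed simp
  also have "\<dots> \<le> (\<Sum>I\<in>C. \<bar>\<alpha> I\<bar> powr p) powr (1/p) * (\<Sum>I\<in>C. (len I powr (1/p') * \<beta> I) powr p') powr (1/p')"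
    using Cf p p' \<beta>0 by (intro holder_sum) auto
  also have "(\<Sum>I\<in>C. (len I powr (1/p') * \<beta> I) powr p') = (\<Sum>I\<in>C. len I * \<beta> I powr p')"
    using \<beta>0 p' by (intro sum.cong) (auto simp: powr_mult powr_powr)
  also have "(\<Sum>I\<in>C. len I * \<beta> I powr p') \<le> K * isum N UNIV (\<lambda>t. g t powr p')"
    unfolding K_def \<beta>_def using C Cup M p' g0 by (intro carleson_embedding)
  then have "(\<Sum>I\<in>C. \<bar>\<alpha> I\<bar> powr p) powr (1/p) * (\<Sum>I\<in>C. len I * \<beta> I powr p') powr (1/p')
      \<le> X powr (1/p) * (K * isum N UNIV (\<lambda>t. g t powr p')) powr (1/p')"
    unfolding X_def using p'(1) \<beta>0 by (intro mult_left_mono powr_mono2) (auto intro!: sum_nonneg)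
  also have "isum N UNIV (\<lambda>t. g t powr p') = Y"
  proof -
    have "(p - 1) * p' = p" using p p' by simp
    then show ?thesis by (simp add: Y_def g_def powr_powr)
  qed
  also have "X powr (1/p) * (K * Y) powr (1/p') = K powr (1/p') * X powr (1/p) * Y powr (1/p')"
    using K XY by (simp add: powr_mult)
  finally have "Y \<le> (K powr (1/p')) powr p * X" using XY p by (intro self_improve) auto
  moreover have "Lp_pow N p (hsum p id (\<lambda>_. 1) \<alpha> C) \<le> Y"
    unfolding Lp_pow_def Y_def
  proof (intro isum_mono powr_mono2)
    fix t
    show "norm (hsum p id (\<lambda>_. 1) \<alpha> C t) \<le> \<phi> t"
      unfolding hsum_def \<phi>_def by (rule order_trans[OF norm_sum]) (simp add: abs_mult abs_haar mult.commute)
  qed (use p in auto)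
  ultimately show ?thesis by (simp add: K_def X_def)
qed

text \<open>By orthogonality, pairing with the Haar sum of coefficients \<alpha>^(p-1) reproduces
  the sum of \<alpha>^p, and the upper estimate for p' bounds that second Haar sum.\<close>

lemma carleson_Lp_lower:
  assumes C: "carleson M C" and CN: "C \<subseteq> haar_upto N" and M: "M > 0" and p: "p > 1" "1/p + 1/p' = 1"
    and \<alpha>: "\<And>I. I \<in> C \<Longrightarrow> (\<alpha> :: real set \<Rightarrow> real) I \<ge> 0"
  shows "(\<Sum>I\<in>C. \<alpha> I powr p) \<le> (((((M * (2 powr p / (p - 1))) powr (1/p)) powr p') powr (1/p')) powr p) * Lp_pow N p (hsum p id (\<lambda>_. 1) \<alpha> C)"
proof -
  have p': "p' > 1" "p' = p / (p - 1)" using conj_exp_gt_1 p by auto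
  have Cf: "finite C" "C \<subseteq> dyadic" using C by (auto simp: carleson_def)
  define \<beta> where "\<beta> = (\<lambda>I. \<alpha> I powr (p - 1))"
  define f g where "f = hsum p id (\<lambda>_. 1) \<alpha> C" and "g = hsum p' id (\<lambda>_. 1) \<beta> C"
  define K where "K = ((M * (2 powr p / (p - 1))) powr (1/p)) powr p'"
  define X Y where "X = Lp_pow N p f" and "Y = (\<Sum>I\<in>C. \<alpha> I powr p)"
  have XY: "X \<ge> 0" "Y \<ge> 0" by (auto simp: X_def Y_def sum_nonneg)
  have "Lp_pow N p' g \<le> K * (\<Sum>I\<in>C. \<bar>\<beta> I\<bar> powr p')"
    unfolding g_def K_def using carleson_Lp_upper[OF C CN M p'(1), of p \<beta>] p(2) by (simp add: add.commute)
  also have "(\<Sum>I\<in>C. \<bar>\<beta> I\<bar> powr p') = Y"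
  proof -
    have "(p - 1) * p' = p" using p p' by simp
    then show ?thesis by (simp add: Y_def \<beta>_def powr_powr)
  qed
  finally have gp: "Lp_pow N p' g \<le> K * Y" .
  have "Y = isum N UNIV (\<lambda>t. f t * g t)"
  proof -
    have "isum N UNIV (\<lambda>t. f t * g t) = isum N UNIV (\<lambda>t. \<Sum>I\<in>C. \<Sum>J\<in>C.
        (\<alpha> I * \<beta> J / (len I powr (1/p) * len J powr (1/p'))) * (haar I t * haar J t))"
      by (simp add: f_def g_def hsum_def sum_product mult_ac)
    also have "\<dots> = (\<Sum>I\<in>C. \<Sum>J\<in>C.
        (\<alpha> I * \<beta> J / (len I powr (1/p) * len J powr (1/p'))) * isum N UNIV (\<lambda>t. haar I t * haar J t))"
      unfolding isum_sum isum_cmult ..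
    also have "\<dots> = (\<Sum>I\<in>C. \<Sum>J\<in>C. if I = J then \<alpha> I powr p else 0)"
    proof (intro sum.cong refl)
      fix I J assume IJ: "I \<in> C" "J \<in> C"
      have o: "isum N UNIV (\<lambda>t. haar I t * haar J t) = (if I = J then len I else 0)"
        using IJ CN by (intro haar_orth) (auto simp: haar_upto_def)
      have l: "len I > 0" using IJ(1) Cf len_pos by blast
      then have e: "len I powr (1/p) * len I powr (1/p') = len I" using p(2) by (simp flip: powr_add)
      have "\<alpha> I * \<beta> I = \<alpha> I powr p" using \<alpha>[OF IJ(1)] by (cases "\<alpha> I = 0") (auto simp: \<beta>_def powr_diff)
      then show "(\<alpha> I * \<beta> J / (len I powr (1/p) * len J powr (1/p'))) * isum N UNIV (\<lambda>t. haar I t * haar J t)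
          = (if I = J then \<alpha> I powr p else 0)" unfolding o using l e by auto
    qed
    also have "\<dots> = Y" using Cf by (simp add: Y_def)
    finally show ?thesis by simp
  qed
  also have "\<dots> \<le> isum N UNIV (\<lambda>t. \<bar>f t\<bar> * \<bar>g t\<bar>)" by (intro isum_mono) (simp flip: abs_mult)
  also have "\<dots> \<le> X powr (1/p) * Lp_pow N p' g powr (1/p')"
    unfolding X_def Lp_pow_def real_norm_def using p p' by (intro holder_isum) auto
  also have "\<dots> \<le> X powr (1/p) * (K * Y) powr (1/p')" using gp p'(1) by (intro mult_left_mono powr_mono2) auto
  also have "\<dots> = K powr (1/p') * X powr (1/p) * Y powr (1/p')" using XY by (simp add: powr_mult K_def)
  finally have "Y \<le> (K powr (1/p')) powr p * X" using XY p by (intro self_improve) auto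
  then show ?thesis by (simp add: K_def X_def Y_def f_def)
qed

text \<open>For a Carleson family \<open>C\<close> and an interval \<open>R\<close>, the sum of \<open>h\<^bsub>\<tau>(I)\<^esub>\<close> over those \<open>I \<in> C\<close> with
  \<open>\<tau>(I) \<subseteq> R\<close> has the squared \<open>L\<^sup>2\<close> norm \<open>m = \<Sum>|\<tau>(I)|\<close>, and its \<open>L\<^sup>p\<close> norm to the power \<open>p\<close> is
  comparable to \<open>m\<close>. Comparing both by Hoelder's inequality on \<open>R\<close> bounds \<open>m\<close> because \<open>p \<noteq> 2\<close>.\<close>

theorem preserves_carleson_if_rearr_bdd:
  assumes bij: "bij_betw \<tau> dyadic dyadic" and p: "p > 1" "p \<noteq> 2"
    and bt: "rearr_bdd TYPE(real) p \<tau>" and bs: "rearr_bdd TYPE(real) p (inv_into dyadic \<tau>)"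
  shows "preserves_carleson \<tau>"
proof -
  define \<sigma> where "\<sigma> = inv_into dyadic \<tau>"
  have \<tau>D: "\<tau> J \<in> dyadic" if "J \<in> dyadic" for J using bij that by (metis bij_betw_apply)
  have \<tau>inj: "inj_on \<tau> dyadic" using bij by (rule bij_betw_imp_inj_on)
  have \<sigma>\<tau>: "\<sigma> (\<tau> J) = J" if "J \<in> dyadic" for J using bij that by (simp add: \<sigma>_def bij_betw_inv_into_left)
  obtain D where D: "D \<ge> 0" "\<And>N F (a :: real set \<Rightarrow> real). F \<subseteq> dyadic \<Longrightarrow> (\<forall>I\<in>F. lev I < N \<and> lev (\<tau> I) < N) \<Longrightarrow>
     Lp_pow N p (hsum p \<tau> (\<lambda>_. 1) a F) \<le> D * Lp_pow N p (hsum p id (\<lambda>_. 1) a F)"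
    using bt unfolding rearr_bdd_def by blast
  obtain D' where D': "D' \<ge> 0" "\<And>N F (a :: real set \<Rightarrow> real). F \<subseteq> dyadic \<Longrightarrow> (\<forall>I\<in>F. lev I < N \<and> lev (\<sigma> I) < N) \<Longrightarrow>
     Lp_pow N p (hsum p \<sigma> (\<lambda>_. 1) a F) \<le> D' * Lp_pow N p (hsum p id (\<lambda>_. 1) a F)"
    using bs unfolding rearr_bdd_def \<sigma>_def by blast
  define p' where "p' = p / (p - 1)"
  have p': "1/p + 1/p' = 1" using p by (simp add: p'_def field_simps)
  have "\<exists>M'\<ge>1. \<forall>C. carleson M0 C \<longrightarrow> carleson M' (\<tau> ` C)" for M0
  proof -
    define M where "M = max M0 1"
    have M: "M > 0" by (simp add: M_def)
    define K1 where "K1 = ((M * (2 powr p' / (p' - 1))) powr (1/p')) powr p"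
    define K2 where "K2 = ((((M * (2 powr p / (p - 1))) powr (1/p)) powr p') powr (1/p')) powr p"
    define M' where "M' = max 1 (max (((D * K1) powr (2/p)) powr (1 / (1 - 2/p))) ((K2 * D') powr (1 / (1 - p/2))))"
    have "carleson M' (\<tau> ` C)" if "carleson M0 C" for C
    proof -
      have C: "carleson M C" using carleson_mono[OF that, of M] by (simp add: M_def)
      have Cf: "finite C" "C \<subseteq> dyadic" using C by (auto simp: carleson_def)
      have "(\<Sum>K\<in>{K \<in> \<tau> ` C. K \<subseteq> R}. len K) \<le> M' * len R" if R: "R \<in> dyadic" for R
      proof -
        define E where "E = {I\<in>C. \<tau> I \<subseteq> R}"
        have E: "carleson M E" "finite E" "E \<subseteq> dyadic" using carleson_subset[OF C, of E] Cf by (auto simp: E_def)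
        obtain N0 where N0: "\<And>n. n \<ge> N0 \<Longrightarrow> insert R (E \<union> \<tau> ` E) \<subseteq> dyadic_upto n"
          using finite_subset_upto[of "insert R (E \<union> \<tau> ` E)"] E R \<tau>D by blast
        define N where "N = Suc N0"
        have lev: "lev I < N" "lev (\<tau> I) < N" if "I \<in> E" for I
          using N0[of N0] that by (auto simp: N_def dyadic_upto_def less_Suc_eq_le subset_iff)
        have levR: "lev R \<le> N" using N0[of N0] by (auto simp: N_def dyadic_upto_def)
        have EN: "E \<subseteq> haar_upto N" using E lev by (auto simp: haar_upto_def)
        define m where "m = (\<Sum>I\<in>E. len (\<tau> I))"
        have m0: "m \<ge> 0" by (simp add: m_def sum_nonneg)
        have injE: "inj_on \<tau> E" using \<tau>inj E(3) inj_on_subset by blast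
        have m_eq: "(\<Sum>K\<in>{K \<in> \<tau> ` C. K \<subseteq> R}. len K) = m"
        proof -
          have "{K \<in> \<tau> ` C. K \<subseteq> R} = \<tau> ` E" by (auto simp: E_def)
          then show ?thesis using injE by (simp add: m_def sum.reindex)
        qed
        define s where "s = (\<lambda>t. \<Sum>I\<in>E. haar (\<tau> I) t)"
        have s0: "s t = 0" if "t \<notin> R" for t
          unfolding s_def using that by (intro sum.neutral ballI haar_outside) (auto simp: E_def)
        have s2: "isum N UNIV (\<lambda>t. s t * s t) = m"
        proof -
          have "isum N UNIV (\<lambda>t. s t * s t) = (\<Sum>I\<in>E. \<Sum>J\<in>E. isum N UNIV (\<lambda>t. haar (\<tau> I) t * haar (\<tau> J) t))"
            unfolding s_def sum_product isum_sum ..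
          also have "\<dots> = (\<Sum>I\<in>E. \<Sum>J\<in>E. if I = J then len (\<tau> I) else 0)"
          proof (intro sum.cong refl)
            fix I J assume IJ: "I \<in> E" "J \<in> E"
            have "\<tau> I = \<tau> J \<longleftrightarrow> I = J" using injE IJ by (auto dest: inj_onD)
            then show "isum N UNIV (\<lambda>t. haar (\<tau> I) t * haar (\<tau> J) t) = (if I = J then len (\<tau> I) else 0)"
              using IJ E(3) lev \<tau>D by (subst haar_orth) auto
          qed
          finally show ?thesis using E(2) by (simp add: m_def)
        qed
        define P where "P = Lp_pow N p s"
        have P0: "P \<ge> 0" by (simp add: P_def)
        have PR: "P = isum N R (\<lambda>t. \<bar>s t\<bar> powr p)" unfolding P_def Lp_pow_def real_norm_def by (rule isum_restrict) (auto simp: s0)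
        have mR: "m = isum N R (\<lambda>t. \<bar>s t\<bar> powr 2)"
        proof -
          have "m = isum N R (\<lambda>t. s t * s t)" unfolding s2[symmetric] by (rule isum_restrict) (auto simp: s0)
          then show ?thesis by (simp add: power2_eq_square)
        qed
        have lR: "len R > 0" using len_pos R by blast
        have jen: "isum N R (\<lambda>t. x t) powr r \<le> len R powr (r - 1) * isum N R (\<lambda>t. x t powr r)"
          if "r > 1" "\<And>t. x t \<ge> 0" for x r
        proof -
          have "(\<Sum>t\<in>grid N \<inter> R. (1 / 2 ^ N) * x t) powr r
              \<le> (\<Sum>t\<in>grid N \<inter> R. 1 / 2 ^ N) powr (r - 1) * (\<Sum>t\<in>grid N \<inter> R. (1 / 2 ^ N) * x t powr r)"
            using that by (intro jensen_sum) auto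
          moreover have "(\<Sum>t\<in>grid N \<inter> R. 1 / 2 ^ N) = len R" using isum_1[OF R levR] by (simp add: isum_def)
          ultimately show ?thesis by (simp add: isum_def sum_divide_distrib)
        qed
        \<comment> \<open>These coefficients cancel the normalisation of the images, so s is the
          output of the operator for them, while their p-th powers add up to m.\<close>
        define \<alpha> where "\<alpha> = (\<lambda>I. len (\<tau> I) powr (1/p))"
        have \<tau>l: "len (\<tau> I) > 0" if "I \<in> E" for I using that E(3) \<tau>D len_pos by blast
        have \<alpha>m: "(\<Sum>I\<in>E. \<alpha> I powr p) = m"
          unfolding m_def using p \<tau>l by (intro sum.cong) (auto simp: \<alpha>_def powr_powr)
        have s_eq: "s = hsum p \<tau> (\<lambda>_. 1) \<alpha> E"
        proof -
          have "len (\<tau> I) \<noteq> 0" if "I \<in> E" for I using \<tau>l[OF that] by simp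
          then show ?thesis unfolding s_def hsum_def \<alpha>_def by (intro ext sum.cong) auto
        qed
        define f where "f = hsum p id (\<lambda>_. 1) \<alpha> E"
        show ?thesis
        proof (cases "p > 2")
          case True
          \<comment> \<open>For p > 2, boundedness of \<tau> and the upper Carleson estimate bound P
            by a multiple of m, and Hoelder's inequality on R bounds m^(p/2) by |R|^(p/2-1)
            P.\<close>
          have "P \<le> D * Lp_pow N p f" unfolding P_def s_eq f_def using E lev by (intro D(2)) auto
          also have "\<dots> \<le> D * (K1 * m)"
          proof (rule mult_left_mono)
            have "(\<Sum>I\<in>E. \<bar>\<alpha> I\<bar> powr p) = m" using \<alpha>m by (simp add: \<alpha>_def)
            then show "Lp_pow N p f \<le> K1 * m"
              unfolding f_def K1_def using carleson_Lp_upper[OF E(1) EN M p(1) p', of \<alpha>] by simp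
          qed (use D in simp)
          finally have P: "P \<le> D * K1 * m" by simp
          have "m powr (p/2) \<le> len R powr (p/2 - 1) * P"
            using jen[of "p/2" "\<lambda>t. \<bar>s t\<bar> powr 2"] True unfolding mR[symmetric] PR by (simp add: powr_powr del: powr_numeral)
          also have "\<dots> \<le> len R powr (p/2 - 1) * (D * K1 * m)" using P by (intro mult_left_mono) auto
          finally have "(m powr (p/2)) powr (2/p) \<le> (len R powr (p/2 - 1) * (D * K1 * m)) powr (2/p)"
            using p by (intro powr_mono2) auto
          moreover have "(m powr (p/2)) powr (2/p) = m" using m0 p by (simp add: powr_powr)
          moreover have "(len R powr (p/2 - 1) * (D * K1 * m)) powr (2/p) = (D * K1) powr (2/p) * len R powr (1 - 2/p) * m powr (2/p)"
          proof -
            have "(p/2 - 1) * (2/p) = 1 - 2/p" using p by (simp add: field_simps)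
            moreover have "K1 \<ge> 0" by (simp add: K1_def)
            ultimately show ?thesis using m0 D(1) lR by (simp add: powr_mult powr_powr)
          qed
          ultimately have "m \<le> (D * K1) powr (2/p) * len R powr (1 / (1 / (1 - 2/p))) * m powr (1 / (p/2))" by simp
          \<comment> \<open>The powers of |R| and m have exponents 1 - 2/p and 2/p, so absorption
            applies with the conjugate pair 1/(1 - 2/p) and p/2.\<close>
          then have "m \<le> ((D * K1) powr (2/p)) powr (1 / (1 - 2/p)) * len R"
          proof (rule self_improve[where q' = "p/2"])
            show "1 < 1 / (1 - 2/p)" using True by (simp add: field_simps)
          qed (use m0 lR p in auto)
          also have "\<dots> \<le> M' * len R" using lR by (intro mult_right_mono) (auto simp: M'_def)
          finally show ?thesis using m_eq by simp
        next
          case False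
          then have p2: "p < 2" using p(2) by simp
          \<comment> \<open>For p < 2 the roles are exchanged: the lower Carleson estimate and
            boundedness of the inverse bound m by a multiple of P, and Hoelder's inequality on R
            bounds P by |R|^(1-p/2) m^(p/2).\<close>
          have "m \<le> K2 * Lp_pow N p f"
            unfolding \<alpha>m[symmetric] f_def K2_def using E EN M p p' by (intro carleson_Lp_lower) (auto simp: \<alpha>_def)
          also have "Lp_pow N p f \<le> D' * P"
          proof -
            have "Lp_pow N p (hsum p \<sigma> (\<lambda>_. 1) (\<lambda>K. \<alpha> (\<sigma> K)) (\<tau> ` E)) \<le> D' * Lp_pow N p (hsum p id (\<lambda>_. 1) (\<lambda>K. \<alpha> (\<sigma> K)) (\<tau> ` E))"
              using E \<tau>D lev \<sigma>\<tau> by (intro D'(2)) (auto simp: subset_iff)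
            moreover have "hsum p \<sigma> (\<lambda>_. 1) (\<lambda>K. \<alpha> (\<sigma> K)) (\<tau> ` E) = f"
              unfolding f_def hsum_def using E(3) \<sigma>\<tau> by (intro ext) (simp add: sum.reindex[OF injE] subset_iff)
            moreover have "hsum p id (\<lambda>_. 1) (\<lambda>K. \<alpha> (\<sigma> K)) (\<tau> ` E) = s"
              unfolding s_eq hsum_def using E(3) \<sigma>\<tau> by (intro ext) (simp add: sum.reindex[OF injE] subset_iff)
            ultimately show ?thesis by (simp add: P_def)
          qed
          then have "K2 * Lp_pow N p f \<le> K2 * (D' * P)" by (intro mult_left_mono) (auto simp: K2_def)
          finally have m1: "m \<le> K2 * D' * P" by simp
          have "P powr (2/p) \<le> len R powr (2/p - 1) * m"
            using jen[of "2/p" "\<lambda>t. \<bar>s t\<bar> powr p"] p p2 unfolding mR PR by (simp add: powr_powr field_simps del: powr_numeral)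
          then have "(P powr (2/p)) powr (p/2) \<le> (len R powr (2/p - 1) * m) powr (p/2)" using p by (intro powr_mono2) auto
          moreover have "(P powr (2/p)) powr (p/2) = P" using P0 p by (simp add: powr_powr)
          moreover have "(len R powr (2/p - 1) * m) powr (p/2) = len R powr (1 - p/2) * m powr (p/2)"
          proof -
            have "(2/p - 1) * (p/2) = 1 - p/2" using p by (simp add: field_simps)
            then have s2: "(len R powr (2/p - 1)) powr (p/2) = len R powr (1 - p/2)" by (simp only: powr_powr)
            have s1: "(len R powr (2/p - 1) * m) powr (p/2) = (len R powr (2/p - 1)) powr (p/2) * m powr (p/2)"
              using m0 by (intro powr_mult)
            show ?thesis unfolding s1 s2 ..
          qed
          ultimately have "P \<le> len R powr (1 - p/2) * m powr (p/2)" by simp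
          then have "K2 * D' * P \<le> K2 * D' * (len R powr (1 - p/2) * m powr (p/2))"
            using D'(1) by (intro mult_left_mono) (auto simp: K2_def)
          then have "m \<le> (K2 * D') * len R powr (1 / (1 / (1 - p/2))) * m powr (1 / (2/p))" using m1 by simp
          then have "m \<le> (K2 * D') powr (1 / (1 - p/2)) * len R"
          proof (rule self_improve[where q' = "2/p"])
            show "1 < 1 / (1 - p/2)" using p p2 by (simp add: field_simps)
          qed (use m0 lR p D'(1) in \<open>auto simp: K2_def\<close>)
          also have "\<dots> \<le> M' * len R" using lR by (intro mult_right_mono) (auto simp: M'_def)
          finally show ?thesis using m_eq by simp
        qed
      qed
      then show ?thesis unfolding carleson_def using Cf \<tau>D by auto
    qed
    then show ?thesis by (intro exI[of _ M']) (auto simp: M'_def)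
  qed
  then show ?thesis unfolding preserves_carleson_def by blast
qed

section \<open>Unconditionality of the Haar system\<close>

text \<open>
  The Haar functions, enumerated along the heap order of the dyadic tree, form a martingale difference
  sequence of a filtration that refines only one atom per step. It is realised on the dyadic filtration
  by letting the \<open>v\<close>-th binary digit of \<open>t\<close> decide the step from the node \<open>v\<close>; \<open>node m t\<close> is the node
  reached after \<open>m\<close> steps from the root \<open>1\<close>, and \<open>pos N t\<close> the left endpoint of the interval reached.
\<close>

primrec node :: "nat \<Rightarrow> real \<Rightarrow> nat" where
  "node 0 t = 1"
| "node (Suc m) t = 2 * node m t + (if odd \<lfloor>2 ^ node m t * t\<rfloor> then 1 else 0)"

definition pos :: "nat \<Rightarrow> real \<Rightarrow> real" where
  "pos N t = (real (node N t) - 2 ^ N) / 2 ^ N"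

text \<open>The unit interval has number 1, and the halves of the interval with number v have
  numbers 2v and 2v + 1, as in the recursion of \<open>node\<close>. Any point of I gives the same
  value, since the integer part is constant on I.\<close>

definition heap_index :: "real set \<Rightarrow> nat" where
  "heap_index I = 2 ^ lev I + nat \<lfloor>2 ^ lev I * (SOME x. x \<in> I)\<rfloor>"

lemma node_bounds: "2 ^ m \<le> node m t" "node m t < 2 ^ Suc m"
  by (induction m) auto

lemma node_pos: "node m t > 0"
  using node_bounds(1)[of m t] by (metis gr0I less_le_trans zero_less_numeral zero_less_power not_le)

lemma node_less: "i < m \<Longrightarrow> node i t < node m t"
proof (induction m)
  case (Suc m)
  have "node m t < node (Suc m) t" using node_pos[of m t] by simp
  then show ?case using Suc less_Suc_eq by (metis less_trans)
qed simp

text \<open>The nodes visited before v have smaller numbers, and each step reads the digit numbered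
  by its node. Reaching v thus depends only on the first v - 1 digits of t: the walk is
  predictable.\<close>

lemma node_cong: "t' \<in> cell (node m t - 1) t \<Longrightarrow> node m t' = node m t"
proof (induction m)
  case (Suc m)
  have "node m t \<le> node (Suc m) t - 1" using node_less[of m "Suc m" t] by simp
  then have t': "t' \<in> cell (node m t) t" using Suc.prems cell_mono by blast
  then have "t' \<in> cell (node m t - 1) t" using cell_mono[of "node m t - 1" "node m t"] by auto
  then have "node m t' = node m t" by (rule Suc.IH)
  moreover have "\<lfloor>2 ^ node m t * t'\<rfloor> = \<lfloor>2 ^ node m t * t\<rfloor>" using t' by (simp add: cell_def)
  ultimately show ?case by simp
qed simp

lemma node_div: "node m t = node (m + i) t div 2 ^ i"
proof (induction i)
  case (Suc i)
  have "node (m + Suc i) t div 2 ^ Suc i = node (m + Suc i) t div 2 div 2 ^ i" by (simp add: div_mult2_eq)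
  also have "node (m + Suc i) t div 2 = node (m + i) t" by simp
  finally show ?case using Suc by simp
qed simp

lemma floor_pos:
  assumes "m \<le> N"
  shows "\<lfloor>2 ^ m * pos N t\<rfloor> = int (node m t) - 2 ^ m"
proof -
  obtain i where i: "N = m + i" using assms le_Suc_ex by blast
  have "2 ^ m * pos N t = real (node N t) / real (2 ^ i) - of_int (2 ^ m)"
    by (simp add: pos_def i power_add field_simps)
  then have "\<lfloor>2 ^ m * pos N t\<rfloor> = \<lfloor>real (node N t) / real (2 ^ i)\<rfloor> - 2 ^ m" by (simp only: floor_diff_of_int)
  also have "\<lfloor>real (node N t) / real (2 ^ i)\<rfloor> = int (node m t)"
    unfolding floor_divide_of_nat_eq using node_div[of m t i] i by simp
  finally show ?thesis .
qed

lemma pos_in_grid: "pos N t \<in> grid N"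
proof -
  have "node N t = 2 ^ N + (node N t - 2 ^ N)" using node_bounds(1) by simp
  then have "pos N t = real (node N t - 2 ^ N) / 2 ^ N"
    unfolding pos_def by (metis add_diff_cancel_left' of_nat_add of_nat_numeral of_nat_power)
  moreover have "node N t - 2 ^ N < 2 ^ N" using node_bounds(2)[of N t] by simp
  ultimately show ?thesis unfolding grid_def by blast
qed

section \<open>The walk and the dyadic tree\<close>

lemma heap_index_eq:
  assumes "I \<in> dyadic" "x \<in> I"
  shows "heap_index I = 2 ^ lev I + nat \<lfloor>2 ^ lev I * x\<rfloor>"
proof -
  have "(SOME x. x \<in> I) \<in> I" using assms(2) by (rule someI)
  then have "(SOME x. x \<in> I) \<in> cell (lev I) x" using dyadic_cell[OF assms] by blast
  then show ?thesis by (simp add: heap_index_def cell_def)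
qed

lemma heap_index_bounds:
  assumes "I \<in> dyadic"
  shows "2 ^ lev I \<le> heap_index I" "heap_index I < 2 ^ Suc (lev I)"
proof -
  obtain x where x: "x \<in> I" using dyadic_nonempty assms by blast
  then have "x \<in> {0..<1}" using dyadic_subset_unit assms by blast
  then have "nat \<lfloor>2 ^ lev I * x\<rfloor> < 2 ^ lev I" using floor_unit_bounds[of x "lev I"] by (simp add: nat_less_iff)
  then show "2 ^ lev I \<le> heap_index I" "heap_index I < 2 ^ Suc (lev I)" unfolding heap_index_eq[OF assms x] by auto
qed

lemma power2_bracket_unique:
  fixes v :: nat
  assumes "2 ^ m \<le> v" "v < 2 ^ Suc m" "2 ^ l \<le> v" "v < 2 ^ Suc l"
  shows "m = l"
proof -
  have "(2::nat) ^ m < 2 ^ Suc l" "(2::nat) ^ l < 2 ^ Suc m" using assms by linarith+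
  then have "m < Suc l" "l < Suc m" by (metis one_less_numeral_iff power_less_imp_less_exp semiring_norm(76))+
  then show ?thesis by simp
qed

text \<open>The first m binary digits of \<open>pos N t\<close> spell the node visited after m
  steps, so visiting the number of I and ending inside I are the same event.\<close>

lemma heap_index_node:
  assumes I: "I \<in> dyadic" "lev I < N" and m: "m < N"
  shows "node m t = heap_index I \<longleftrightarrow> m = lev I \<and> pos N t \<in> I"
proof
  have xU: "pos N t \<in> {0..<1}" using pos_in_grid grid_unit by blast
  have fl: "nat \<lfloor>2 ^ m * pos N t\<rfloor> = node m t - 2 ^ m" using floor_pos[of m N t] m by (simp add: nat_diff_distrib' nat_power_eq)
  { assume e: "node m t = heap_index I"
    have ml: "m = lev I"
      using power2_bracket_unique[OF node_bounds[of m t]] heap_index_bounds[OF I(1)] e by simp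
    obtain s where s: "s \<in> I" using dyadic_nonempty I by blast
    then have sU: "s \<in> {0..<1}" using dyadic_subset_unit I by blast
    have "nat \<lfloor>2 ^ m * s\<rfloor> = nat \<lfloor>2 ^ m * pos N t\<rfloor>" using heap_index_eq[OF I(1) s] e fl ml by simp
    then have "\<lfloor>2 ^ m * s\<rfloor> = \<lfloor>2 ^ m * pos N t\<rfloor>"
      by (rule iffD1[OF eq_nat_nat_iff[OF floor_unit_bounds(1)[OF sU] floor_unit_bounds(1)[OF xU]]])
    then have "pos N t \<in> cell (lev I) s" using ml by (simp add: cell_def)
    then show "m = lev I \<and> pos N t \<in> I" using dyadic_cell[OF I(1) s] ml by simp }
  { assume "m = lev I \<and> pos N t \<in> I"
    then show "node m t = heap_index I" using heap_index_eq[OF I(1), of "pos N t"] fl node_bounds(1)[of m t] by simp }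
qed

lemma heap_index_inj: "inj_on heap_index dyadic"
proof (rule inj_onI)
  fix I J assume H: "I \<in> dyadic" "J \<in> dyadic" "heap_index I = heap_index J"
  obtain x y where xy: "x \<in> I" "y \<in> J" using dyadic_nonempty H by blast
  then have U: "x \<in> {0..<1}" "y \<in> {0..<1}" using dyadic_subset_unit H by blast+
  have l: "lev I = lev J"
    using power2_bracket_unique[OF heap_index_bounds[OF H(1)]] heap_index_bounds[OF H(2)] H(3) by simp
  then have "nat \<lfloor>2 ^ lev I * x\<rfloor> = nat \<lfloor>2 ^ lev I * y\<rfloor>" using heap_index_eq H xy by simp
  then have "\<lfloor>2 ^ lev I * x\<rfloor> = \<lfloor>2 ^ lev I * y\<rfloor>"
    by (rule iffD1[OF eq_nat_nat_iff[OF floor_unit_bounds(1)[OF U(1)] floor_unit_bounds(1)[OF U(2)]]])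
  then have "cell (lev I) x = cell (lev J) y" using l by (simp add: cell_def)
  then show "I = J" using dyadic_cell H xy by metis
qed

text \<open>The half of I in which the walk ends is decided at the node of I, hence by the digit of
  t numbered by I.\<close>

lemma haar_pos:
  assumes I: "I \<in> dyadic" "lev I < N" "pos N t \<in> I"
  shows "haar I (pos N t) = (if odd \<lfloor>2 ^ heap_index I * t\<rfloor> then -1 else 1)"
proof -
  have n: "node (lev I) t = heap_index I" using heap_index_node[OF I(1,2), of "lev I" t] I by blast
  have "\<lfloor>2 ^ Suc (lev I) * pos N t\<rfloor> = int (node (Suc (lev I)) t) - 2 ^ Suc (lev I)" using I(2) by (intro floor_pos) simp
  then have "odd \<lfloor>2 ^ Suc (lev I) * pos N t\<rfloor> \<longleftrightarrow> odd \<lfloor>2 ^ heap_index I * t\<rfloor>" using n by simp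
  then show ?thesis using I(3) by (auto simp: haar_eq[OF I(1)] lft_def rgt_def)
qed

lemma haar_level:
  assumes "J \<in> dyadic_level k" "t \<in> J"
  shows "haar J t = (if odd \<lfloor>2 ^ Suc k * t\<rfloor> then -1 else 1)"
  using assms by (auto simp: dyadic_iff_lev haar_eq lft_def rgt_def)

section \<open>Predictable coin tosses\<close>

definition active :: "nat \<Rightarrow> nat \<Rightarrow> real \<Rightarrow> bool" where
  "active N k t \<longleftrightarrow> (\<exists>m<N. node m t = k)"

definition coin :: "nat \<Rightarrow> real \<Rightarrow> real" where
  "coin k t = (if odd \<lfloor>2 ^ k * t\<rfloor> then -1 else 1)"

text \<open>Predictability in the form used for martingale differences: whether the k-th digit is
  read is known from the first k - 1 digits.\<close>

lemma active_cong: "t' \<in> cell (k - 1) t \<Longrightarrow> active N k t \<longleftrightarrow> active N k t'"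
proof -
  have "active N k t'" if "t' \<in> cell (k - 1) t" "active N k t" for t t'
    using that node_cong unfolding active_def by blast
  moreover assume "t' \<in> cell (k - 1) t"
  moreover have "t \<in> cell (k - 1) t'" using calculation(2) by (simp add: cell_def)
  ultimately show ?thesis by blast
qed

lemma coin_haar:
  assumes "J \<in> dyadic_level (k - 1)" "t \<in> J" "k \<ge> 1"
  shows "coin k t = haar J t"
  using haar_level[OF assms(1,2)] assms(3) by (simp add: coin_def)

lemma level_partition: "\<Union>(dyadic_level k) = {0..<1}"
  using cell_in_level cell_refl level_subset_unit by blast

lemma level_disjoint: "I \<in> dyadic_level k \<Longrightarrow> J \<in> dyadic_level k \<Longrightarrow> I \<noteq> J \<Longrightarrow> I \<inter> J = {}"
  using level_eq_cell by blast

lemma isum_coin: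
  assumes k: "k \<ge> 1" "k \<le> n" and A: "\<And>t t'. t' \<in> cell (k - 1) t \<Longrightarrow> A t = A t'"
  shows "isum n UNIV (\<lambda>t. A t * coin k t) = 0"
proof -
  have "isum n UNIV (\<lambda>t. A t * coin k t) = isum n (\<Union>(dyadic_level (k - 1))) (\<lambda>t. A t * coin k t)"
    unfolding level_partition isum_def using grid_unit by (simp add: Int_absorb2)
  also have "\<dots> = (\<Sum>J\<in>dyadic_level (k - 1). isum n J (\<lambda>t. A t * coin k t))"
    using k by (intro disjoint_sum_isum[symmetric] level_disjoint) (auto simp: dyadic_upto_def dyadic_iff_lev)
  also have "\<dots> = 0"
  proof (rule sum.neutral, rule ballI)
    fix J assume J: "J \<in> dyadic_level (k - 1)"
    then have JD: "J \<in> dyadic" "lev J < n" using k by (auto simp: dyadic_iff_lev)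
    obtain s where s: "s \<in> J" using dyadic_nonempty JD by blast
    have "A t * coin k t = A s * haar J t" if "t \<in> J" for t
    proof -
      have "t \<in> cell (k - 1) s" using level_eq_cell[OF J s] that by simp
      then show ?thesis using A[of t s] coin_haar[OF J that k(1)] by simp
    qed
    then have "isum n J (\<lambda>t. A t * coin k t) = isum n J (\<lambda>t. A s * haar J t)" by (simp add: isum_def)
    then show "isum n J (\<lambda>t. A t * coin k t) = 0" using isum_haar[OF JD] by (simp add: isum_cmult)
  qed
  finally show ?thesis .
qed

text \<open>The indicator of visiting a child is half the indicator of visiting its parent, plus or
  minus half of that indicator times the coin of the parent; the last term has mean zero by
  predictability. Level 2^N is fine enough for every digit read within N steps.\<close>

lemma node_uniform:
  assumes "2 ^ m \<le> v" "v < 2 ^ Suc m" "m \<le> N"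
  shows "isum (2 ^ N) UNIV (\<lambda>t. of_bool (node m t = v)) = 1 / 2 ^ m"
  using assms
proof (induction m arbitrary: v)
  case 0
  then have "v = 1" by simp
  then show ?case using isum_restrict[of UNIV "{0..<1}" "\<lambda>_. 1" "2 ^ N"] isum_1[OF unit_dyadic(1), of "2 ^ N"] unit_dyadic grid_unit
    by (simp add: isum_def Int_absorb2)
next
  case (Suc m)
  define w where "w = v div 2"
  have w: "2 ^ m \<le> w" "w < 2 ^ Suc m" "m \<le> N" using Suc.prems by (auto simp: w_def)
  have w1: "w \<ge> 1" using w(1) by (metis le_trans one_le_numeral one_le_power)
  have "(2::nat) ^ Suc m \<le> 2 ^ N" using Suc.prems by (intro power_increasing) auto
  then have wN: "w \<le> 2 ^ N" using w by linarith
  define \<epsilon> :: real where "\<epsilon> = (if odd v then -1 else 1)"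
  have "of_bool (node (Suc m) t = v) = 1 / 2 * (of_bool (node m t = w) + \<epsilon> * (of_bool (node m t = w) * coin w t))" for t
  proof -
    have v: "v = 2 * w + (if odd v then 1 else 0)" by (auto simp: w_def)
    have "node (Suc m) t = v \<longleftrightarrow> node m t = w \<and> (odd \<lfloor>2 ^ w * t\<rfloor> \<longleftrightarrow> odd v)"
    proof -
      define o1 where "o1 = odd \<lfloor>2 ^ node m t * t\<rfloor>"
      have gen: "(2 * a + of_bool x = 2 * w + of_bool y) \<longleftrightarrow> a = w \<and> (x \<longleftrightarrow> y)" for a :: nat and x y
        by (cases x; cases y; auto; presburger)
      have e1: "node (Suc m) t = 2 * node m t + of_bool o1" by (simp add: o1_def)
      define ov where "ov = odd v"
      have e2: "v = 2 * w + of_bool ov" using v by (auto simp: ov_def)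
      have "node (Suc m) t = v \<longleftrightarrow> 2 * node m t + of_bool o1 = 2 * w + of_bool ov" using e1 e2 by argo
      also have "\<dots> \<longleftrightarrow> node m t = w \<and> (o1 \<longleftrightarrow> ov)" by (rule gen)
      finally show ?thesis unfolding o1_def ov_def by (cases "node m t = w") simp_all
    qed
    then show ?thesis by (auto simp: coin_def \<epsilon>_def)
  qed
  then have "isum (2 ^ N) UNIV (\<lambda>t. of_bool (node (Suc m) t = v))
      = 1 / 2 * (isum (2 ^ N) UNIV (\<lambda>t. of_bool (node m t = w)) + \<epsilon> * isum (2 ^ N) UNIV (\<lambda>t. of_bool (node m t = w) * coin w t))"
    by (simp add: isum_def sum.distrib sum_distrib_left[symmetric] sum_divide_distrib[symmetric] add_divide_distrib)
  also have "isum (2 ^ N) UNIV (\<lambda>t. of_bool (node m t = w) * coin w t) = 0"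
  proof (rule isum_coin[OF w1 wN])
    fix t t' :: real assume H: "t' \<in> cell (w - 1) t"
    then have H': "t \<in> cell (w - 1) t'" by (simp add: cell_def)
    have "node m t' = w" if "node m t = w" using node_cong[of t' m t] H unfolding that .
    moreover have "node m t = w" if "node m t' = w" using node_cong[of t m t'] H' unfolding that .
    ultimately have "node m t = w \<longleftrightarrow> node m t' = w" by blast
    then show "of_bool (node m t = w) = (of_bool (node m t' = w) :: real)" by (rule arg_cong)
  qed
  finally show ?case using Suc.IH[OF w] by simp
qed

text \<open>Uniformity after N steps says that \<open>pos N\<close> carries the uniform measure of
  the fine grid to that of the grid of level N, which transfers all norms.\<close>

lemma isum_pos: "isum (2 ^ N) UNIV (\<lambda>t. G (pos N t)) = isum N UNIV G"
proof -
  have "G (pos N t) = (\<Sum>x\<in>grid N. G x * of_bool (pos N t = x))" for t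
    using pos_in_grid by simp
  then have "isum (2 ^ N) UNIV (\<lambda>t. G (pos N t)) = (\<Sum>x\<in>grid N. G x * isum (2 ^ N) UNIV (\<lambda>t. of_bool (pos N t = x)))"
    by (simp only: isum_cmult[symmetric] isum_sum[symmetric])
  also have "\<dots> = (\<Sum>x\<in>grid N. G x * (1 / 2 ^ N))"
  proof (intro sum.cong refl)
    fix x assume "x \<in> grid N"
    then obtain j :: nat where j: "j < 2 ^ N" "x = real j / 2 ^ N" by (auto simp: grid_def)
    have "pos N t = x \<longleftrightarrow> node N t = 2 ^ N + j" for t
    proof -
      have "pos N t = x \<longleftrightarrow> real (node N t) = real (2 ^ N + j)" by (auto simp: pos_def j)
      then show ?thesis by (simp only: of_nat_eq_iff)
    qed
    then show "G x * isum (2 ^ N) UNIV (\<lambda>t. of_bool (pos N t = x)) = G x * (1 / 2 ^ N)"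
      using node_uniform[of N "2 ^ N + j" N] j by simp
  qed
  finally show ?thesis by (simp add: isum_def sum_divide_distrib)
qed

section \<open>Measurability and conditional expectations on dyadic levels\<close>

lemma stepfun_measurable:
  fixes f :: "real \<Rightarrow> 'a::topological_space"
  assumes "stepfun k f"
  shows "f \<in> borel_measurable (dyadic_filtration k)"
proof (rule measurableI)
  have sp: "dyadic_level k \<subseteq> Pow {0..<1}" using level_subset_unit by blast
  fix A :: "'a set"
  have "f -` A \<inter> space (dyadic_filtration k) = \<Union>{J\<in>dyadic_level k. J \<subseteq> f -` A}"
  proof (intro equalityI subsetI)
    fix t assume "t \<in> f -` A \<inter> space (dyadic_filtration k)"
    then have t: "t \<in> {0..<1}" "f t \<in> A" using sp by (auto simp: dyadic_filtration_def space_measure_of_conv)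
    have "cell k t \<subseteq> f -` A"
    proof
      fix s assume "s \<in> cell k t"
      then have "f s = f t" using assms t(1) unfolding stepfun_def by blast
      then show "s \<in> f -` A" using t(2) by simp
    qed
    then show "t \<in> \<Union>{J\<in>dyadic_level k. J \<subseteq> f -` A}" using cell_in_level[OF t(1)] cell_refl by blast
  next
    fix t assume "t \<in> \<Union>{J\<in>dyadic_level k. J \<subseteq> f -` A}"
    then have "t \<in> f -` A" "t \<in> {0..<1}" using level_subset_unit by blast+
    then show "t \<in> f -` A \<inter> space (dyadic_filtration k)"
      by (simp add: dyadic_filtration_def space_measure_of_conv)
  qed
  moreover have "\<Union>{J\<in>dyadic_level k. J \<subseteq> f -` A} \<in> sets (dyadic_filtration k)"
    using sp by (intro sets.finite_Union) (auto simp: dyadic_filtration_def)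
  ultimately show "f -` A \<inter> space (dyadic_filtration k) \<in> sets (dyadic_filtration k)" by simp
qed simp

text \<open>The intervals of a level partition [0,1), so their unions already form a
  sigma-algebra.\<close>

lemma sets_dyadic_filtration:
  assumes "A \<in> sets (dyadic_filtration k)"
  shows "\<exists>\<J>\<subseteq>dyadic_level k. A = \<Union>\<J>"
proof -
  have sp: "dyadic_level k \<subseteq> Pow {0..<1}" using level_subset_unit by blast
  have "A \<in> sigma_sets {0..<1} (dyadic_level k)" using assms sp by (simp add: dyadic_filtration_def sets_measure_of)
  then show ?thesis
  proof induction
    case (Basic a)
    then show ?case by (intro exI[of _ "{a}"]) auto
  next
    case Empty
    then show ?case by (intro exI[of _ "{}"]) auto
  next
    case (Compl a)
    then obtain \<J> where J: "\<J> \<subseteq> dyadic_level k" "a = \<Union>\<J>" by blast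
    have "{0..<1} - a = \<Union>(dyadic_level k - \<J>)"
      unfolding level_partition[of k, symmetric] J(2) using level_disjoint J(1) by blast
    then show ?case by blast
  next
    case (Union a)
    then obtain \<J> where J: "\<And>i. \<J> i \<subseteq> dyadic_level k" "\<And>i. a i = \<Union>(\<J> i)" by metis
    have "(\<Union>i. a i) = \<Union>(\<Union>i. \<J> i)" using J(2) by auto
    moreover have "(\<Union>i. \<J> i) \<subseteq> dyadic_level k" using J(1) by (rule UN_least)
    ultimately show ?case by (intro exI conjI)
  qed
qed

lemma has_integral_haar:
  fixes c :: "'a::banach"
  assumes J: "J \<in> dyadic"
  shows "((\<lambda>t. haar J t *\<^sub>R c) has_integral 0) J"
proof -
  have const: "((\<lambda>t. haar J t *\<^sub>R c) has_integral (v * len I) *\<^sub>R c) I"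
    if H: "I \<in> dyadic" "\<And>t. t \<in> I \<Longrightarrow> haar J t = v" for I v
  proof -
    obtain x where x: "x \<in> I" using dyadic_nonempty[OF H(1)] by blast
    have I: "I = cell (lev I) x" by (rule dyadic_cell[OF H(1) x])
    have "I \<in> sets lborel" "emeasure lborel I < \<infinity>" by (subst I, simp add: cell_interval divide_right_mono)+
    then have "((\<lambda>_. 1) has_integral len I) I" by (intro has_integral_measure_lborel) auto
    then have "((\<lambda>t. 1 *\<^sub>R (v *\<^sub>R c)) has_integral len I *\<^sub>R (v *\<^sub>R c)) I" by (rule has_integral_scaleR_left)
    then have "((\<lambda>t. haar J t *\<^sub>R c) has_integral len I *\<^sub>R (v *\<^sub>R c)) I"
      by (rule has_integral_eq[rotated]) (simp add: H(2))
    then show ?thesis by (simp add: mult.commute)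
  qed
  have "((\<lambda>t. haar J t *\<^sub>R c) has_integral ((1 * len (lft J)) *\<^sub>R c + ((-1) * len (rgt J)) *\<^sub>R c)) (lft J \<union> rgt J)"
    using children[OF J] by (intro has_integral_Un const) (auto simp: haar_eq[OF J])
  then show ?thesis using children(5)[OF J] len_children[OF J] by simp
qed

text \<open>A coefficient known from k - 1 digits times the coin of the k-th digit: on each interval
  of level k - 1 this is a constant multiple of its Haar function, which has integral zero.\<close>

lemma coin_martingale_difference:
  fixes bb :: "nat \<Rightarrow> 'a::banach" and N :: nat
  defines "d \<equiv> \<lambda>k t. (of_bool (active N k t) * coin k t) *\<^sub>R bb k"
  shows "martingale_difference n d"
  unfolding martingale_difference_def is_dyadic_cond_exp_def
proof (intro ballI conjI)
  fix k assume "k \<in> {1..n}"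
  then have k: "k \<ge> 1" by simp
  have "stepfun k (d k)"
    unfolding stepfun_def
  proof (intro allI impI)
    fix s t assume "s \<in> {0..<1::real}" "t \<in> cell k s"
    moreover have "t \<in> cell (k - 1) s" using calculation(2) cell_mono[of "k - 1" k s] by auto
    ultimately show "d k t = d k s" using active_cong[of t k s N] by (simp add: d_def coin_def cell_def)
  qed
  then show "d k \<in> borel_measurable (dyadic_filtration k)" by (rule stepfun_measurable)
  show "(\<lambda>_. 0 :: 'a) \<in> borel_measurable (dyadic_filtration (k - 1))" by simp
  fix A assume "A \<in> sets (dyadic_filtration (k - 1))"
  then obtain \<J> where J: "\<J> \<subseteq> dyadic_level (k - 1)" "A = \<Union>\<J>" using sets_dyadic_filtration by blast
  show "(\<lambda>_. 0 :: 'a) integrable_on A" by (rule integrable_0)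
  have "(d k has_integral (\<Sum>I\<in>\<J>. 0)) (\<Union>\<J>)"
  proof (rule has_integral_Union)
    show "finite \<J>" using J(1) finite_level finite_subset by blast
    show "(d k has_integral 0) I" if "I \<in> \<J>" for I
    proof -
      have I: "I \<in> dyadic_level (k - 1)" "I \<in> dyadic" using that J(1) dyadic_iff_lev by blast+
      obtain s where s: "s \<in> I" using dyadic_nonempty I(2) by blast
      have "((\<lambda>t. haar I t *\<^sub>R (of_bool (active N k s) *\<^sub>R bb k)) has_integral 0) I" using I(2) by (rule has_integral_haar)
      then show ?thesis
      proof (rule has_integral_eq[rotated])
        fix t assume t: "t \<in> I"
        then have "t \<in> cell (k - 1) s" using level_eq_cell[OF I(1) s] by simp
        then show "haar I t *\<^sub>R (of_bool (active N k s) *\<^sub>R bb k) = d k t"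
          using active_cong[of t k s N] coin_haar[OF I(1) t k] by (simp add: d_def)
      qed
    qed
    show "pairwise (\<lambda>S S'. negligible (S \<inter> S')) \<J>"
      unfolding pairwise_def using level_disjoint J(1) by (metis negligible_empty subsetD)
  qed
  then show "(d k has_integral integral A (\<lambda>_. 0)) A" using J(2) by simp
qed

text \<open>UMD offers one multiplier per level, whereas unconditionality demands one per interval.
  Along the walk the k-th difference comes from the single interval with heap number k, so the
  multiplier of the level becomes that of the interval.\<close>

theorem UMD_haar_bdd:
  assumes "UMD_space TYPE('a::banach)"
  shows "\<exists>p>1. haar_bdd TYPE('a) p id"
proof -
  obtain p c where p: "p > 1" and c: "c > 0" and umd: "\<And>n (d :: nat \<Rightarrow> real \<Rightarrow> 'a) \<theta>. n \<ge> 1 \<Longrightarrow> martingale_difference n d \<Longrightarrow>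
      (\<forall>k\<in>{1..n}. \<theta> k \<in> {-1..1}) \<Longrightarrow>
      Lp_norm p (\<lambda>t. \<Sum>k=1..n. \<theta> k *\<^sub>R d k t) \<le> c * Lp_norm p (\<lambda>t. \<Sum>k=1..n. d k t)"
    using assms unfolding UMD_space_def by blast
  have "Lp_pow N p (hsum p id \<theta> a F) \<le> c powr p * Lp_pow N p (hsum p id (\<lambda>_. 1) a F)"
    if F: "F \<subseteq> dyadic" "\<forall>I\<in>F. lev I < N \<and> lev (id I) < N" and \<theta>: "\<forall>I. \<bar>\<theta> I\<bar> \<le> 1"
    for N F \<theta> and a :: "real set \<Rightarrow> 'a"
  proof -
    \<comment> \<open>Heap numbers of intervals of level below N stay below 2^N.\<close>
    define n :: nat where "n = 2 ^ N"
    have Ff: "finite F"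
      by (rule finite_subset[OF _ finite_haar_upto[of N]]) (use F in \<open>auto simp: haar_upto_def\<close>)
    define b where "b = (\<lambda>I. (1 / len I powr (1/p)) *\<^sub>R a I)"
    define ih where "ih = inv_into F heap_index"
    have injF: "inj_on heap_index F" using heap_index_inj F(1) by (rule inj_on_subset)
    have ih: "ih (heap_index I) = I" if "I \<in> F" for I using injF that by (simp add: ih_def)
    define bb where "bb = (\<lambda>k. if k \<in> heap_index ` F then b (ih k) else 0)"
    define d where "d = (\<lambda>k t. (of_bool (active N k t) * coin k t) *\<^sub>R bb k)"
    have md: "martingale_difference n d" unfolding d_def by (rule coin_martingale_difference)
    have hF: "heap_index ` F \<subseteq> {1..n}"
    proof
      fix k assume "k \<in> heap_index ` F"
      then obtain I where I: "I \<in> F" "k = heap_index I" by blast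
      have "lev I < N" "I \<in> dyadic" using F I by auto
      then have "(2::nat) ^ Suc (lev I) \<le> 2 ^ N" by (intro power_increasing) auto
      then show "k \<in> {1..n}" using heap_index_bounds[OF \<open>I \<in> dyadic\<close>] I(2) by (simp add: n_def)
    qed
    have step: "(of_bool (active N (heap_index I) t) * coin (heap_index I) t) *\<^sub>R b I = haar I (pos N t) *\<^sub>R b I"
      if "I \<in> F" for I t
    proof -
      have I: "I \<in> dyadic" "lev I < N" using F that by auto
      have act: "active N (heap_index I) t \<longleftrightarrow> pos N t \<in> I"
        unfolding active_def using heap_index_node[OF I] I(2) by blast
      show ?thesis
      proof (cases "pos N t \<in> I")
        case True
        then show ?thesis using act haar_pos[OF I True] by (simp add: coin_def)
      next
        case False
        then show ?thesis using act by (simp add: haar_outside)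
      qed
    qed
    have sum_eq: "(\<Sum>k=1..n. \<psi> (ih k) *\<^sub>R d k t) = hsum p id \<psi> a F (pos N t)" for \<psi> t
    proof -
      have "(\<Sum>k=1..n. \<psi> (ih k) *\<^sub>R d k t) = (\<Sum>k\<in>heap_index ` F. \<psi> (ih k) *\<^sub>R d k t)"
        using hF by (intro sum.mono_neutral_right) (auto simp: d_def bb_def)
      also have "\<dots> = (\<Sum>I\<in>F. \<psi> I *\<^sub>R (haar I (pos N t) *\<^sub>R b I))"
      proof (subst sum.reindex[OF injF], rule sum.cong[OF refl])
        fix I assume I: "I \<in> F"
        then have "bb (heap_index I) = b I" using ih by (simp add: bb_def)
        then show "((\<lambda>k. \<psi> (ih k) *\<^sub>R d k t) \<circ> heap_index) I = \<psi> I *\<^sub>R (haar I (pos N t) *\<^sub>R b I)"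
          using step[OF I] ih[OF I] by (simp add: d_def)
      qed
      finally show ?thesis by (simp add: hsum_def b_def)
    qed
    have norm_eq: "Lp_norm p (\<lambda>t. \<Sum>k=1..n. \<psi> (ih k) *\<^sub>R d k t) = (Lp_pow N p (hsum p id \<psi> a F)) powr (1/p)" for \<psi>
    proof -
      have "stepfun n (\<lambda>t. \<Sum>k=1..n. \<psi> (ih k) *\<^sub>R d k t)"
        unfolding stepfun_def
      proof (intro allI impI sum.cong refl)
        fix s t :: real and k assume H: "s \<in> {0..<1}" "t \<in> cell n s" "k \<in> {1..n}"
        have "k - 1 \<le> n" "k \<le> n" using H(3) by auto
        then have "t \<in> cell (k - 1) s" "t \<in> cell k s" using H(2) cell_mono by blast+
        then show "\<psi> (ih k) *\<^sub>R d k t = \<psi> (ih k) *\<^sub>R d k s" using active_cong[of t k s N] by (simp add: d_def coin_def cell_def)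
      qed
      then have "Lp_norm p (\<lambda>t. \<Sum>k=1..n. \<psi> (ih k) *\<^sub>R d k t)
          = (isum n UNIV (\<lambda>t. norm (hsum p id \<psi> a F (pos N t)) powr p)) powr (1/p)"
        by (simp only: Lp_norm_stepfun sum_eq)
      then show ?thesis unfolding n_def by (simp add: isum_pos[where G = "\<lambda>x. norm (hsum p id \<psi> a F x) powr p"] Lp_pow_def)
    qed
    have "Lp_norm p (\<lambda>t. \<Sum>k=1..n. \<theta> (ih k) *\<^sub>R d k t) \<le> c * Lp_norm p (\<lambda>t. \<Sum>k=1..n. d k t)"
      using \<theta> by (intro umd md) (auto simp: n_def abs_le_iff minus_le_iff)
    then have "(Lp_pow N p (hsum p id \<theta> a F)) powr (1/p) \<le> c * (Lp_pow N p (hsum p id (\<lambda>_. 1) a F)) powr (1/p)"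
      using norm_eq[of \<theta>] norm_eq[of "\<lambda>_. 1"] by simp
    then have "((Lp_pow N p (hsum p id \<theta> a F)) powr (1/p)) powr p \<le> (c * (Lp_pow N p (hsum p id (\<lambda>_. 1) a F)) powr (1/p)) powr p"
      using p by (intro powr_mono2) auto
    then show ?thesis using p c by (simp add: powr_mult powr_powr)
  qed
  then show ?thesis using p c unfolding haar_bdd_def by (intro exI[of _ p] conjI exI[of _ "c powr p"]) auto
qed

section \<open>Extrapolation of rearrangement operators\<close>

text \<open>Applying \<open>inv_into\<close> twice returns \<tau> on dyadic intervals only. This and
  the next two lemmas make the values elsewhere harmless.\<close>

lemma haar_bdd_cong: "(\<And>J. J \<in> dyadic \<Longrightarrow> \<tau> J = \<tau>' J) \<Longrightarrow> haar_bdd TYPE('a::real_normed_vector) p \<tau> \<Longrightarrow> haar_bdd TYPE('a) p \<tau>'"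
proof -
  assume eq: "\<And>J. J \<in> dyadic \<Longrightarrow> \<tau> J = \<tau>' J" and b: "haar_bdd TYPE('a) p \<tau>"
  have h: "hsum p \<tau> \<theta> a F = hsum p \<tau>' \<theta> a F" if "F \<subseteq> dyadic" for \<theta> F and a :: "real set \<Rightarrow> 'a"
    unfolding hsum_def using eq that by (intro ext sum.cong refl) (metis subsetD)
  obtain D where D: "D \<ge> 0" "\<And>N F (a :: real set \<Rightarrow> 'a) \<theta>. F \<subseteq> dyadic \<Longrightarrow> (\<forall>I\<in>F. lev I < N \<and> lev (\<tau> I) < N) \<Longrightarrow>
     (\<forall>I. \<bar>\<theta> I\<bar> \<le> 1) \<Longrightarrow> Lp_pow N p (hsum p \<tau> \<theta> a F) \<le> D * Lp_pow N p (hsum p id (\<lambda>_. 1) a F)"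
    using b unfolding haar_bdd_def by blast
  have "Lp_pow N p (hsum p \<tau>' \<theta> a F) \<le> D * Lp_pow N p (hsum p id (\<lambda>_. 1) a F)"
    if H: "F \<subseteq> dyadic" "\<forall>I\<in>F. lev I < N \<and> lev (\<tau>' I) < N" "\<forall>I. \<bar>\<theta> I\<bar> \<le> 1" for N F \<theta> and a :: "real set \<Rightarrow> 'a"
  proof -
    have "\<forall>I\<in>F. lev I < N \<and> lev (\<tau> I) < N" using H(1,2) eq by (metis subsetD)
    from D(2)[OF H(1) this H(3), of a] show ?thesis by (simp add: h[OF H(1)])
  qed
  then show ?thesis unfolding haar_bdd_def using D(1) by blast
qed

lemma rearr_bdd_cong: "(\<And>J. J \<in> dyadic \<Longrightarrow> \<tau> J = \<tau>' J) \<Longrightarrow> rearr_bdd TYPE('a::real_normed_vector) p \<tau> \<Longrightarrow> rearr_bdd TYPE('a) p \<tau>'"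
proof -
  assume eq: "\<And>J. J \<in> dyadic \<Longrightarrow> \<tau> J = \<tau>' J" and b: "rearr_bdd TYPE('a) p \<tau>"
  have h: "hsum p \<tau> \<theta> a F = hsum p \<tau>' \<theta> a F" if "F \<subseteq> dyadic" for \<theta> F and a :: "real set \<Rightarrow> 'a"
    unfolding hsum_def using eq that by (intro ext sum.cong refl) (metis subsetD)
  obtain D where D: "D \<ge> 0" "\<And>N F (a :: real set \<Rightarrow> 'a). F \<subseteq> dyadic \<Longrightarrow> (\<forall>I\<in>F. lev I < N \<and> lev (\<tau> I) < N) \<Longrightarrow>
     Lp_pow N p (hsum p \<tau> (\<lambda>_. 1) a F) \<le> D * Lp_pow N p (hsum p id (\<lambda>_. 1) a F)"
    using b unfolding rearr_bdd_def by blast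
  have "Lp_pow N p (hsum p \<tau>' (\<lambda>_. 1) a F) \<le> D * Lp_pow N p (hsum p id (\<lambda>_. 1) a F)"
    if H: "F \<subseteq> dyadic" "\<forall>I\<in>F. lev I < N \<and> lev (\<tau>' I) < N" for N F and a :: "real set \<Rightarrow> 'a"
  proof -
    have "\<forall>I\<in>F. lev I < N \<and> lev (\<tau> I) < N" using H(1,2) eq by (metis subsetD)
    from D(2)[OF H(1) this, of a] show ?thesis by (simp add: h[OF H(1)])
  qed
  then show ?thesis unfolding rearr_bdd_def using D(1) by blast
qed

lemma preserves_carleson_cong:
  assumes "\<And>J. J \<in> dyadic \<Longrightarrow> \<tau> J = \<tau>' J" "preserves_carleson \<tau>"
  shows "preserves_carleson \<tau>'"
proof -
  have "\<tau> ` C = \<tau>' ` C" if "carleson M C" for M C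
    using assms(1) that by (intro image_cong) (auto simp: carleson_def)
  then show ?thesis using assms(2) unfolding preserves_carleson_def by metis
qed

lemma bij_inv_into:
  assumes "bij_betw \<tau> dyadic dyadic"
  shows "bij_betw (inv_into dyadic \<tau>) dyadic dyadic"
    and "J \<in> dyadic \<Longrightarrow> inv_into dyadic (inv_into dyadic \<tau>) J = \<tau> J"
  using bij_betw_inv_into[OF assms] inv_into_inv_into_eq[OF assms] by auto

text \<open>For q > p the operator is dualised to the inverse rearrangement on the dual space with
  exponent p', moved down to q' < p' there, and dualised back. On the way back vectors are tested by
  functionals, which norm the space by \<open>norming_functional\<close>.\<close>

theorem haar_bdd_extrapolate:
  assumes bij: "bij_betw \<tau> dyadic dyadic" and pt: "preserves_carleson \<tau>"
    and ps: "preserves_carleson (inv_into dyadic \<tau>)"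
    and p: "1 < p" and q: "1 < q" and bp: "haar_bdd TYPE('a::real_normed_vector) p \<tau>"
  shows "haar_bdd TYPE('a) q \<tau>"
proof -
  consider "q = p" | "q < p" | "p < q" by linarith
  then show ?thesis
  proof cases
    case 1
    then show ?thesis using bp by simp
  next
    case 2
    then show ?thesis using haar_bdd_extrapolate_down[OF bij pt ps q _ bp] by simp
  next
    case 3
    define \<sigma> where "\<sigma> = inv_into dyadic \<tau>"
    define p' q' where "p' = p / (p - 1)" and "q' = q / (q - 1)"
    have p': "1/p + 1/p' = 1" using p by (simp add: p'_def field_simps)
    have q': "q' > 1" "1/q' + 1/q = 1" using q by (auto simp: q'_def field_simps)
    have "1/p' < 1/q'" using p' q' p 3 by (simp add: frac_less2 algebra_simps) (smt (verit) frac_less2)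
    then have qp': "q' < p'" using p p' q' conj_exp_gt_1(1)[OF p p'] by (simp add: field_simps)
    have dual: "haar_bdd TYPE('a \<Rightarrow>\<^sub>L real) p' \<sigma>"
      unfolding \<sigma>_def
    proof (rule haar_bdd_dual[OF bounded_bilinear_blinfun_apply _ _ bij p p' bp])
      show "\<bar>blinfun_apply \<phi> y\<bar> \<le> norm \<phi> * norm y" for \<phi> :: "'a \<Rightarrow>\<^sub>L real" and y
        using norm_blinfun[of \<phi> y] by simp
      show "\<exists>y. norm y \<le> 1 \<and> norm \<phi> / 2 \<le> blinfun_apply \<phi> y" for \<phi> :: "'a \<Rightarrow>\<^sub>L real"
      proof (rule ccontr)
        assume "\<not> ?thesis"
        then have *: "blinfun_apply \<phi> y < norm \<phi> / 2" if "norm y \<le> 1" for y using that by force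
        have "norm (blinfun_apply \<phi> y) \<le> norm \<phi> / 2 * norm y" for y
        proof (cases "y = 0")
          case False
          define e where "e = (1 / norm y) *\<^sub>R y"
          have "norm e \<le> 1" using False by (simp add: e_def)
          then have "blinfun_apply \<phi> e < norm \<phi> / 2" "blinfun_apply \<phi> (- e) < norm \<phi> / 2" using *[of e] *[of "- e"] by auto
          then have "\<bar>blinfun_apply \<phi> e\<bar> \<le> norm \<phi> / 2" by (simp add: blinfun.minus_right)
          then have "norm y * \<bar>blinfun_apply \<phi> e\<bar> \<le> norm y * (norm \<phi> / 2)" by (intro mult_left_mono) auto
          moreover have "blinfun_apply \<phi> e = blinfun_apply \<phi> y / norm y" by (simp add: e_def blinfun.scaleR_right)
          ultimately show ?thesis using False by (simp add: mult.commute)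
        qed simp
        then have "norm \<phi> \<le> norm \<phi> / 2" by (intro norm_blinfun_bound) auto
        then have "norm \<phi> = 0" using norm_ge_zero[of \<phi>] by linarith
        then show False using *[of 0] by simp
      qed
    qed
    have b\<sigma>: "bij_betw \<sigma> dyadic dyadic" "\<And>J. J \<in> dyadic \<Longrightarrow> inv_into dyadic \<sigma> J = \<tau> J"
      unfolding \<sigma>_def using bij_inv_into[OF bij] by auto
    have "preserves_carleson (inv_into dyadic \<sigma>)"
      by (rule preserves_carleson_cong[OF _ pt]) (simp add: b\<sigma>(2))
    then have hq: "haar_bdd TYPE('a \<Rightarrow>\<^sub>L real) q' \<sigma>"
      using haar_bdd_extrapolate_down[OF b\<sigma>(1) _ _ q'(1) qp' dual] ps by (simp add: \<sigma>_def)
    have "haar_bdd TYPE('a) q (inv_into dyadic \<sigma>)"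
    proof (rule haar_bdd_dual[where pair = "\<lambda>x \<phi>. blinfun_apply \<phi> x", OF _ _ _ b\<sigma>(1) q' hq])
      show "bounded_bilinear (\<lambda>(x :: 'a) (\<phi> :: 'a \<Rightarrow>\<^sub>L real). blinfun_apply \<phi> x)"
        by (rule bounded_bilinear.flip[OF bounded_bilinear_blinfun_apply])
      show "\<bar>blinfun_apply \<phi> x\<bar> \<le> norm x * norm \<phi>" for \<phi> :: "'a \<Rightarrow>\<^sub>L real" and x
        using norm_blinfun[of \<phi> x] by (simp add: mult.commute)
      show "\<exists>\<phi> :: 'a \<Rightarrow>\<^sub>L real. norm \<phi> \<le> 1 \<and> norm x / 2 \<le> blinfun_apply \<phi> x" for x :: 'a
        using norming_functional[of x] by (metis field_sum_of_halves le_add_same_cancel2 norm_ge_zero divide_nonneg_nonneg zero_le_numeral)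
    qed
    then show ?thesis by (rule haar_bdd_cong[rotated]) (simp add: b\<sigma>(2))
  qed
qed

lemma preserves_carleson_id: "preserves_carleson id"
  unfolding preserves_carleson_def
proof (intro allI)
  fix M :: real
  show "\<exists>M'\<ge>1. \<forall>C. carleson M C \<longrightarrow> carleson M' (id ` C)"
    by (intro exI[of _ "max M 1"]) (auto intro: carleson_mono)
qed

lemma UMD_haar_bdd_all:
  assumes "UMD_space TYPE('a::banach)" "p > 1"
  shows "haar_bdd TYPE('a) p id"
proof -
  obtain p0 where p0: "p0 > 1" "haar_bdd TYPE('a) p0 id" using UMD_haar_bdd[OF assms(1)] by blast
  have "preserves_carleson (inv_into dyadic id)"
    by (rule preserves_carleson_cong[OF _ preserves_carleson_id]) (simp add: inv_into_f_f[of id, simplified])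
  then show ?thesis by (intro haar_bdd_extrapolate[OF _ preserves_carleson_id _ p0(1) assms(2) p0(2)]) auto
qed

section \<open>Rearrangement norms and bounds on the grid\<close>

lemma haar_sum_eq_hsum:
  fixes a :: "real set \<Rightarrow> 'a::real_normed_vector"
  assumes "finite F" "{I \<in> dyadic. a I \<noteq> 0} \<subseteq> F"
  shows "haar_sum p \<tau> a = hsum p \<tau> (\<lambda>_. 1) a (F \<inter> dyadic)"
  unfolding haar_sum_def hsum_def using assms by (intro ext sum.mono_neutral_cong_left) auto

lemma Lp_norm_hsum:
  assumes "\<And>I. I \<in> F \<Longrightarrow> \<tau> I \<in> dyadic \<and> lev (\<tau> I) < N"
  shows "Lp_norm p (hsum p \<tau> \<theta> a F) = Lp_pow N p (hsum p \<tau> \<theta> a F) powr (1/p)"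
  using Lp_norm_stepfun[OF stepfun_hsum[OF assms]] by (simp add: Lp_pow_def)

text \<open>Homogeneity turns the supremum over the unit ball into an inequality for all families.
  When the input has norm zero, all its multiples stay in the ball, which forces the output to
  vanish.\<close>

lemma rearr_bdd_if_norm_finite:
  assumes p: "p > 1" and \<tau>: "\<And>J. J \<in> dyadic \<Longrightarrow> \<tau> J \<in> dyadic"
    and fin: "rearrangement_norm TYPE('a::real_normed_vector) p \<tau> < \<infinity>"
  shows "rearr_bdd TYPE('a) p \<tau>"
proof -
  define C where "C = enn2real (rearrangement_norm TYPE('a) p \<tau>)"
  have C0: "C \<ge> 0" by (simp add: C_def)
  have Ce: "ennreal C = rearrangement_norm TYPE('a) p \<tau>" using fin by (simp add: C_def)
  have le: "Lp_norm p (haar_sum p \<tau> a) \<le> C" if "fin_supp a" "Lp_norm p (haar_sum p id a) \<le> 1" for a :: "real set \<Rightarrow> 'a"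
  proof -
    have "ennreal (Lp_norm p (haar_sum p \<tau> a)) \<le> ennreal C"
      unfolding Ce rearrangement_norm_def using that by (intro SUP_upper) simp
    then show ?thesis using C0 by (simp add: ennreal_le_iff)
  qed
  have "Lp_pow N p (hsum p \<tau> (\<lambda>_. 1) a F) \<le> C powr p * Lp_pow N p (hsum p id (\<lambda>_. 1) a F)"
    if F: "F \<subseteq> dyadic" "\<forall>I\<in>F. lev I < N \<and> lev (\<tau> I) < N" for N F and a :: "real set \<Rightarrow> 'a"
  proof -
    have Ff: "finite F"
      by (rule finite_subset[OF _ finite_haar_upto[of N]]) (use F in \<open>auto simp: haar_upto_def\<close>)
    define X Y where "X = Lp_pow N p (hsum p id (\<lambda>_. 1) a F)" and "Y = Lp_pow N p (hsum p \<tau> (\<lambda>_. 1) a F)"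
    have XY: "X \<ge> 0" "Y \<ge> 0" by (auto simp: X_def Y_def)
    have scaled: "s * Y powr (1/p) \<le> C" if s: "s > 0" "s * X powr (1/p) \<le> 1" for s
    proof -
      define b where "b = (\<lambda>I. if I \<in> F then s *\<^sub>R a I else 0)"
      have hs: "haar_sum p \<rho> b = (\<lambda>t. s *\<^sub>R hsum p \<rho> (\<lambda>_. 1) a F t)" for \<rho>
      proof -
        have "haar_sum p \<rho> b = hsum p \<rho> (\<lambda>_. 1) b (F \<inter> dyadic)"
          using Ff by (intro haar_sum_eq_hsum) (auto simp: b_def)
        also have "F \<inter> dyadic = F" using F by blast
        also have "hsum p \<rho> (\<lambda>_. 1) b F = (\<lambda>t. s *\<^sub>R hsum p \<rho> (\<lambda>_. 1) a F t)"
          unfolding hsum_def scaleR_sum_right by (intro ext sum.cong refl) (simp add: b_def mult.commute)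
        finally show ?thesis .
      qed
      have norm_s: "Lp_norm p (\<lambda>t. s *\<^sub>R h t) = s * Lp_norm p h" if "stepfun N h" for h :: "real \<Rightarrow> 'a"
      proof -
        have "stepfun N (\<lambda>t. s *\<^sub>R h t)" using that unfolding stepfun_def by metis
        then show ?thesis using that s(1) p
          by (simp add: Lp_norm_stepfun powr_mult isum_cmult isum_nonneg powr_powr)
      qed
      have "stepfun N (hsum p \<tau> (\<lambda>_. 1) a F)" "Lp_norm p (hsum p \<tau> (\<lambda>_. 1) a F) = Y powr (1/p)"
        unfolding Y_def using F \<tau> by (intro stepfun_hsum Lp_norm_hsum; auto)+
      then have Le: "Lp_norm p (haar_sum p \<tau> b) = s * Y powr (1/p)" unfolding hs by (simp add: norm_s)
      have "stepfun N (hsum p id (\<lambda>_. 1) a F)" "Lp_norm p (hsum p id (\<lambda>_. 1) a F) = X powr (1/p)"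
        unfolding X_def using F by (intro stepfun_hsum Lp_norm_hsum; auto)+
      then have "Lp_norm p (haar_sum p id b) = s * X powr (1/p)" unfolding hs by (simp add: norm_s)
      moreover have "fin_supp b" unfolding fin_supp_def by (rule finite_subset[OF _ Ff]) (auto simp: b_def)
      ultimately show ?thesis using le[of b] s Le by simp
    qed
    have "Y powr (1/p) \<le> C * X powr (1/p)"
    proof (cases "X = 0")
      case True
      have "Y powr (1/p) \<le> 0"
      proof (rule ccontr)
        assume "\<not> ?thesis"
        then have y: "Y powr (1/p) > 0" by simp
        \<comment> \<open>The multiple is chosen to yield C + 1 at most C.\<close>
        have "(C + 1) / Y powr (1/p) * Y powr (1/p) \<le> C" using y C0 True by (intro scaled) auto
        then show False using y by simp
      qed
      then show ?thesis using True by simp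
    next
      case False
      then have "X powr (1/p) > 0" using XY by simp
      then show ?thesis using scaled[of "1 / X powr (1/p)"] by (simp add: field_simps)
    qed
    then have "(Y powr (1/p)) powr p \<le> (C * X powr (1/p)) powr p" using p by (intro powr_mono2) auto
    then show ?thesis using p XY C0 by (simp add: powr_mult powr_powr X_def Y_def)
  qed
  then show ?thesis unfolding rearr_bdd_def by (intro exI[of _ "C powr p"]) auto
qed

lemma norm_finite_if_haar_bdd:
  assumes p: "p > 1" and \<tau>: "\<And>J. J \<in> dyadic \<Longrightarrow> \<tau> J \<in> dyadic"
    and b: "haar_bdd TYPE('a::real_normed_vector) p \<tau>"
  shows "rearrangement_norm TYPE('a) p \<tau> < \<infinity>"
proof -
  obtain D where D: "D \<ge> 0" "\<And>N F (a :: real set \<Rightarrow> 'a) \<theta>. F \<subseteq> dyadic \<Longrightarrow> (\<forall>I\<in>F. lev I < N \<and> lev (\<tau> I) < N) \<Longrightarrow>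
     (\<forall>I. \<bar>\<theta> I\<bar> \<le> 1) \<Longrightarrow> Lp_pow N p (hsum p \<tau> \<theta> a F) \<le> D * Lp_pow N p (hsum p id (\<lambda>_. 1) a F)"
    using b unfolding haar_bdd_def by blast
  have "rearrangement_norm TYPE('a) p \<tau> \<le> ennreal (D powr (1/p))"
    unfolding rearrangement_norm_def
  proof (intro SUP_least ennreal_leI)
    fix a :: "real set \<Rightarrow> 'a" assume "a \<in> {a. fin_supp a \<and> Lp_norm p (haar_sum p id a) \<le> 1}"
    then have a: "fin_supp a" "Lp_norm p (haar_sum p id a) \<le> 1" by auto
    define F where "F = {I \<in> dyadic. a I \<noteq> 0}"
    have F: "finite F" "F \<subseteq> dyadic" using a(1) by (auto simp: F_def fin_supp_def)
    obtain N0 where N0: "\<And>n. n \<ge> N0 \<Longrightarrow> F \<union> \<tau> ` F \<subseteq> dyadic_upto n"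
      using finite_subset_upto[of "F \<union> \<tau> ` F"] F \<tau> by blast
    define N where "N = Suc N0"
    have lev: "lev I < N" "lev (\<tau> I) < N" if "I \<in> F" for I
      using N0[of N0] that by (auto simp: N_def dyadic_upto_def less_Suc_eq_le subset_iff)
    have hs: "haar_sum p \<rho> a = hsum p \<rho> (\<lambda>_. 1) a F" for \<rho>
    proof -
      have "F \<inter> dyadic = F" using F by blast
      then show ?thesis using haar_sum_eq_hsum[of F a p \<rho>] F by (simp add: F_def)
    qed
    have L: "Lp_norm p (haar_sum p \<tau> a) = Lp_pow N p (hsum p \<tau> (\<lambda>_. 1) a F) powr (1/p)"
      unfolding hs using F \<tau> lev by (intro Lp_norm_hsum) auto
    have L1: "Lp_norm p (haar_sum p id a) = Lp_pow N p (hsum p id (\<lambda>_. 1) a F) powr (1/p)"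
      unfolding hs using F lev by (intro Lp_norm_hsum) auto
    have "Lp_pow N p (hsum p \<tau> (\<lambda>_. 1) a F) \<le> D * Lp_pow N p (hsum p id (\<lambda>_. 1) a F)"
      using F lev by (intro D(2)) auto
    then have "Lp_pow N p (hsum p \<tau> (\<lambda>_. 1) a F) powr (1/p) \<le> (D * Lp_pow N p (hsum p id (\<lambda>_. 1) a F)) powr (1/p)"
      using p by (intro powr_mono2) auto
    also have "\<dots> = D powr (1/p) * Lp_norm p (haar_sum p id a)" using D(1) by (simp add: powr_mult L1)
    also have "\<dots> \<le> D powr (1/p)" using a(2) mult_left_mono[of _ 1 "D powr (1/p)"] by simp
    finally show "Lp_norm p (haar_sum p \<tau> a) \<le> D powr (1/p)" unfolding L .
  qed
  then show ?thesis by (rule le_less_trans) simp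
qed

text \<open>A unit vector placed on [0,1) is sent to one normalised Haar term of norm 1.
  Nonvanishing matters because 0 times infinity is 0 in \<open>ennreal\<close>, so a finite product
  by itself does not make the factors finite.\<close>

lemma norm_nonzero:
  assumes p: "p > 1" and \<tau>: "\<And>J. J \<in> dyadic \<Longrightarrow> \<tau> J \<in> dyadic" and x: "(x :: 'a::real_normed_vector) \<noteq> 0"
  shows "rearrangement_norm TYPE('a) p \<tau> \<noteq> 0"
proof -
  define U where "U = {0..<1::real}"
  have U: "U \<in> dyadic" "lev U = 0" using unit_dyadic by (auto simp: U_def)
  define e where "e = (1 / norm x) *\<^sub>R x"
  have e: "norm e = 1" using x by (simp add: e_def)
  define a where "a = (\<lambda>I. if I = U then e else 0)"
  have fs: "fin_supp a" unfolding fin_supp_def by (rule finite_subset[of _ "{U}"]) (auto simp: a_def)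
  have one: "Lp_norm p (haar_sum p \<rho> a) = 1" if \<rho>: "\<rho> U \<in> dyadic" for \<rho>
  proof -
    define K N where "K = \<rho> U" and "N = Suc (lev (\<rho> U))"
    have K: "K \<in> dyadic" "len K > 0" "lev K \<le> N" using \<rho> len_pos by (auto simp: K_def N_def)
    have "haar_sum p \<rho> a = hsum p \<rho> (\<lambda>_. 1) a ({U} \<inter> dyadic)" by (intro haar_sum_eq_hsum) (auto simp: a_def)
    moreover have "Lp_norm p (hsum p \<rho> (\<lambda>_. 1) a {U}) = Lp_pow N p (hsum p \<rho> (\<lambda>_. 1) a {U}) powr (1/p)"
      using \<rho> by (intro Lp_norm_hsum) (auto simp: N_def)
    ultimately have "Lp_norm p (haar_sum p \<rho> a) = Lp_pow N p (hsum p \<rho> (\<lambda>_. 1) a {U}) powr (1/p)"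
      using U by simp
    also have "Lp_pow N p (hsum p \<rho> (\<lambda>_. 1) a {U}) = isum N UNIV (\<lambda>t. indicator K t * (1 / len K))"
    proof -
      have "norm (hsum p \<rho> (\<lambda>_. 1) a {U} t) powr p = indicator K t * (1 / len K)" for t
      proof -
        have "norm (hsum p \<rho> (\<lambda>_. 1) a {U} t) = indicator K t / len K powr (1/p)"
          by (simp add: hsum_def a_def e abs_haar K_def)
        then show ?thesis using K p by (auto simp: powr_divide powr_powr indicator_def)
      qed
      then show ?thesis by (simp add: Lp_pow_def)
    qed
    also have "\<dots> = isum N K (\<lambda>t. indicator K t * (1 / len K))" by (rule isum_restrict) auto
    also have "\<dots> = (1 / len K) * len K" using K by (intro isum_const) auto
    finally show ?thesis using K by simp
  qed
  have "ennreal (Lp_norm p (haar_sum p \<tau> a)) \<le> rearrangement_norm TYPE('a) p \<tau>"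
    unfolding rearrangement_norm_def using fs one[of id] U by (intro SUP_upper) simp
  then show ?thesis using one[of \<tau>] \<tau>[OF U(1)] by auto
qed

text \<open>Scalar coefficients are placed along a fixed unit vector, which reduces the Carleson
  analysis to real Haar sums.\<close>

lemma rearr_bdd_real:
  assumes "rearr_bdd TYPE('a::real_normed_vector) p \<tau>" "(x :: 'a) \<noteq> 0"
  shows "rearr_bdd TYPE(real) p \<tau>"
proof -
  define e where "e = (1 / norm x) *\<^sub>R x"
  have e: "norm e = 1" using assms(2) by (simp add: e_def)
  obtain D where D: "D \<ge> 0" "\<And>N F (a :: real set \<Rightarrow> 'a). F \<subseteq> dyadic \<Longrightarrow> (\<forall>I\<in>F. lev I < N \<and> lev (\<tau> I) < N) \<Longrightarrow>
     Lp_pow N p (hsum p \<tau> (\<lambda>_. 1) a F) \<le> D * Lp_pow N p (hsum p id (\<lambda>_. 1) a F)"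
    using assms(1) unfolding rearr_bdd_def by blast
  have eq: "Lp_pow N p (hsum p \<rho> (\<lambda>_. 1) (\<lambda>I. \<alpha> I *\<^sub>R e) F) = Lp_pow N p (hsum p \<rho> (\<lambda>_. 1) \<alpha> F)" for N F \<rho> \<alpha>
  proof -
    have "hsum p \<rho> (\<lambda>_. 1) (\<lambda>I. \<alpha> I *\<^sub>R e) F t = hsum p \<rho> (\<lambda>_. 1) \<alpha> F t *\<^sub>R e" for t
      by (simp add: hsum_def scaleR_sum_left)
    then show ?thesis by (simp add: Lp_pow_def e)
  qed
  show ?thesis
    unfolding rearr_bdd_def
  proof (intro exI[of _ D] conjI allI impI)
    fix N F and \<alpha> :: "real set \<Rightarrow> real"
    assume "F \<subseteq> dyadic" "\<forall>I\<in>F. lev I < N \<and> lev (\<tau> I) < N"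
    from D(2)[OF this, of "\<lambda>I. \<alpha> I *\<^sub>R e"]
    show "Lp_pow N p (hsum p \<tau> (\<lambda>_. 1) \<alpha> F) \<le> D * Lp_pow N p (hsum p id (\<lambda>_. 1) \<alpha> F)" unfolding eq .
  qed (rule D(1))
qed

text \<open>The multipliers are absorbed into the coefficients of the input, where unconditionality
  of the Haar system controls them.\<close>

lemma haar_bdd_if_rearr_bdd:
  assumes b: "rearr_bdd TYPE('a::real_normed_vector) p \<tau>" and h: "haar_bdd TYPE('a) p id"
  shows "haar_bdd TYPE('a) p \<tau>"
proof -
  obtain D where D: "D \<ge> 0" "\<And>N F (a :: real set \<Rightarrow> 'a). F \<subseteq> dyadic \<Longrightarrow> (\<forall>I\<in>F. lev I < N \<and> lev (\<tau> I) < N) \<Longrightarrow>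
     Lp_pow N p (hsum p \<tau> (\<lambda>_. 1) a F) \<le> D * Lp_pow N p (hsum p id (\<lambda>_. 1) a F)"
    using b unfolding rearr_bdd_def by blast
  obtain D' where D': "D' \<ge> 0" "\<And>N F (a :: real set \<Rightarrow> 'a) \<theta>. F \<subseteq> dyadic \<Longrightarrow> (\<forall>I\<in>F. lev I < N \<and> lev (id I) < N) \<Longrightarrow>
     (\<forall>I. \<bar>\<theta> I\<bar> \<le> 1) \<Longrightarrow> Lp_pow N p (hsum p id \<theta> a F) \<le> D' * Lp_pow N p (hsum p id (\<lambda>_. 1) a F)"
    using h unfolding haar_bdd_def by blast
  have "Lp_pow N p (hsum p \<tau> \<theta> a F) \<le> (D * D') * Lp_pow N p (hsum p id (\<lambda>_. 1) a F)"
    if F: "F \<subseteq> dyadic" "\<forall>I\<in>F. lev I < N \<and> lev (\<tau> I) < N" and \<theta>: "\<forall>I. \<bar>\<theta> I\<bar> \<le> 1"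
    for N F \<theta> and a :: "real set \<Rightarrow> 'a"
  proof -
    have e: "hsum p \<rho> \<theta> a F = hsum p \<rho> (\<lambda>_. 1) (\<lambda>I. \<theta> I *\<^sub>R a I) F" for \<rho>
      unfolding hsum_def by (intro ext sum.cong refl) (simp add: mult.commute)
    have "Lp_pow N p (hsum p \<tau> \<theta> a F) \<le> D * Lp_pow N p (hsum p id \<theta> a F)" unfolding e by (rule D(2)[OF F])
    also have "\<dots> \<le> D * (D' * Lp_pow N p (hsum p id (\<lambda>_. 1) a F))" using F \<theta> D(1) by (intro mult_left_mono D'(2)) auto
    finally show ?thesis by simp
  qed
  then show ?thesis unfolding haar_bdd_def using D(1) D'(1) by (intro exI[of _ "D * D'"]) auto
qed

theorem theorem5p8:
  fixes \<tau> :: "real set \<Rightarrow> real set"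
  assumes "bij_betw \<tau> dyadic dyadic"
    and "\<exists>x::'a::complex_banach. x \<noteq> 0"
    and "UMD_space TYPE('a)"
    and "\<exists>p>1. p \<noteq> 2 \<and>
           rearrangement_norm TYPE('a) p \<tau> *
           rearrangement_norm TYPE('a) p (inv_into dyadic \<tau>) < \<infinity>"
  shows "\<forall>q>1. rearrangement_norm TYPE('a) q \<tau> *
           rearrangement_norm TYPE('a) q (inv_into dyadic \<tau>) < \<infinity>"
proof (intro allI impI)
  fix q :: real assume q: "q > 1"
  note bij = assms(1)
  define \<sigma> where "\<sigma> = inv_into dyadic \<tau>"
  have b\<sigma>: "bij_betw \<sigma> dyadic dyadic" "\<And>J. J \<in> dyadic \<Longrightarrow> \<tau> J = inv_into dyadic \<sigma> J"
    unfolding \<sigma>_def using bij_inv_into[OF bij] by auto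
  have D: "J \<in> dyadic \<Longrightarrow> \<tau> J \<in> dyadic" "J \<in> dyadic \<Longrightarrow> \<sigma> J \<in> dyadic" for J
    using bij b\<sigma>(1) by (metis bij_betw_apply)+
  obtain x :: 'a where x: "x \<noteq> 0" using assms(2) by blast
  obtain p where p: "p > 1" "p \<noteq> 2"
    and fin: "rearrangement_norm TYPE('a) p \<tau> * rearrangement_norm TYPE('a) p \<sigma> < \<infinity>"
    using assms(4) unfolding \<sigma>_def by blast
  \<comment> \<open>Both factors are nonzero, so finiteness of the product passes to each of
    them.\<close>
  have "rearrangement_norm TYPE('a) p \<tau> < \<infinity>" "rearrangement_norm TYPE('a) p \<sigma> < \<infinity>"
    using fin norm_nonzero[OF p(1) D(1) x] norm_nonzero[OF p(1) D(2) x]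
    by (auto simp: ennreal_mult_less_top)
  then have r: "rearr_bdd TYPE('a) p \<tau>" "rearr_bdd TYPE('a) p \<sigma>"
    using rearr_bdd_if_norm_finite[OF p(1)] D by blast+
  have rr: "rearr_bdd TYPE(real) p \<tau>" "rearr_bdd TYPE(real) p \<sigma>" using r x rearr_bdd_real by blast+
  have pt: "preserves_carleson \<tau>"
    using preserves_carleson_if_rearr_bdd[OF bij p rr(1)] rr(2) by (simp add: \<sigma>_def)
  have ps: "preserves_carleson \<sigma>"
    by (rule preserves_carleson_if_rearr_bdd[OF b\<sigma>(1) p rr(2) rearr_bdd_cong[OF b\<sigma>(2) rr(1)]])
  have h: "haar_bdd TYPE('a) p id" using UMD_haar_bdd_all[OF assms(3) p(1)] .
  have "haar_bdd TYPE('a) q \<tau>"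
    using haar_bdd_extrapolate[OF bij pt _ p(1) q haar_bdd_if_rearr_bdd[OF r(1) h]] ps by (simp add: \<sigma>_def)
  then have 1: "rearrangement_norm TYPE('a) q \<tau> < \<infinity>" using norm_finite_if_haar_bdd[OF q, of \<tau>] D(1) by blast
  have "haar_bdd TYPE('a) q \<sigma>"
    by (rule haar_bdd_extrapolate[OF b\<sigma>(1) ps preserves_carleson_cong[OF b\<sigma>(2) pt] p(1) q haar_bdd_if_rearr_bdd[OF r(2) h]])
  then have "rearrangement_norm TYPE('a) q \<sigma> < \<infinity>" using norm_finite_if_haar_bdd[OF q, of \<sigma>] D(2) by blast
  then show "rearrangement_norm TYPE('a) q \<tau> * rearrangement_norm TYPE('a) q (inv_into dyadic \<tau>) < \<infinity>"
    using 1 by (simp add: \<sigma>_def ennreal_mult_less_top)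
qed

end
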